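(* Let $X$ be a $\mathcal{B}$-clos graph with vertex set $\{0,\dots,n-1\}$, and let $\mathcal{O}_i^s$ ($0\le i\le n-1$, $0\le s\le r$) be the labelled orbits of the vertex stabilizers of $\mathrm{Aut}(X)$. Suppose that for every $s\in\{1,\dots,r\}$ there exist $j_s\in\mathcal{O}_0^s$, $k_s\in\{0,\dots,n-1\}$ and $t_s^1,t_s^2,t_s^3,t_s^4,t_s^5\in\{0,\dots,r\}$ such that $$\mathcal{O}_0^{t_s^1}\cap\mathcal{O}_{j_s}^{t_s^2}=\{k_s\},\qquad \mathcal{O}_0^{s}\cap\mathcal{O}_{k_s}^{t_s^4}=\{j_s\},\qquad \mathcal{O}_{k_s}^{t_s^5}\cap\mathcal{O}_{j_s}^{t_s^3}=\{0\}.$$ Then $X$ has no quantum symmetry.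
   Context: Let $X$ be a finite vertex-transitive graph with vertex set $\{0,\dots,n-1\}$, $G=\mathrm{Aut}(X)$, and $G_i$ the stabilizer of $i$ in $G$. Let $\mathcal{O}_0^0=\{0\},\mathcal{O}_0^1,\dots,\mathcal{O}_0^r$ be the $G_0$-orbits on $\{0,\dots,n-1\}$. For each $i$ put $\mathcal{O}_i^s=\sigma_i(\mathcal{O}_0^s)$, where $\sigma_i\in G$ is any element with $\sigma_i(0)=i$ (independent of the choice). Let $(e_0,\dots,e_{n-1})$ be the canonical basis of $\mathbb{C}^n$, let $T_s\in\mathrm{End}(\mathbb{C}^n)$ be given by $T_s(e_j)=\sum_{i\in\mathcal{O}_j^s}e_i$, and $\mathcal{T}^X=\mathrm{span}(T_0,\dots,T_r)$. A matrix over a unital $C^*$-algebra is magic unitary if its entries are projections, distinct entries in the same row or the same column are orthogonal, and each row and column sums to $1$. $A_s(n)$ is the universal unital $C^*$-algebra generated by the entries of an $n\times n$ magic unitary $u$, and $A(X)=A_s(n)/\langle d_Xu=ud_X\rangle$, where $d_X$ is the adjacency matrix of $X$. $C_{A(X)}(1,1)$ is the space of $T\in\mathrm{End}(\mathbb{C}^n)$ such that $Tu=uT$ in $M_n(A(X))$. The graph $X$ is called $\mathcal{B}$-clos if it is vertex-transitive and $C_{A(X)}(1,1)=\mathcal{T}^X$. $X$ has no quantum symmetry if $A(X)$ is commutative. *)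

theory Defs
  imports
    "HOL-Algebra.QuotRing"
    "HOL-Combinatorics.Permutations"
    "Jordan_Normal_Form.VS_Connect"
    "Graph_Theory.Pair_Digraph"
begin

section \<open>Unital C*-algebras\<close>

record 'a star_alg = "(complex, 'a) module" +
  star :: "'a \<Rightarrow> 'a"
  nrm :: "'a \<Rightarrow> real"

definition converges :: "'a star_alg \<Rightarrow> (nat \<Rightarrow> 'a) \<Rightarrow> 'a \<Rightarrow> bool" where
  "converges A X l \<longleftrightarrow> (\<lambda>k. nrm A (X k \<ominus>\<^bsub>A\<^esub> l)) \<longlonglongrightarrow> 0"

text \<open>The zero algebra is allowed.\<close>

locale cstar_algebra = Module.module "class_ring :: complex ring" A + ring A
  for A :: "'a star_alg" +
  assumes smult_mult_left:
      "\<lbrakk>x \<in> carrier A; y \<in> carrier A\<rbrakk> \<Longrightarrow> (c \<odot>\<^bsub>A\<^esub> x) \<otimes>\<^bsub>A\<^esub> y = c \<odot>\<^bsub>A\<^esub> (x \<otimes>\<^bsub>A\<^esub> y)"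
    and smult_mult_right:
      "\<lbrakk>x \<in> carrier A; y \<in> carrier A\<rbrakk> \<Longrightarrow> x \<otimes>\<^bsub>A\<^esub> (c \<odot>\<^bsub>A\<^esub> y) = c \<odot>\<^bsub>A\<^esub> (x \<otimes>\<^bsub>A\<^esub> y)"
    and star_closed: "x \<in> carrier A \<Longrightarrow> star A x \<in> carrier A"
    and star_star: "x \<in> carrier A \<Longrightarrow> star A (star A x) = x"
    and star_add: "\<lbrakk>x \<in> carrier A; y \<in> carrier A\<rbrakk> \<Longrightarrow> star A (x \<oplus>\<^bsub>A\<^esub> y) = star A x \<oplus>\<^bsub>A\<^esub> star A y"
    and star_smult: "x \<in> carrier A \<Longrightarrow> star A (c \<odot>\<^bsub>A\<^esub> x) = cnj c \<odot>\<^bsub>A\<^esub> star A x"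
    and star_mult: "\<lbrakk>x \<in> carrier A; y \<in> carrier A\<rbrakk> \<Longrightarrow> star A (x \<otimes>\<^bsub>A\<^esub> y) = star A y \<otimes>\<^bsub>A\<^esub> star A x"
    and nrm_nonneg: "x \<in> carrier A \<Longrightarrow> 0 \<le> nrm A x"
    and nrm_eq_0_iff: "x \<in> carrier A \<Longrightarrow> nrm A x = 0 \<longleftrightarrow> x = \<zero>\<^bsub>A\<^esub>"
    and nrm_triangle: "\<lbrakk>x \<in> carrier A; y \<in> carrier A\<rbrakk> \<Longrightarrow> nrm A (x \<oplus>\<^bsub>A\<^esub> y) \<le> nrm A x + nrm A y"
    and nrm_smult: "x \<in> carrier A \<Longrightarrow> nrm A (c \<odot>\<^bsub>A\<^esub> x) = cmod c * nrm A x"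
    and nrm_mult: "\<lbrakk>x \<in> carrier A; y \<in> carrier A\<rbrakk> \<Longrightarrow> nrm A (x \<otimes>\<^bsub>A\<^esub> y) \<le> nrm A x * nrm A y"
    and cstar_identity: "x \<in> carrier A \<Longrightarrow> nrm A (star A x \<otimes>\<^bsub>A\<^esub> x) = (nrm A x)\<^sup>2"
    and complete: "\<lbrakk>\<forall>k. X k \<in> carrier A; \<forall>e>0. \<exists>N. \<forall>k\<ge>N. \<forall>l\<ge>N. nrm A (X k \<ominus>\<^bsub>A\<^esub> X l) < e\<rbrakk>
      \<Longrightarrow> \<exists>x\<in>carrier A. converges A X x"

definition nrm_closed :: "'a star_alg \<Rightarrow> 'a set \<Rightarrow> bool" where
  "nrm_closed A D \<longleftrightarrow> (\<forall>X. \<forall>x\<in>carrier A. (\<forall>k. X k \<in> D) \<longrightarrow> converges A X x \<longrightarrow> x \<in> D)"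

definition cstar_subalgebra :: "'a star_alg \<Rightarrow> 'a set \<Rightarrow> bool" where
  "cstar_subalgebra A D \<longleftrightarrow> D \<subseteq> carrier A \<and> \<one>\<^bsub>A\<^esub> \<in> D \<and>
     (\<forall>x\<in>D. \<forall>y\<in>D. x \<oplus>\<^bsub>A\<^esub> y \<in> D \<and> x \<otimes>\<^bsub>A\<^esub> y \<in> D) \<and>
     (\<forall>x\<in>D. star A x \<in> D \<and> (\<forall>c. c \<odot>\<^bsub>A\<^esub> x \<in> D)) \<and> nrm_closed A D"

definition cstar_generated :: "'a star_alg \<Rightarrow> 'a set \<Rightarrow> 'a set" where
  "cstar_generated A S = \<Inter>{D. cstar_subalgebra A D \<and> S \<subseteq> D}"

definition star_hom :: "'a star_alg \<Rightarrow> 'b star_alg \<Rightarrow> ('a \<Rightarrow> 'b) set" where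
  "star_hom A B = {f \<in> Ring.ring_hom A B. \<forall>x\<in>carrier A.
     f (star A x) = star B (f x) \<and> (\<forall>c. f (c \<odot>\<^bsub>A\<^esub> x) = c \<odot>\<^bsub>B\<^esub> f x)}"

text \<open>Closed two-sided ideals, and the quotient with its quotient norm. The ring structure is that
  of \<^term>\<open>A Quot I\<close>.\<close>

definition closed_ideal_generated :: "'a star_alg \<Rightarrow> 'a set \<Rightarrow> 'a set" where
  "closed_ideal_generated A S = \<Inter>{I. ideal I A \<and> nrm_closed A I \<and> S \<subseteq> I}"

definition cstar_quotient :: "'a star_alg \<Rightarrow> 'a set \<Rightarrow> 'a set star_alg" where
  "cstar_quotient A I =
     \<lparr>carrier = carrier (A Quot I), monoid.mult = monoid.mult (A Quot I), one = one (A Quot I),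
      zero = zero (A Quot I), add = add (A Quot I),
      smult = (\<lambda>c K. \<Union>x\<in>K. I +>\<^bsub>A\<^esub> (c \<odot>\<^bsub>A\<^esub> x)),
      star = (\<lambda>K. \<Union>x\<in>K. I +>\<^bsub>A\<^esub> star A x),
      nrm = (\<lambda>K. INF x\<in>K. nrm A x)\<rparr>"


section \<open>Magic unitaries and the algebra \<open>A\<^sub>s(n)\<close>\<close>

text \<open>Only the entries \<open>u i j\<close> with \<open>i, j < n\<close> matter.\<close>

definition magic_unitary :: "'a star_alg \<Rightarrow> nat \<Rightarrow> (nat \<Rightarrow> nat \<Rightarrow> 'a) \<Rightarrow> bool" where
  "magic_unitary A n u \<longleftrightarrow>
     (\<forall>i<n. \<forall>j<n. u i j \<in> carrier A \<and> star A (u i j) = u i j \<and> u i j \<otimes>\<^bsub>A\<^esub> u i j = u i j) \<and>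
     (\<forall>i<n. \<forall>j<n. \<forall>k<n. j \<noteq> k \<longrightarrow>
        u i j \<otimes>\<^bsub>A\<^esub> u i k = \<zero>\<^bsub>A\<^esub> \<and> u j i \<otimes>\<^bsub>A\<^esub> u k i = \<zero>\<^bsub>A\<^esub>) \<and>
     (\<forall>i<n. (\<Oplus>\<^bsub>A\<^esub>j\<in>{..<n}. u i j) = \<one>\<^bsub>A\<^esub> \<and> (\<Oplus>\<^bsub>A\<^esub>j\<in>{..<n}. u j i) = \<one>\<^bsub>A\<^esub>)"

definition bounded_product :: "'i set \<Rightarrow> ('i \<Rightarrow> 'a star_alg) \<Rightarrow> ('i \<Rightarrow> 'a) star_alg" where
  "bounded_product I B =
     \<lparr>carrier = {f \<in> (\<Pi>\<^sub>E i\<in>I. carrier (B i)). bdd_above ((\<lambda>i. nrm (B i) (f i)) ` I)},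
      monoid.mult = (\<lambda>f g. \<lambda>i\<in>I. f i \<otimes>\<^bsub>B i\<^esub> g i),
      one = (\<lambda>i\<in>I. \<one>\<^bsub>B i\<^esub>),
      zero = (\<lambda>i\<in>I. \<zero>\<^bsub>B i\<^esub>),
      add = (\<lambda>f g. \<lambda>i\<in>I. f i \<oplus>\<^bsub>B i\<^esub> g i),
      smult = (\<lambda>c f. \<lambda>i\<in>I. c \<odot>\<^bsub>B i\<^esub> f i),
      star = (\<lambda>f. \<lambda>i\<in>I. star (B i) (f i)),
      nrm = (\<lambda>f. Sup (insert 0 ((\<lambda>i. nrm (B i) (f i)) ` I)))\<rparr>"

text \<open>\<open>A\<^sub>s(n)\<close> is the C*-algebra generated by the universal magic unitary inside the bounded
  product of all pairs \<open>(B, v)\<close> of a C*-algebra \<open>B\<close> and a magic unitary \<open>v\<close> over it. HOL cannot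
  quantify over all types here, so \<open>B\<close> ranges over the C*-algebras on subsets of one type. That
  type has to be large enough for a copy of every C*-algebra generated by the entries of a magic
  unitary; sequences of *-polynomials suffice, because every element of such an algebra is the
  limit of a sequence of *-polynomials in the entries. The universal property with respect to
  C*-algebras on arbitrary types is \<open>A_s_universal\<close> below.\<close>

datatype star_poly =
  Gen nat nat | Const complex | Add star_poly star_poly | Mul star_poly star_poly | Star star_poly

type_synonym test = "nat \<Rightarrow> star_poly"

definition magic_pairs :: "nat \<Rightarrow> (test star_alg \<times> (nat \<Rightarrow> nat \<Rightarrow> test)) set" where
  "magic_pairs n = {(B, v). cstar_algebra B \<and> magic_unitary B n v}"

type_synonym univ = "test star_alg \<times> (nat \<Rightarrow> nat \<Rightarrow> test) \<Rightarrow> test"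

definition A_s_entry :: "nat \<Rightarrow> nat \<Rightarrow> nat \<Rightarrow> univ" where
  "A_s_entry n i j = (\<lambda>(B, v)\<in>magic_pairs n. v i j)"

definition A_s :: "nat \<Rightarrow> univ star_alg" where
  "A_s n = (let P = bounded_product (magic_pairs n) fst in
     P\<lparr>carrier := cstar_generated P {A_s_entry n i j | i j. i < n \<and> j < n}\<rparr>)"


section \<open>Graphs, their automorphisms and orbits\<close>

definition graph_on :: "nat \<Rightarrow> nat pair_pre_digraph \<Rightarrow> bool" where
  "graph_on n X \<longleftrightarrow> pair_graph X \<and> pverts X = {..<n}"

definition adjacency_matrix :: "nat \<Rightarrow> nat pair_pre_digraph \<Rightarrow> complex mat" where
  "adjacency_matrix n X = mat n n (\<lambda>(i, j). if (i, j) \<in> parcs X then 1 else 0)"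

definition aut :: "nat pair_pre_digraph \<Rightarrow> (nat \<Rightarrow> nat) set" where
  "aut X = {\<sigma>. \<sigma> permutes pverts X \<and>
     (\<forall>i\<in>pverts X. \<forall>j\<in>pverts X. (\<sigma> i, \<sigma> j) \<in> parcs X \<longleftrightarrow> (i, j) \<in> parcs X)}"

definition vertex_transitive :: "nat pair_pre_digraph \<Rightarrow> bool" where
  "vertex_transitive X \<longleftrightarrow> (\<forall>i\<in>pverts X. \<forall>j\<in>pverts X. \<exists>\<sigma>\<in>aut X. \<sigma> i = j)"

definition stabilizer :: "nat pair_pre_digraph \<Rightarrow> nat \<Rightarrow> (nat \<Rightarrow> nat) set" where
  "stabilizer X i = {\<sigma> \<in> aut X. \<sigma> i = i}"

definition orbits_0 :: "nat pair_pre_digraph \<Rightarrow> nat set set" where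
  "orbits_0 X = {(\<lambda>\<sigma>. \<sigma> j) ` stabilizer X 0 | j. j \<in> pverts X}"

text \<open>\<open>moved_orbit X S i\<close> is \<open>\<sigma>\<^sub>i(S)\<close>; it is independent of the choice of \<open>\<sigma>\<^sub>i\<close>, see
  \<open>moved_orbit_eq\<close>.\<close>

definition moved_orbit :: "nat pair_pre_digraph \<Rightarrow> nat set \<Rightarrow> nat \<Rightarrow> nat set" where
  "moved_orbit X S i = (SOME \<sigma>. \<sigma> \<in> aut X \<and> \<sigma> 0 = i) ` S"

text \<open>\<open>L s\<close> is the \<open>s\<close>-th orbit of the stabilizer of \<open>0\<close>, and \<open>labelled_orbit X L i s\<close> is
  \<open>O\<^sub>i\<^sup>s\<close>.\<close>

definition orbit_labelling :: "nat pair_pre_digraph \<Rightarrow> nat \<Rightarrow> (nat \<Rightarrow> nat set) \<Rightarrow> bool" where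
  "orbit_labelling X r L \<longleftrightarrow> bij_betw L {0..r} (orbits_0 X) \<and> L 0 = {0}"

abbreviation labelled_orbit :: "nat pair_pre_digraph \<Rightarrow> (nat \<Rightarrow> nat set) \<Rightarrow> nat \<Rightarrow> nat \<Rightarrow> nat set" where
  "labelled_orbit X L i s \<equiv> moved_orbit X (L s) i"

text \<open>The matrix of the operator sending \<open>e\<^sub>j\<close> to the sum of the \<open>e\<^sub>i\<close> with \<open>i \<in> \<sigma>\<^sub>j(S)\<close>.\<close>

definition orbit_matrix :: "nat \<Rightarrow> nat pair_pre_digraph \<Rightarrow> nat set \<Rightarrow> complex mat" where
  "orbit_matrix n X S = mat n n (\<lambda>(i, j). if i \<in> moved_orbit X S j then 1 else 0)"

definition T_space :: "nat \<Rightarrow> nat pair_pre_digraph \<Rightarrow> complex mat set" where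
  "T_space n X = LinearCombinations.module.span class_ring (module_mat TYPE(complex) n n)
     (orbit_matrix n X ` orbits_0 X)"


section \<open>The quantum automorphism group\<close>

text \<open>Entries of \<open>T u\<close> and of \<open>u T\<close> for a scalar matrix \<open>T\<close> and a matrix \<open>u\<close> over \<open>A\<close>.\<close>

definition scalar_mat_mult :: "'a star_alg \<Rightarrow> nat \<Rightarrow> complex mat \<Rightarrow> (nat \<Rightarrow> nat \<Rightarrow> 'a) \<Rightarrow> nat \<Rightarrow> nat \<Rightarrow> 'a"
  where "scalar_mat_mult A n T u i j = (\<Oplus>\<^bsub>A\<^esub>k\<in>{..<n}. T $$ (i, k) \<odot>\<^bsub>A\<^esub> u k j)"

definition mat_scalar_mult :: "'a star_alg \<Rightarrow> nat \<Rightarrow> (nat \<Rightarrow> nat \<Rightarrow> 'a) \<Rightarrow> complex mat \<Rightarrow> nat \<Rightarrow> nat \<Rightarrow> 'a"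
  where "mat_scalar_mult A n u T i j = (\<Oplus>\<^bsub>A\<^esub>k\<in>{..<n}. T $$ (k, j) \<odot>\<^bsub>A\<^esub> u i k)"

definition A_ideal :: "nat \<Rightarrow> nat pair_pre_digraph \<Rightarrow> univ set" where
  "A_ideal n X = (let d = adjacency_matrix n X in
     closed_ideal_generated (A_s n)
       {scalar_mat_mult (A_s n) n d (A_s_entry n) i j
          \<ominus>\<^bsub>A_s n\<^esub> mat_scalar_mult (A_s n) n (A_s_entry n) d i j | i j. i < n \<and> j < n})"

definition A_graph :: "nat \<Rightarrow> nat pair_pre_digraph \<Rightarrow> univ set star_alg" where
  "A_graph n X = cstar_quotient (A_s n) (A_ideal n X)"

definition A_graph_entry :: "nat \<Rightarrow> nat pair_pre_digraph \<Rightarrow> nat \<Rightarrow> nat \<Rightarrow> univ set" where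
  "A_graph_entry n X i j = A_ideal n X +>\<^bsub>A_s n\<^esub> A_s_entry n i j"

definition intertwiners :: "nat \<Rightarrow> nat pair_pre_digraph \<Rightarrow> complex mat set" where
  "intertwiners n X = {T \<in> carrier_mat n n. \<forall>i<n. \<forall>j<n.
     scalar_mat_mult (A_graph n X) n T (A_graph_entry n X) i j =
     mat_scalar_mult (A_graph n X) n (A_graph_entry n X) T i j}"

definition B_clos :: "nat \<Rightarrow> nat pair_pre_digraph \<Rightarrow> bool" where
  "B_clos n X \<longleftrightarrow> graph_on n X \<and> vertex_transitive X \<and> intertwiners n X = T_space n X"

definition no_quantum_symmetry :: "nat \<Rightarrow> nat pair_pre_digraph \<Rightarrow> bool" where
  "no_quantum_symmetry n X \<longleftrightarrow>
     (\<forall>a\<in>carrier (A_graph n X). \<forall>b\<in>carrier (A_graph n X).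
        a \<otimes>\<^bsub>A_graph n X\<^esub> b = b \<otimes>\<^bsub>A_graph n X\<^esub> a)"


lemma moved_orbit_eq:
  assumes S: "S \<in> orbits_0 X" and s: "\<sigma> \<in> aut X" "\<sigma> 0 = i" 
  shows "moved_orbit X S i = \<sigma> ` S"
proof -
  define \<tau> where "\<tau> = (SOME \<tau>. \<tau> \<in> aut X \<and> \<tau> 0 = i)"
  have t: "\<tau> \<in> aut X" "\<tau> 0 = i"
    unfolding \<tau>_def using someI[of "\<lambda>\<tau>. \<tau> \<in> aut X \<and> \<tau> 0 = i"] s by blast+
  have comp: "p \<circ> q \<in> aut X" if "p \<in> aut X" "q \<in> aut X" for p q
    using that by (auto simp: aut_def permutes_compose permutes_in_image)
  have inv: "inv_into UNIV p \<in> aut X" if "p \<in> aut X" for p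
  proof -
    have p: "p permutes pverts X" using that by (simp add: aut_def)
    have "(inv_into UNIV p i, inv_into UNIV p j) \<in> parcs X \<longleftrightarrow> (i, j) \<in> parcs X"
      if "i \<in> pverts X" "j \<in> pverts X" for i j
    proof -
      have "inv_into UNIV p i \<in> pverts X" "inv_into UNIV p j \<in> pverts X"
        using that p by (simp_all add: permutes_inv permutes_in_image)
      moreover have "p (inv_into UNIV p i) = i" "p (inv_into UNIV p j) = j"
        using p by (simp_all add: permutes_inverses)
      ultimately show ?thesis using \<open>p \<in> aut X\<close> unfolding aut_def
        by (metis (mono_tags, lifting) mem_Collect_eq)
    qed
    then show ?thesis using p by (simp add: aut_def permutes_inv)
  qed
  have sub: "p ` S \<subseteq> q ` S" if p: "p \<in> aut X" "p 0 = i" and q: "q \<in> aut X" "q 0 = i" for p q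
  proof
    fix y assume "y \<in> p ` S"
    then obtain x where x: "x \<in> S" "y = p x" by blast
    obtain j where j: "S = (\<lambda>\<sigma>. \<sigma> j) ` stabilizer X 0" using S by (auto simp: orbits_0_def)
    obtain g where g: "g \<in> stabilizer X 0" "x = g j" using x j by blast
    have qp: "q permutes pverts X" using q by (simp add: aut_def)
    have "inv_into UNIV q \<circ> p \<circ> g \<in> stabilizer X 0"
      using g p q comp inv qp unfolding stabilizer_def
      by (auto simp: permutes_inverses inv_f_eq permutes_inj)
    then have "(inv_into UNIV q \<circ> p \<circ> g) j \<in> S" using j by blast
    moreover have "q ((inv_into UNIV q \<circ> p \<circ> g) j) = y" using qp x g by (simp add: permutes_inverses)
    ultimately show "y \<in> q ` S" by (metis imageI)
  qed
  show ?thesis using sub[OF t s] sub[OF s t] unfolding moved_orbit_def \<tau>_def by blast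
qed

section \<open>C*-algebra constructions\<close>

lemma cstar_algebra_ring: "cstar_algebra A \<Longrightarrow> ring A"
  by (simp add: cstar_algebra_def)

lemma cstar_algebra_module: "cstar_algebra A \<Longrightarrow> Module.module (class_ring :: complex ring) A"
  by (simp add: cstar_algebra_def)

lemma cstar_smult:
  assumes A: "cstar_algebra A" and x: "x \<in> carrier A"
  shows "c \<odot>\<^bsub>A\<^esub> x \<in> carrier A"
    and "(a + b) \<odot>\<^bsub>A\<^esub> x = a \<odot>\<^bsub>A\<^esub> x \<oplus>\<^bsub>A\<^esub> b \<odot>\<^bsub>A\<^esub> x"
    and "y \<in> carrier A \<Longrightarrow> c \<odot>\<^bsub>A\<^esub> (x \<oplus>\<^bsub>A\<^esub> y) = c \<odot>\<^bsub>A\<^esub> x \<oplus>\<^bsub>A\<^esub> c \<odot>\<^bsub>A\<^esub> y"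
    and "(a * b) \<odot>\<^bsub>A\<^esub> x = a \<odot>\<^bsub>A\<^esub> (b \<odot>\<^bsub>A\<^esub> x)"
    and "1 \<odot>\<^bsub>A\<^esub> x = x"
    and "0 \<odot>\<^bsub>A\<^esub> x = \<zero>\<^bsub>A\<^esub>"
    and "(- 1) \<odot>\<^bsub>A\<^esub> x = \<ominus>\<^bsub>A\<^esub> x"
proof -
  note M = cstar_algebra_module[OF A]
  interpret A: ring A by (rule cstar_algebra_ring[OF A])
  show 1: "\<And>c. c \<odot>\<^bsub>A\<^esub> x \<in> carrier A"
    using Module.module.smult_closed[OF M] x by (simp add: class_ring_simps)
  show 2: "\<And>a b. (a + b) \<odot>\<^bsub>A\<^esub> x = a \<odot>\<^bsub>A\<^esub> x \<oplus>\<^bsub>A\<^esub> b \<odot>\<^bsub>A\<^esub> x"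
    using Module.module.smult_l_distr[OF M] x by (simp add: class_ring_simps)
  show "c \<odot>\<^bsub>A\<^esub> (x \<oplus>\<^bsub>A\<^esub> y) = c \<odot>\<^bsub>A\<^esub> x \<oplus>\<^bsub>A\<^esub> c \<odot>\<^bsub>A\<^esub> y" if "y \<in> carrier A"
    using Module.module.smult_r_distr[OF M] x that by (simp add: class_ring_simps)
  show "(a * b) \<odot>\<^bsub>A\<^esub> x = a \<odot>\<^bsub>A\<^esub> (b \<odot>\<^bsub>A\<^esub> x)"
    using Module.module.smult_assoc1[OF M] x by (simp add: class_ring_simps)
  show 3: "1 \<odot>\<^bsub>A\<^esub> x = x"
    using Module.module.smult_one[OF M] x by (simp add: class_ring_simps)
  have "0 \<odot>\<^bsub>A\<^esub> x \<oplus>\<^bsub>A\<^esub> 0 \<odot>\<^bsub>A\<^esub> x = 0 \<odot>\<^bsub>A\<^esub> x" using 2[of 0 0] by simp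
  then show 4: "0 \<odot>\<^bsub>A\<^esub> x = \<zero>\<^bsub>A\<^esub>" using 1[of 0] by (metis A.add.r_cancel_one')
  have "(- 1) \<odot>\<^bsub>A\<^esub> x \<oplus>\<^bsub>A\<^esub> x = \<zero>\<^bsub>A\<^esub>" using 2[of "-1" 1] 3 4 by simp
  then show "(- 1) \<odot>\<^bsub>A\<^esub> x = \<ominus>\<^bsub>A\<^esub> x" using 1 x by (metis A.minus_equality)
qed

lemma cstar_minus:
  assumes "cstar_algebra A" "x \<in> carrier A" "y \<in> carrier A"
  shows "x \<ominus>\<^bsub>A\<^esub> y = x \<oplus>\<^bsub>A\<^esub> (- 1) \<odot>\<^bsub>A\<^esub> y" "x \<ominus>\<^bsub>A\<^esub> y \<in> carrier A"
proof -
  interpret A: ring A by (rule cstar_algebra_ring[OF assms(1)])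
  show "x \<ominus>\<^bsub>A\<^esub> y = x \<oplus>\<^bsub>A\<^esub> (- 1) \<odot>\<^bsub>A\<^esub> y"
    using cstar_smult(7)[OF assms(1,3)] by (simp add: a_minus_def)
  show "x \<ominus>\<^bsub>A\<^esub> y \<in> carrier A" using assms by simp
qed

lemma cstar_algebraI:
  fixes A :: "'a star_alg"
  assumes add_closed: "\<And>x y. \<lbrakk>x \<in> carrier A; y \<in> carrier A\<rbrakk> \<Longrightarrow> x \<oplus>\<^bsub>A\<^esub> y \<in> carrier A"
    and mult_closed: "\<And>x y. \<lbrakk>x \<in> carrier A; y \<in> carrier A\<rbrakk> \<Longrightarrow> x \<otimes>\<^bsub>A\<^esub> y \<in> carrier A"
    and zero: "\<zero>\<^bsub>A\<^esub> \<in> carrier A" and one: "\<one>\<^bsub>A\<^esub> \<in> carrier A"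
    and sm: "\<And>c x. x \<in> carrier A \<Longrightarrow> c \<odot>\<^bsub>A\<^esub> x \<in> carrier A"
    and st: "\<And>x. x \<in> carrier A \<Longrightarrow> star A x \<in> carrier A"
    and add_assoc: "\<And>x y z. \<lbrakk>x \<in> carrier A; y \<in> carrier A; z \<in> carrier A\<rbrakk> \<Longrightarrow>
      x \<oplus>\<^bsub>A\<^esub> y \<oplus>\<^bsub>A\<^esub> z = x \<oplus>\<^bsub>A\<^esub> (y \<oplus>\<^bsub>A\<^esub> z)"
    and add_comm: "\<And>x y. \<lbrakk>x \<in> carrier A; y \<in> carrier A\<rbrakk> \<Longrightarrow> x \<oplus>\<^bsub>A\<^esub> y = y \<oplus>\<^bsub>A\<^esub> x"
    and add_zero: "\<And>x. x \<in> carrier A \<Longrightarrow> \<zero>\<^bsub>A\<^esub> \<oplus>\<^bsub>A\<^esub> x = x"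
    and add_inv: "\<And>x. x \<in> carrier A \<Longrightarrow> (- 1) \<odot>\<^bsub>A\<^esub> x \<oplus>\<^bsub>A\<^esub> x = \<zero>\<^bsub>A\<^esub>"
    and mult_assoc: "\<And>x y z. \<lbrakk>x \<in> carrier A; y \<in> carrier A; z \<in> carrier A\<rbrakk> \<Longrightarrow>
      x \<otimes>\<^bsub>A\<^esub> y \<otimes>\<^bsub>A\<^esub> z = x \<otimes>\<^bsub>A\<^esub> (y \<otimes>\<^bsub>A\<^esub> z)"
    and l_one: "\<And>x. x \<in> carrier A \<Longrightarrow> \<one>\<^bsub>A\<^esub> \<otimes>\<^bsub>A\<^esub> x = x"
    and r_one: "\<And>x. x \<in> carrier A \<Longrightarrow> x \<otimes>\<^bsub>A\<^esub> \<one>\<^bsub>A\<^esub> = x"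
    and l_distr: "\<And>x y z. \<lbrakk>x \<in> carrier A; y \<in> carrier A; z \<in> carrier A\<rbrakk> \<Longrightarrow>
      (x \<oplus>\<^bsub>A\<^esub> y) \<otimes>\<^bsub>A\<^esub> z = x \<otimes>\<^bsub>A\<^esub> z \<oplus>\<^bsub>A\<^esub> y \<otimes>\<^bsub>A\<^esub> z"
    and r_distr: "\<And>x y z. \<lbrakk>x \<in> carrier A; y \<in> carrier A; z \<in> carrier A\<rbrakk> \<Longrightarrow>
      z \<otimes>\<^bsub>A\<^esub> (x \<oplus>\<^bsub>A\<^esub> y) = z \<otimes>\<^bsub>A\<^esub> x \<oplus>\<^bsub>A\<^esub> z \<otimes>\<^bsub>A\<^esub> y"
    and sm_add: "\<And>a b x. x \<in> carrier A \<Longrightarrow> (a + b) \<odot>\<^bsub>A\<^esub> x = a \<odot>\<^bsub>A\<^esub> x \<oplus>\<^bsub>A\<^esub> b \<odot>\<^bsub>A\<^esub> x"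
    and add_sm: "\<And>c x y. \<lbrakk>x \<in> carrier A; y \<in> carrier A\<rbrakk> \<Longrightarrow>
      c \<odot>\<^bsub>A\<^esub> (x \<oplus>\<^bsub>A\<^esub> y) = c \<odot>\<^bsub>A\<^esub> x \<oplus>\<^bsub>A\<^esub> c \<odot>\<^bsub>A\<^esub> y"
    and sm_sm: "\<And>a b x. x \<in> carrier A \<Longrightarrow> (a * b) \<odot>\<^bsub>A\<^esub> x = a \<odot>\<^bsub>A\<^esub> (b \<odot>\<^bsub>A\<^esub> x)"
    and sm_one: "\<And>x. x \<in> carrier A \<Longrightarrow> 1 \<odot>\<^bsub>A\<^esub> x = x"
    and rest: "\<And>x y c. \<lbrakk>x \<in> carrier A; y \<in> carrier A\<rbrakk> \<Longrightarrow> (c \<odot>\<^bsub>A\<^esub> x) \<otimes>\<^bsub>A\<^esub> y = c \<odot>\<^bsub>A\<^esub> (x \<otimes>\<^bsub>A\<^esub> y)"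
      "\<And>x y c. \<lbrakk>x \<in> carrier A; y \<in> carrier A\<rbrakk> \<Longrightarrow> x \<otimes>\<^bsub>A\<^esub> (c \<odot>\<^bsub>A\<^esub> y) = c \<odot>\<^bsub>A\<^esub> (x \<otimes>\<^bsub>A\<^esub> y)"
      "\<And>x. x \<in> carrier A \<Longrightarrow> star A (star A x) = x"
      "\<And>x y. \<lbrakk>x \<in> carrier A; y \<in> carrier A\<rbrakk> \<Longrightarrow> star A (x \<oplus>\<^bsub>A\<^esub> y) = star A x \<oplus>\<^bsub>A\<^esub> star A y"
      "\<And>x c. x \<in> carrier A \<Longrightarrow> star A (c \<odot>\<^bsub>A\<^esub> x) = cnj c \<odot>\<^bsub>A\<^esub> star A x"
      "\<And>x y. \<lbrakk>x \<in> carrier A; y \<in> carrier A\<rbrakk> \<Longrightarrow> star A (x \<otimes>\<^bsub>A\<^esub> y) = star A y \<otimes>\<^bsub>A\<^esub> star A x"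
      "\<And>x. x \<in> carrier A \<Longrightarrow> 0 \<le> nrm A x"
      "\<And>x. x \<in> carrier A \<Longrightarrow> nrm A x = 0 \<longleftrightarrow> x = \<zero>\<^bsub>A\<^esub>"
      "\<And>x y. \<lbrakk>x \<in> carrier A; y \<in> carrier A\<rbrakk> \<Longrightarrow> nrm A (x \<oplus>\<^bsub>A\<^esub> y) \<le> nrm A x + nrm A y"
      "\<And>x c. x \<in> carrier A \<Longrightarrow> nrm A (c \<odot>\<^bsub>A\<^esub> x) = cmod c * nrm A x"
      "\<And>x y. \<lbrakk>x \<in> carrier A; y \<in> carrier A\<rbrakk> \<Longrightarrow> nrm A (x \<otimes>\<^bsub>A\<^esub> y) \<le> nrm A x * nrm A y"
      "\<And>x. x \<in> carrier A \<Longrightarrow> nrm A (star A x \<otimes>\<^bsub>A\<^esub> x) = (nrm A x)\<^sup>2"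
    and complete: "\<And>X. \<lbrakk>\<And>k. X k \<in> carrier A;
        \<And>e. e > 0 \<Longrightarrow> \<exists>N. \<forall>k\<ge>N. \<forall>l\<ge>N. nrm A (X k \<oplus>\<^bsub>A\<^esub> (- 1) \<odot>\<^bsub>A\<^esub> X l) < e\<rbrakk>
      \<Longrightarrow> \<exists>x\<in>carrier A. (\<lambda>k. nrm A (X k \<oplus>\<^bsub>A\<^esub> (- 1) \<odot>\<^bsub>A\<^esub> x)) \<longlonglongrightarrow> 0"
  shows "cstar_algebra A"
proof -
  have ab: "abelian_group A"
  proof (rule abelian_groupI)
    fix x assume "x \<in> carrier A"
    then show "\<exists>y\<in>carrier A. y \<oplus>\<^bsub>A\<^esub> x = \<zero>\<^bsub>A\<^esub>" using sm add_inv by blast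
  qed (fact add_closed zero add_assoc add_comm add_zero)+
  have mon: "Group.monoid A"
    by (intro Group.monoidI) (auto simp: mult_closed one mult_assoc l_one r_one)
  have ring: "ring A" using l_distr r_distr by (intro ringI ab mon) auto
  interpret A: ring A by (rule ring)
  have mod: "Module.module (class_ring :: complex ring) A"
    by (intro Module.moduleI class_cring.is_cring ab)
      (auto simp: class_ring_simps sm sm_add add_sm sm_sm sm_one)
  have min: "x \<ominus>\<^bsub>A\<^esub> y = x \<oplus>\<^bsub>A\<^esub> (- 1) \<odot>\<^bsub>A\<^esub> y" if "x \<in> carrier A" "y \<in> carrier A" for x y
    using A.minus_equality[OF add_inv] that sm by (simp add: a_minus_def)
  show ?thesis
  proof (intro cstar_algebra.intro cstar_algebra_axioms.intro mod ring)
    fix X :: "nat \<Rightarrow> 'a"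
    assume X: "\<forall>k. X k \<in> carrier A"
      and C: "\<forall>e>0. \<exists>N. \<forall>k\<ge>N. \<forall>l\<ge>N. nrm A (X k \<ominus>\<^bsub>A\<^esub> X l) < e"
    have "\<exists>x\<in>carrier A. (\<lambda>k. nrm A (X k \<oplus>\<^bsub>A\<^esub> (- 1) \<odot>\<^bsub>A\<^esub> x)) \<longlonglongrightarrow> 0"
      using X C by (intro complete) (simp_all add: min)
    then show "\<exists>x\<in>carrier A. converges A X x" using X by (auto simp: converges_def min)
  qed (fact st rest)+
qed

lemma cstar_star_one:
  assumes A: "cstar_algebra A"
  shows "star A \<one>\<^bsub>A\<^esub> = \<one>\<^bsub>A\<^esub>"
proof -
  interpret A: ring A by (rule cstar_algebra_ring[OF A])
  have "star A \<one>\<^bsub>A\<^esub> = star A \<one>\<^bsub>A\<^esub> \<otimes>\<^bsub>A\<^esub> star A (star A \<one>\<^bsub>A\<^esub>)"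
    using cstar_algebra.star_star[OF A A.one_closed] cstar_algebra.star_closed[OF A A.one_closed]
    by simp
  also have "\<dots> = star A (star A \<one>\<^bsub>A\<^esub> \<otimes>\<^bsub>A\<^esub> \<one>\<^bsub>A\<^esub>)"
    using cstar_algebra.star_mult[OF A, of "star A \<one>\<^bsub>A\<^esub>" "\<one>\<^bsub>A\<^esub>"]
      cstar_algebra.star_closed[OF A A.one_closed] by simp
  also have "\<dots> = \<one>\<^bsub>A\<^esub>"
    using cstar_algebra.star_star[OF A A.one_closed] cstar_algebra.star_closed[OF A A.one_closed]
    by simp
  finally show ?thesis .
qed

lemma cstar_nrm_projection:
  assumes A: "cstar_algebra A" and p: "p \<in> carrier A" "star A p = p" "p \<otimes>\<^bsub>A\<^esub> p = p"
  shows "nrm A p \<le> 1"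
proof -
  have "nrm A p * nrm A p = nrm A p * 1"
    using cstar_algebra.cstar_identity[OF A p(1)] p by (simp add: power2_eq_square)
  then have "nrm A p = 0 \<or> nrm A p = 1" by (metis mult_left_cancel)
  then show ?thesis by auto
qed

lemma cstar_nrm_one: "cstar_algebra A \<Longrightarrow> nrm A \<one>\<^bsub>A\<^esub> \<le> 1"
  using cstar_algebra_ring[of A] cstar_star_one[of A]
  by (intro cstar_nrm_projection) (auto simp: ring.ring_simprules(6) ring.ring_simprules(12))

lemma cstar_nrm_star:
  assumes A: "cstar_algebra A" and x: "x \<in> carrier A"
  shows "nrm A (star A x) = nrm A x"
proof -
  have le: "nrm A y \<le> nrm A (star A y)" if y: "y \<in> carrier A" for y
  proof (cases "nrm A y = 0")
    case True
    then show ?thesis using cstar_algebra.nrm_nonneg[OF A cstar_algebra.star_closed[OF A y]] by simp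
  next
    case False
    have "nrm A y * nrm A y \<le> nrm A (star A y) * nrm A y"
      using cstar_algebra.cstar_identity[OF A y]
        cstar_algebra.nrm_mult[OF A cstar_algebra.star_closed[OF A y] y]
      by (simp add: power2_eq_square)
    then show ?thesis using False cstar_algebra.nrm_nonneg[OF A y] by simp
  qed
  show ?thesis
    using le[OF x] le[OF cstar_algebra.star_closed[OF A x]] cstar_algebra.star_star[OF A x] by simp
qed

lemma cstar_nrm_zero: "cstar_algebra A \<Longrightarrow> nrm A \<zero>\<^bsub>A\<^esub> = 0"
  using cstar_algebra.nrm_eq_0_iff[of A "\<zero>\<^bsub>A\<^esub>"] ring.ring_simprules(2)[OF cstar_algebra_ring] by blast

lemma cstar_subalgebra_zero:
  assumes A: "cstar_algebra A" and D: "cstar_subalgebra A D"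
  shows "\<zero>\<^bsub>A\<^esub> \<in> D"
proof -
  have "0 \<odot>\<^bsub>A\<^esub> \<one>\<^bsub>A\<^esub> \<in> D" "\<one>\<^bsub>A\<^esub> \<in> carrier A" using D by (auto simp: cstar_subalgebra_def)
  then show ?thesis using cstar_smult(6)[OF A] by metis
qed

lemma cstar_algebra_subalgebra:
  assumes A: "cstar_algebra A" and D: "cstar_subalgebra A D"
  shows "cstar_algebra (A\<lparr>carrier := D\<rparr>)"
proof -
  interpret A: ring A by (rule cstar_algebra_ring[OF A])
  have sub: "\<And>x. x \<in> D \<Longrightarrow> x \<in> carrier A" and one: "\<one>\<^bsub>A\<^esub> \<in> D"
    and cl: "\<And>x y. \<lbrakk>x \<in> D; y \<in> D\<rbrakk> \<Longrightarrow> x \<oplus>\<^bsub>A\<^esub> y \<in> D" "\<And>x y. \<lbrakk>x \<in> D; y \<in> D\<rbrakk> \<Longrightarrow> x \<otimes>\<^bsub>A\<^esub> y \<in> D"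
      "\<And>x. x \<in> D \<Longrightarrow> star A x \<in> D" "\<And>c x. x \<in> D \<Longrightarrow> c \<odot>\<^bsub>A\<^esub> x \<in> D"
    and closed: "nrm_closed A D"
    using D by (auto simp: cstar_subalgebra_def)
  note zero = cstar_subalgebra_zero[OF A D]
  show ?thesis
  proof (rule cstar_algebraI, goal_cases)
    case (10 x) then show ?case using cstar_smult(7)[OF A, of x] sub[of x] by (simp add: A.l_neg)
  next
    case (32 X)
    have X: "X k \<in> D" for k using 32(1) by simp
    have "\<forall>e>0. \<exists>N. \<forall>k\<ge>N. \<forall>l\<ge>N. nrm A (X k \<ominus>\<^bsub>A\<^esub> X l) < e"
      using 32(2) cstar_minus(1)[OF A] sub X by simp
    then obtain x where x: "x \<in> carrier A" "converges A X x"
      using cstar_algebra.complete[OF A, of X] sub X by blast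
    then have "x \<in> D" using closed X by (auto simp: nrm_closed_def)
    then show ?case using x(2) cstar_minus(1)[OF A] sub X by (auto simp: converges_def)
  qed (use sub one zero cl A.add.m_assoc A.add.m_comm A.m_assoc A.l_distr A.r_distr
        cstar_smult[OF A] cstar_algebra.nrm_nonneg[OF A] cstar_algebra.nrm_eq_0_iff[OF A]
        cstar_algebra.nrm_triangle[OF A] cstar_algebra.nrm_smult[OF A] cstar_algebra.nrm_mult[OF A]
        cstar_algebra.cstar_identity[OF A] cstar_algebra.smult_mult_left[OF A]
        cstar_algebra.smult_mult_right[OF A] cstar_algebra.star_star[OF A]
        cstar_algebra.star_add[OF A] cstar_algebra.star_smult[OF A]
        cstar_algebra.star_mult[OF A] in auto)
qed

lemma cstar_nrm_diff:
  assumes A: "cstar_algebra A" and x: "x \<in> carrier A" and y: "y \<in> carrier A"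
  shows "nrm A (x \<ominus>\<^bsub>A\<^esub> y) = nrm A (y \<ominus>\<^bsub>A\<^esub> x)"
    and "nrm A y \<le> nrm A x + nrm A (x \<ominus>\<^bsub>A\<^esub> y)"
    and "z \<in> carrier A \<Longrightarrow> nrm A (x \<ominus>\<^bsub>A\<^esub> z) \<le> nrm A (x \<ominus>\<^bsub>A\<^esub> y) + nrm A (y \<ominus>\<^bsub>A\<^esub> z)"
    and "nrm A (x \<ominus>\<^bsub>A\<^esub> y) = 0 \<Longrightarrow> x = y"
proof -
  interpret A: ring A by (rule cstar_algebra_ring[OF A])
  have neg: "nrm A (\<ominus>\<^bsub>A\<^esub> z) = nrm A z" if "z \<in> carrier A" for z
    using cstar_smult(7)[OF A that] cstar_algebra.nrm_smult[OF A that, of "-1"] by simp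
  have "x \<ominus>\<^bsub>A\<^esub> y = \<ominus>\<^bsub>A\<^esub> (y \<ominus>\<^bsub>A\<^esub> x)"
    using x y by (simp add: a_minus_def A.minus_add A.a_comm)
  then show sym: "nrm A (x \<ominus>\<^bsub>A\<^esub> y) = nrm A (y \<ominus>\<^bsub>A\<^esub> x)" using neg x y by simp
  have "x \<oplus>\<^bsub>A\<^esub> (y \<ominus>\<^bsub>A\<^esub> x) = y" using x y by (simp add: a_minus_def A.a_comm[of y] A.r_neg2)
  then show "nrm A y \<le> nrm A x + nrm A (x \<ominus>\<^bsub>A\<^esub> y)"
    using cstar_algebra.nrm_triangle[OF A x, of "y \<ominus>\<^bsub>A\<^esub> x"] x y sym by simp
  show "nrm A (x \<ominus>\<^bsub>A\<^esub> z) \<le> nrm A (x \<ominus>\<^bsub>A\<^esub> y) + nrm A (y \<ominus>\<^bsub>A\<^esub> z)" if z: "z \<in> carrier A"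
  proof -
    have "(x \<ominus>\<^bsub>A\<^esub> y) \<oplus>\<^bsub>A\<^esub> (y \<ominus>\<^bsub>A\<^esub> z) = x \<ominus>\<^bsub>A\<^esub> z"
      using x y z by (simp add: a_minus_def A.a_assoc A.r_neg1)
    then show ?thesis
      using cstar_algebra.nrm_triangle[OF A, of "x \<ominus>\<^bsub>A\<^esub> y" "y \<ominus>\<^bsub>A\<^esub> z"] x y z by simp
  qed
  show "x = y" if "nrm A (x \<ominus>\<^bsub>A\<^esub> y) = 0"
    using that cstar_algebra.nrm_eq_0_iff[OF A, of "x \<ominus>\<^bsub>A\<^esub> y"] x y by simp
qed

lemma bounded_productD:
  assumes "f \<in> carrier (bounded_product I B)"
  shows "i \<in> I \<Longrightarrow> f i \<in> carrier (B i)"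
    and "f \<in> extensional I"
    and "i \<in> I \<Longrightarrow> nrm (B i) (f i) \<le> nrm (bounded_product I B) f"
proof -
  show "i \<in> I \<Longrightarrow> f i \<in> carrier (B i)" "f \<in> extensional I"
    using assms by (auto simp: bounded_product_def PiE_def)
  show "nrm (B i) (f i) \<le> nrm (bounded_product I B) f" if "i \<in> I"
    using assms that by (auto simp: bounded_product_def intro!: cSup_upper)
qed

lemma bounded_product_nrm_le:
  assumes "0 \<le> M" "\<And>i. i \<in> I \<Longrightarrow> nrm (B i) (f i) \<le> M"
  shows "nrm (bounded_product I B) f \<le> M"
  using assms by (auto simp: bounded_product_def intro!: cSup_least)

lemma bounded_productI:
  assumes "f \<in> extensional I" "\<And>i. i \<in> I \<Longrightarrow> f i \<in> carrier (B i)"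
    and "\<And>i. i \<in> I \<Longrightarrow> nrm (B i) (f i) \<le> M"
  shows "f \<in> carrier (bounded_product I B)"
  using assms by (auto simp: bounded_product_def PiE_def intro!: bdd_aboveI[of _ M])

lemma bounded_product_ops:
  "i \<in> I \<Longrightarrow> (f \<oplus>\<^bsub>bounded_product I B\<^esub> g) i = f i \<oplus>\<^bsub>B i\<^esub> g i"
  "i \<in> I \<Longrightarrow> (f \<otimes>\<^bsub>bounded_product I B\<^esub> g) i = f i \<otimes>\<^bsub>B i\<^esub> g i"
  "i \<in> I \<Longrightarrow> \<zero>\<^bsub>bounded_product I B\<^esub> i = \<zero>\<^bsub>B i\<^esub>"
  "i \<in> I \<Longrightarrow> \<one>\<^bsub>bounded_product I B\<^esub> i = \<one>\<^bsub>B i\<^esub>"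
  "i \<in> I \<Longrightarrow> (c \<odot>\<^bsub>bounded_product I B\<^esub> f) i = c \<odot>\<^bsub>B i\<^esub> f i"
  "i \<in> I \<Longrightarrow> star (bounded_product I B) f i = star (B i) (f i)"
  "f \<oplus>\<^bsub>bounded_product I B\<^esub> g \<in> extensional I"
  "f \<otimes>\<^bsub>bounded_product I B\<^esub> g \<in> extensional I"
  "\<zero>\<^bsub>bounded_product I B\<^esub> \<in> extensional I"
  "\<one>\<^bsub>bounded_product I B\<^esub> \<in> extensional I"
  "c \<odot>\<^bsub>bounded_product I B\<^esub> f \<in> extensional I"
  "star (bounded_product I B) f \<in> extensional I"
  by (simp_all add: bounded_product_def)

lemma cstar_algebra_bounded_product:
  assumes B: "\<And>i. i \<in> I \<Longrightarrow> cstar_algebra (B i)"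
  shows "cstar_algebra (bounded_product I B)"
proof -
  let ?P = "bounded_product I B"
  note R = cstar_algebra_ring[OF B]
  note D = bounded_productD
  note ops = bounded_product_ops
  note rs = ring.ring_simprules[OF R] Group.monoid.r_one[OF ring.is_monoid[OF R]]
  note cs = cstar_smult[OF B]
  note ca = cstar_algebra.star_closed[OF B] cstar_algebra.star_star[OF B]
    cstar_algebra.star_add[OF B] cstar_algebra.star_smult[OF B] cstar_algebra.star_mult[OF B]
    cstar_algebra.smult_mult_left[OF B] cstar_algebra.smult_mult_right[OF B]
  have nonneg: "0 \<le> nrm ?P f" if "f \<in> carrier ?P" for f
    using that by (auto simp: bounded_product_def intro!: cSup_upper)
  show ?thesis
  proof (rule cstar_algebraI, goal_cases)
    case (1 x y)
    show ?case
    proof (rule bounded_productI[where M = "nrm ?P x + nrm ?P y"])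
      fix i assume i: "i \<in> I"
      have "nrm (B i) (x i \<oplus>\<^bsub>B i\<^esub> y i) \<le> nrm (B i) (x i) + nrm (B i) (y i)"
        using cstar_algebra.nrm_triangle[OF B[OF i]] D(1)[OF 1(1) i] D(1)[OF 1(2) i] by blast
      then show "nrm (B i) ((x \<oplus>\<^bsub>?P\<^esub> y) i) \<le> nrm ?P x + nrm ?P y"
        using D(3)[OF 1(1) i] D(3)[OF 1(2) i] i by (simp add: ops)
    qed (use 1 in \<open>auto simp: ops rs D\<close>)
  next
    case (2 x y)
    show ?case
    proof (rule bounded_productI[where M = "nrm ?P x * nrm ?P y"])
      fix i assume i: "i \<in> I"
      have "nrm (B i) (x i \<otimes>\<^bsub>B i\<^esub> y i) \<le> nrm (B i) (x i) * nrm (B i) (y i)"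
        using cstar_algebra.nrm_mult[OF B[OF i]] D(1)[OF 2(1) i] D(1)[OF 2(2) i] by blast
      also have "\<dots> \<le> nrm ?P x * nrm ?P y"
        using cstar_algebra.nrm_nonneg[OF B[OF i]] D(1)[OF 2(1) i] D(1)[OF 2(2) i] nonneg 2
        by (intro mult_mono D(3)[OF 2(1) i] D(3)[OF 2(2) i]) auto
      finally show "nrm (B i) ((x \<otimes>\<^bsub>?P\<^esub> y) i) \<le> nrm ?P x * nrm ?P y"
        using i by (simp add: ops)
    qed (use 2 in \<open>auto simp: ops rs D\<close>)
  next
    case 3
    show ?case
      by (rule bounded_productI[where M = 0]) (auto simp: ops rs cstar_nrm_zero[OF B])
  next
    case 4
    show ?case
      by (rule bounded_productI[where M = 1]) (auto simp: ops rs cstar_nrm_one[OF B])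
  next
    case (5 c x)
    show ?case
      by (rule bounded_productI[where M = "cmod c * nrm ?P x"])
        (use 5 in \<open>auto simp: ops cs(1) D cstar_algebra.nrm_smult[OF B] mult_left_mono\<close>)
  next
    case (6 x)
    show ?case
      by (rule bounded_productI[where M = "nrm ?P x"])
        (use 6 in \<open>auto simp: ops ca D cstar_nrm_star[OF B]\<close>)
  next
    case (10 x)
    show ?case
    proof (rule extensionalityI[of _ I])
      fix i assume i: "i \<in> I"
      then show "((- 1) \<odot>\<^bsub>?P\<^esub> x \<oplus>\<^bsub>?P\<^esub> x) i = \<zero>\<^bsub>?P\<^esub> i"
        using cstar_smult(7)[OF B[OF i] D(1)[OF 10 i]] D(1)[OF 10 i]
        by (simp add: ops rs)
    qed (simp_all add: ops)
  next
    case (26 x) then show ?case by (rule nonneg)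
  next
    case (27 x)
    show ?case
    proof
      assume 0: "nrm ?P x = 0"
      show "x = \<zero>\<^bsub>?P\<^esub>"
      proof (rule extensionalityI[of _ I])
        fix i assume i: "i \<in> I"
        have "nrm (B i) (x i) = 0"
          using D(3)[OF 27 i] 0 cstar_algebra.nrm_nonneg[OF B[OF i] D(1)[OF 27 i]] by simp
        then show "x i = \<zero>\<^bsub>?P\<^esub> i"
          using cstar_algebra.nrm_eq_0_iff[OF B[OF i] D(1)[OF 27 i]] i by (simp add: ops)
      qed (use D(2)[OF 27] in \<open>simp_all add: ops\<close>)
    next
      assume x: "x = \<zero>\<^bsub>?P\<^esub>"
      have "nrm ?P x \<le> 0"
        by (rule bounded_product_nrm_le) (auto simp: x ops cstar_nrm_zero[OF B])
      then show "nrm ?P x = 0" using nonneg[OF 27] by simp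
    qed
  next
    case (28 x y)
    show ?case
    proof (rule bounded_product_nrm_le)
      fix i assume i: "i \<in> I"
      have "nrm (B i) (x i \<oplus>\<^bsub>B i\<^esub> y i) \<le> nrm (B i) (x i) + nrm (B i) (y i)"
        using cstar_algebra.nrm_triangle[OF B[OF i]] D(1)[OF 28(1) i] D(1)[OF 28(2) i] by blast
      then show "nrm (B i) ((x \<oplus>\<^bsub>?P\<^esub> y) i) \<le> nrm ?P x + nrm ?P y"
        using D(3)[OF 28(1) i] D(3)[OF 28(2) i] i by (simp add: ops)
    qed (use nonneg 28 in auto)
  next
    case (29 x c)
    have le: "nrm ?P (d \<odot>\<^bsub>?P\<^esub> y) \<le> cmod d * nrm ?P y" if "y \<in> carrier ?P" for d y
      by (rule bounded_product_nrm_le)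
        (use that nonneg in \<open>auto simp: ops D cstar_algebra.nrm_smult[OF B] mult_left_mono\<close>)
    show ?case
    proof (cases "c = 0")
      case True
      have cl: "c \<odot>\<^bsub>?P\<^esub> x \<in> carrier ?P"
        by (rule bounded_productI[where M = "cmod c * nrm ?P x"])
          (use 29 in \<open>auto simp: ops cs(1) D cstar_algebra.nrm_smult[OF B] mult_left_mono\<close>)
      then show ?thesis using le[OF 29, of c] nonneg[OF cl] True by simp
    next
      case False
      have cl: "c \<odot>\<^bsub>?P\<^esub> x \<in> carrier ?P"
        by (rule bounded_productI[where M = "cmod c * nrm ?P x"])
          (use 29 in \<open>auto simp: ops cs(1) D cstar_algebra.nrm_smult[OF B] mult_left_mono\<close>)
      have "inverse c \<odot>\<^bsub>?P\<^esub> (c \<odot>\<^bsub>?P\<^esub> x) = x"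
      proof (rule extensionalityI[of _ I])
        fix i assume i: "i \<in> I"
        show "(inverse c \<odot>\<^bsub>?P\<^esub> (c \<odot>\<^bsub>?P\<^esub> x)) i = x i"
          using cstar_smult(4)[OF B[OF i] D(1)[OF 29 i], of "inverse c" c]
            cstar_smult(5)[OF B[OF i] D(1)[OF 29 i]] False i
          by (simp add: ops)
      qed (use D(2)[OF 29] in \<open>simp_all add: ops\<close>)
      then have "nrm ?P x \<le> cmod (inverse c) * nrm ?P (c \<odot>\<^bsub>?P\<^esub> x)"
        using le[OF cl, of "inverse c"] by simp
      then have "nrm ?P x \<le> inverse (cmod c) * nrm ?P (c \<odot>\<^bsub>?P\<^esub> x)"
        by (simp only: norm_inverse)
      then have "cmod c * nrm ?P x \<le> nrm ?P (c \<odot>\<^bsub>?P\<^esub> x)"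
        using False by (simp add: field_simps)
      then show ?thesis using le[OF 29, of c] by simp
    qed
  next
    case (30 x y)
    show ?case
    proof (rule bounded_product_nrm_le)
      fix i assume i: "i \<in> I"
      have "nrm (B i) (x i \<otimes>\<^bsub>B i\<^esub> y i) \<le> nrm (B i) (x i) * nrm (B i) (y i)"
        using cstar_algebra.nrm_mult[OF B[OF i]] D(1)[OF 30(1) i] D(1)[OF 30(2) i] by blast
      also have "\<dots> \<le> nrm ?P x * nrm ?P y"
        using cstar_algebra.nrm_nonneg[OF B[OF i]] D(1)[OF 30(1) i] D(1)[OF 30(2) i] nonneg 30
        by (intro mult_mono D(3)[OF 30(1) i] D(3)[OF 30(2) i]) auto
      finally show "nrm (B i) ((x \<otimes>\<^bsub>?P\<^esub> y) i) \<le> nrm ?P x * nrm ?P y"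
        using i by (simp add: ops)
    qed (use nonneg 30 in auto)
  next
    case (31 x)
    let ?y = "star ?P x \<otimes>\<^bsub>?P\<^esub> x"
    have id: "nrm (B i) (?y i) = (nrm (B i) (x i))\<^sup>2" if "i \<in> I" for i
      using that cstar_algebra.cstar_identity[OF B[OF that] D(1)[OF 31 that]] by (simp add: ops)
    have y: "?y \<in> carrier ?P"
    proof (rule bounded_productI[where M = "(nrm ?P x)\<^sup>2"])
      fix i assume i: "i \<in> I"
      show "nrm (B i) (?y i) \<le> (nrm ?P x)\<^sup>2"
        unfolding id[OF i]
        by (intro power_mono D(3)[OF 31 i] cstar_algebra.nrm_nonneg[OF B[OF i] D(1)[OF 31 i]])
    qed (use 31 in \<open>auto simp: ops rs ca D\<close>)
    have "nrm ?P ?y \<le> (nrm ?P x)\<^sup>2"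
    proof (rule bounded_product_nrm_le)
      fix i assume i: "i \<in> I"
      show "nrm (B i) (?y i) \<le> (nrm ?P x)\<^sup>2"
        unfolding id[OF i]
        by (intro power_mono D(3)[OF 31 i] cstar_algebra.nrm_nonneg[OF B[OF i] D(1)[OF 31 i]])
    qed simp
    moreover have "nrm ?P x \<le> sqrt (nrm ?P ?y)"
    proof (rule bounded_product_nrm_le)
      fix i assume i: "i \<in> I"
      show "nrm (B i) (x i) \<le> sqrt (nrm ?P ?y)"
        using D(3)[OF y i] id[OF i] by (simp add: real_le_rsqrt)
    qed (use nonneg[OF y] in simp)
    then have "(nrm ?P x)\<^sup>2 \<le> (sqrt (nrm ?P ?y))\<^sup>2"
      using nonneg[OF 31] by (intro power_mono) auto
    then have "(nrm ?P x)\<^sup>2 \<le> nrm ?P ?y" using nonneg[OF y] by simp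
    ultimately show ?case by simp
  next
    case (32 X)
    note X = 32(1)
    let ?d = "\<lambda>f g. f \<oplus>\<^bsub>?P\<^esub> (- 1) \<odot>\<^bsub>?P\<^esub> g"
    have dif: "?d f g i = f i \<ominus>\<^bsub>B i\<^esub> g i" if "i \<in> I" "f i \<in> carrier (B i)" "g i \<in> carrier (B i)" for f g i
      using cstar_minus(1)[OF B[OF that(1)] that(2,3)] that(1) by (simp add: ops)
    have dcl: "?d f g \<in> carrier ?P" if "f \<in> carrier ?P" "g \<in> carrier ?P" for f g
    proof (rule bounded_productI[where M = "nrm ?P f + nrm ?P g"])
      fix i assume i: "i \<in> I"
      have c: "f i \<in> carrier (B i)" "g i \<in> carrier (B i)" using D(1)[OF that(1) i] D(1)[OF that(2) i] by auto
      have "nrm (B i) (f i \<oplus>\<^bsub>B i\<^esub> (- 1) \<odot>\<^bsub>B i\<^esub> g i) \<le> nrm (B i) (f i) + nrm (B i) (g i)"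
        using cstar_algebra.nrm_triangle[OF B[OF i] c(1) cstar_smult(1)[OF B[OF i] c(2)], of "-1"]
          cstar_algebra.nrm_smult[OF B[OF i] c(2), of "-1"] by simp
      then show "nrm (B i) (?d f g i) \<le> nrm ?P f + nrm ?P g"
        using D(3)[OF that(1) i] D(3)[OF that(2) i] i by (simp add: ops)
      show "?d f g i \<in> carrier (B i)"
        using i c cstar_minus(2)[OF B[OF i] c] by (simp only: dif)
    qed (simp add: ops)
    have co: "nrm (B i) (X k i \<ominus>\<^bsub>B i\<^esub> X l i) \<le> nrm ?P (?d (X k) (X l))" if "i \<in> I" for i k l
      using D(3)[OF dcl[OF X[of k] X[of l]] that] dif[OF that, of "X k" "X l"] D(1)[OF X that] by simp
    have "\<exists>x\<in>carrier (B i). converges (B i) (\<lambda>k. X k i) x" if i: "i \<in> I" for i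
    proof (rule cstar_algebra.complete[OF B[OF i]])
      show "\<forall>k. X k i \<in> carrier (B i)" using D(1)[OF X i] by simp
      show "\<forall>e>0. \<exists>N. \<forall>k\<ge>N. \<forall>l\<ge>N. nrm (B i) (X k i \<ominus>\<^bsub>B i\<^esub> X l i) < e"
        using 32(2) co[OF i] by (meson le_less_trans)
    qed
    then obtain l where l: "\<And>i. i \<in> I \<Longrightarrow> l i \<in> carrier (B i)"
      and lim: "\<And>i. i \<in> I \<Longrightarrow> converges (B i) (\<lambda>k. X k i) (l i)"
      by metis
    define L where "L = (\<lambda>i\<in>I. l i)"
    have unif: "nrm (B i) (X k i \<ominus>\<^bsub>B i\<^esub> l i) \<le> e"
      if N: "\<forall>k\<ge>N. \<forall>l\<ge>N. nrm ?P (?d (X k) (X l)) < e" and k: "k \<ge> N" and i: "i \<in> I" for N e k i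
    proof (rule field_le_epsilon)
      fix d :: real assume "d > 0"
      then obtain M where M: "\<And>m. m \<ge> M \<Longrightarrow> \<bar>nrm (B i) (X m i \<ominus>\<^bsub>B i\<^esub> l i)\<bar> < d"
        using lim[OF i] unfolding converges_def LIMSEQ_iff by auto
      define m where "m = max M N"
      have "nrm (B i) (X k i \<ominus>\<^bsub>B i\<^esub> l i)
          \<le> nrm (B i) (X k i \<ominus>\<^bsub>B i\<^esub> X m i) + nrm (B i) (X m i \<ominus>\<^bsub>B i\<^esub> l i)"
        by (rule cstar_nrm_diff(3)[OF B[OF i] D(1)[OF X i] D(1)[OF X i] l[OF i]])
      moreover have "nrm (B i) (X k i \<ominus>\<^bsub>B i\<^esub> X m i) < e"
        using N k co[OF i, of k m] by (smt (verit) m_def max.cobounded2)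
      moreover have "nrm (B i) (X m i \<ominus>\<^bsub>B i\<^esub> l i) < d" using M[of m] by (simp add: m_def)
      ultimately show "nrm (B i) (X k i \<ominus>\<^bsub>B i\<^esub> l i) \<le> e + d" by linarith
    qed
    obtain N where N: "\<forall>k\<ge>N. \<forall>l\<ge>N. nrm ?P (?d (X k) (X l)) < 1" using 32(2)[of 1] by auto
    have L: "L \<in> carrier ?P"
    proof (rule bounded_productI[where M = "nrm ?P (X N) + 1"])
      fix i assume i: "i \<in> I"
      have "nrm (B i) (l i) \<le> nrm (B i) (X N i) + nrm (B i) (X N i \<ominus>\<^bsub>B i\<^esub> l i)"
        by (rule cstar_nrm_diff(2)[OF B[OF i] D(1)[OF X i] l[OF i]])
      then show "nrm (B i) (L i) \<le> nrm ?P (X N) + 1"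
        using unif[OF N order_refl i] D(3)[OF X[of N] i] i by (simp add: L_def)
    qed (auto simp: L_def l)
    have "(\<lambda>k. nrm ?P (?d (X k) L)) \<longlonglongrightarrow> 0"
    proof (rule LIMSEQ_I)
      fix e :: real assume e: "e > 0"
      then obtain N where N: "\<forall>k\<ge>N. \<forall>l\<ge>N. nrm ?P (?d (X k) (X l)) < e / 2"
        using 32(2)[of "e / 2"] by auto
      have "nrm ?P (?d (X k) L) \<le> e / 2" if k: "k \<ge> N" for k
      proof (rule bounded_product_nrm_le)
        fix i assume i: "i \<in> I"
        show "nrm (B i) (?d (X k) L i) \<le> e / 2"
          using unif[OF N k i] dif[OF i, of "X k" L] D(1)[OF X i] l[OF i] i by (simp add: L_def)
      qed (use e in simp)
      then show "\<exists>N. \<forall>k\<ge>N. norm (nrm ?P (?d (X k) L) - 0) < e"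
        using nonneg[OF dcl[OF X L]] e by (intro exI[of _ N]) force
    qed
    then show ?case using L by blast
  qed (rule extensionalityI[of _ I]; simp add: ops D rs cs ca)+
qed

lemma cstar_subalgebra_carrier: "cstar_algebra A \<Longrightarrow> cstar_subalgebra A (carrier A)"
  using ring.ring_simprules[OF cstar_algebra_ring, of A]
  by (auto simp: cstar_subalgebra_def nrm_closed_def cstar_algebra.star_closed cstar_smult(1))

lemma cstar_generated_subset: "S \<subseteq> cstar_generated A S"
  by (auto simp: cstar_generated_def)

lemma cstar_generated_least: "\<lbrakk>cstar_subalgebra A D; S \<subseteq> D\<rbrakk> \<Longrightarrow> cstar_generated A S \<subseteq> D"
  by (auto simp: cstar_generated_def)

lemma cstar_subalgebra_generated:
  assumes A: "cstar_algebra A" and S: "S \<subseteq> carrier A"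
  shows "cstar_subalgebra A (cstar_generated A S)"
proof -
  have "cstar_generated A S \<subseteq> carrier A"
    using cstar_generated_least[OF cstar_subalgebra_carrier[OF A] S] .
  then show ?thesis
    unfolding cstar_subalgebra_def nrm_closed_def cstar_generated_def by blast
qed

lemma star_homD:
  assumes "f \<in> star_hom A B" "x \<in> carrier A"
  shows "f x \<in> carrier B" "f (star A x) = star B (f x)" "f (c \<odot>\<^bsub>A\<^esub> x) = c \<odot>\<^bsub>B\<^esub> f x"
    "y \<in> carrier A \<Longrightarrow> f (x \<oplus>\<^bsub>A\<^esub> y) = f x \<oplus>\<^bsub>B\<^esub> f y"
    "y \<in> carrier A \<Longrightarrow> f (x \<otimes>\<^bsub>A\<^esub> y) = f x \<otimes>\<^bsub>B\<^esub> f y"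
    "f \<one>\<^bsub>A\<^esub> = \<one>\<^bsub>B\<^esub>"
  using assms by (auto simp: star_hom_def Ring.ring_hom_def)

lemma star_hom_zero:
  assumes A: "cstar_algebra A" and B: "cstar_algebra B" and f: "f \<in> star_hom A B"
  shows "f \<zero>\<^bsub>A\<^esub> = \<zero>\<^bsub>B\<^esub>"
proof -
  have z: "\<zero>\<^bsub>A\<^esub> \<in> carrier A" by (rule ring.ring_simprules(2)[OF cstar_algebra_ring[OF A]])
  have "f (0 \<odot>\<^bsub>A\<^esub> \<zero>\<^bsub>A\<^esub>) = 0 \<odot>\<^bsub>B\<^esub> f \<zero>\<^bsub>A\<^esub>" by (rule star_homD(3)[OF f z])
  then show ?thesis using cstar_smult(6)[OF A z] cstar_smult(6)[OF B star_homD(1)[OF f z]] by simp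
qed

lemma star_hom_finsum:
  assumes A: "cstar_algebra A" and B: "cstar_algebra B" and f: "f \<in> star_hom A B"
    and S: "finite S" and g: "\<And>x. x \<in> S \<Longrightarrow> g x \<in> carrier A"
  shows "f (finsum A g S) = finsum B (\<lambda>x. f (g x)) S"
proof -
  interpret A: ring A by (rule cstar_algebra_ring[OF A])
  interpret B: ring B by (rule cstar_algebra_ring[OF B])
  show ?thesis using S g
  proof (induction S)
    case empty
    then show ?case by (simp add: star_hom_zero[OF A B f])
  next
    case (insert a S)
    have cl: "g a \<in> carrier A" "g \<in> S \<rightarrow> carrier A" using insert by auto
    have "f (finsum A g (insert a S)) = f (g a) \<oplus>\<^bsub>B\<^esub> f (finsum A g S)"
      using insert cl by (simp add: A.finsum_insert star_homD(4)[OF f] A.finsum_closed)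
    also have "\<dots> = f (g a) \<oplus>\<^bsub>B\<^esub> finsum B (\<lambda>x. f (g x)) S" using insert by simp
    also have "\<dots> = finsum B (\<lambda>x. f (g x)) (insert a S)"
      using insert cl star_homD(1)[OF f] by (subst B.finsum_insert) auto
    finally show ?case .
  qed
qed

lemma star_hom_magic_unitary:
  assumes A: "cstar_algebra A" and B: "cstar_algebra B" and f: "f \<in> star_hom A B"
    and u: "magic_unitary A n u"
  shows "magic_unitary B n (\<lambda>i j. f (u i j))"
proof -
  have cl: "u i j \<in> carrier A" if "i < n" "j < n" for i j
    using u that by (simp add: magic_unitary_def)
  have 1: "f (u i j) \<in> carrier B" "star B (f (u i j)) = f (u i j)"
      "f (u i j) \<otimes>\<^bsub>B\<^esub> f (u i j) = f (u i j)" if "i < n" "j < n" for i j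
    using u that star_homD(1,2)[OF f cl[OF that]] star_homD(5)[OF f cl[OF that] cl[OF that], symmetric]
    by (auto simp: magic_unitary_def)
  have 2: "f (u i j) \<otimes>\<^bsub>B\<^esub> f (u i k) = \<zero>\<^bsub>B\<^esub>" "f (u j i) \<otimes>\<^bsub>B\<^esub> f (u k i) = \<zero>\<^bsub>B\<^esub>"
    if "i < n" "j < n" "k < n" "j \<noteq> k" for i j k
    using u that star_homD(5)[OF f cl cl] star_hom_zero[OF A B f]
    unfolding magic_unitary_def by metis+
  have 3: "(\<Oplus>\<^bsub>B\<^esub>j\<in>{..<n}. f (u i j)) = \<one>\<^bsub>B\<^esub>" "(\<Oplus>\<^bsub>B\<^esub>j\<in>{..<n}. f (u j i)) = \<one>\<^bsub>B\<^esub>"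
    if i: "i < n" for i
  proof -
    have one: "f \<one>\<^bsub>A\<^esub> = \<one>\<^bsub>B\<^esub>" using star_homD(6)[OF f cl[OF i i]] .
    show "(\<Oplus>\<^bsub>B\<^esub>j\<in>{..<n}. f (u i j)) = \<one>\<^bsub>B\<^esub>"
      using star_hom_finsum[OF A B f, of "{..<n}" "\<lambda>j. u i j"] cl i u one
      by (auto simp: magic_unitary_def)
    show "(\<Oplus>\<^bsub>B\<^esub>j\<in>{..<n}. f (u j i)) = \<one>\<^bsub>B\<^esub>"
      using star_hom_finsum[OF A B f, of "{..<n}" "\<lambda>j. u j i"] cl i u one
      by (auto simp: magic_unitary_def)
  qed
  show ?thesis
    unfolding magic_unitary_def by (intro conjI allI impI) (simp_all add: 1 2 3)
qed

lemma magic_unitary_subalgebra: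
  assumes A: "cstar_algebra A" and D: "cstar_subalgebra A D"
    and u: "magic_unitary A n u" and sub: "\<And>i j. \<lbrakk>i < n; j < n\<rbrakk> \<Longrightarrow> u i j \<in> D"
  shows "magic_unitary (A\<lparr>carrier := D\<rparr>) n u"
proof -
  let ?D = "A\<lparr>carrier := D\<rparr>"
  have "(\<lambda>x. x) \<in> star_hom ?D A"
    using D by (auto simp: star_hom_def Ring.ring_hom_def cstar_subalgebra_def)
  from star_hom_finsum[OF cstar_algebra_subalgebra[OF A D] A this, of "{..<n}"]
  have "finsum ?D g {..<n} = finsum A g {..<n}" if "\<And>x. x < n \<Longrightarrow> g x \<in> D" for g
    using that by simp
  then show ?thesis using u sub by (auto simp: magic_unitary_def)
qed

definition image_algebra :: "('a \<Rightarrow> 'b) \<Rightarrow> 'a star_alg \<Rightarrow> 'b star_alg" where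
  "image_algebra f A = (let g = inv_into (carrier A) f in
     \<lparr>carrier = f ` carrier A, monoid.mult = (\<lambda>a b. f (g a \<otimes>\<^bsub>A\<^esub> g b)), one = f \<one>\<^bsub>A\<^esub>,
      zero = f \<zero>\<^bsub>A\<^esub>, add = (\<lambda>a b. f (g a \<oplus>\<^bsub>A\<^esub> g b)), smult = (\<lambda>c a. f (c \<odot>\<^bsub>A\<^esub> g a)),
      star = (\<lambda>a. f (star A (g a))), nrm = (\<lambda>a. nrm A (g a))\<rparr>)"

lemma image_algebra_ops:
  assumes "inj_on f (carrier A)" "x \<in> carrier A"
  shows "f x \<in> carrier (image_algebra f A)"
    and "\<zero>\<^bsub>image_algebra f A\<^esub> = f \<zero>\<^bsub>A\<^esub>" "\<one>\<^bsub>image_algebra f A\<^esub> = f \<one>\<^bsub>A\<^esub>"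
    and "c \<odot>\<^bsub>image_algebra f A\<^esub> f x = f (c \<odot>\<^bsub>A\<^esub> x)"
    and "star (image_algebra f A) (f x) = f (star A x)"
    and "nrm (image_algebra f A) (f x) = nrm A x"
    and "y \<in> carrier A \<Longrightarrow> f x \<oplus>\<^bsub>image_algebra f A\<^esub> f y = f (x \<oplus>\<^bsub>A\<^esub> y)"
    and "y \<in> carrier A \<Longrightarrow> f x \<otimes>\<^bsub>image_algebra f A\<^esub> f y = f (x \<otimes>\<^bsub>A\<^esub> y)"
  using assms by (simp_all add: image_algebra_def Let_def inv_into_f_f)

lemma cstar_algebra_image_algebra:
  assumes A: "cstar_algebra A" and f: "inj_on f (carrier A)"
  shows "cstar_algebra (image_algebra f A)"
proof -
  interpret A: ring A by (rule cstar_algebra_ring[OF A])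
  let ?F = "image_algebra f A"
  have car: "carrier ?F = f ` carrier A" by (simp add: image_algebra_def Let_def)
  have z: "\<zero>\<^bsub>?F\<^esub> = f \<zero>\<^bsub>A\<^esub>" "\<one>\<^bsub>?F\<^esub> = f \<one>\<^bsub>A\<^esub>"
    using image_algebra_ops(2,3)[OF f A.zero_closed] by auto
  note ops = z image_algebra_ops(4-)[OF f]
  have inj: "f x = f y \<longleftrightarrow> x = y" if "x \<in> carrier A" "y \<in> carrier A" for x y
    using f that by (auto simp: inj_on_def)
  show ?thesis
  proof (rule cstar_algebraI, goal_cases)
    case (8 x y)
    then show ?case by (auto simp: car ops intro!: arg_cong[of _ _ f] A.a_comm)
  next
    case (10 x)
    then obtain a where a: "a \<in> carrier A" "x = f a" by (auto simp: car)
    then show ?case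
      using cstar_smult(1)[OF A a(1)] cstar_smult(7)[OF A a(1)] by (simp add: ops A.l_neg)
  next
    case (27 x) then show ?case
      by (auto simp: car ops inj cstar_algebra.nrm_eq_0_iff[OF A])
  next
    case (32 X)
    have "\<forall>k. \<exists>a. a \<in> carrier A \<and> X k = f a" using 32(1) by (auto simp: car)
    then obtain Y where Y: "\<And>k. Y k \<in> carrier A" "\<And>k. X k = f (Y k)" by metis
    have eq: "nrm ?F (X k \<oplus>\<^bsub>?F\<^esub> (- 1) \<odot>\<^bsub>?F\<^esub> f a) = nrm A (Y k \<ominus>\<^bsub>A\<^esub> a)" if "a \<in> carrier A" for k a
      using that Y cstar_smult(1)[OF A that] cstar_minus(1)[OF A Y(1) that] by (simp add: ops)
    have "\<forall>e>0. \<exists>N. \<forall>k\<ge>N. \<forall>l\<ge>N. nrm A (Y k \<ominus>\<^bsub>A\<^esub> Y l) < e"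
      using 32(2) eq[OF Y(1)] Y(2) by simp
    then obtain y where "y \<in> carrier A" "converges A Y y"
      using cstar_algebra.complete[OF A, of Y] Y(1) by blast
    then show ?case using eq by (intro bexI[of _ "f y"]) (auto simp: converges_def car)
  next
    case 1 then show ?case by (auto simp: car ops)
  next
    case 2 then show ?case by (auto simp: car ops)
  next
    case 3 then show ?case by (auto simp: car ops)
  next
    case 4 then show ?case by (auto simp: car ops)
  next
    case 5 then show ?case by (auto simp: car ops cstar_smult(1)[OF A])
  next
    case 6 then show ?case by (auto simp: car ops cstar_algebra.star_closed[OF A])
  next
    case 7 then show ?case by (auto simp: car ops A.a_assoc)
  next
    case 9 then show ?case by (auto simp: car ops)
  next
    case 11 then show ?case by (auto simp: car ops A.m_assoc)
  next
    case 12 then show ?case by (auto simp: car ops)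
  next
    case 13 then show ?case by (auto simp: car ops)
  next
    case 14 then show ?case by (auto simp: car ops A.l_distr)
  next
    case 15 then show ?case by (auto simp: car ops A.r_distr)
  next
    case 16 then show ?case by (auto simp: car ops cstar_smult(1,2)[OF A])
  next
    case 17 then show ?case by (auto simp: car ops cstar_smult(1,3)[OF A])
  next
    case 18 then show ?case by (auto simp: car ops cstar_smult(1,4)[OF A])
  next
    case 19 then show ?case by (auto simp: car ops cstar_smult(5)[OF A])
  next
    case 20 then show ?case by (auto simp: car ops cstar_smult(1)[OF A] cstar_algebra.smult_mult_left[OF A])
  next
    case 21 then show ?case by (auto simp: car ops cstar_smult(1)[OF A] cstar_algebra.smult_mult_right[OF A])
  next
    case 22 then show ?case by (auto simp: car ops cstar_algebra.star_closed[OF A] cstar_algebra.star_star[OF A])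
  next
    case 23 then show ?case by (auto simp: car ops cstar_algebra.star_closed[OF A] cstar_algebra.star_add[OF A])
  next
    case 24 then show ?case by (auto simp: car ops cstar_smult(1)[OF A] cstar_algebra.star_closed[OF A] cstar_algebra.star_smult[OF A])
  next
    case 25 then show ?case by (auto simp: car ops cstar_algebra.star_closed[OF A] cstar_algebra.star_mult[OF A])
  next
    case 26 then show ?case by (auto simp: car ops cstar_algebra.nrm_nonneg[OF A])
  next
    case 28 then show ?case by (auto simp: car ops cstar_algebra.nrm_triangle[OF A])
  next
    case 29 then show ?case by (auto simp: car ops cstar_smult(1)[OF A] cstar_algebra.nrm_smult[OF A])
  next
    case 30 then show ?case by (auto simp: car ops cstar_algebra.nrm_mult[OF A])
  next
    case 31 then show ?case by (auto simp: car ops cstar_algebra.star_closed[OF A] cstar_algebra.cstar_identity[OF A])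
  qed
qed


section \<open>The universal property of \<open>A\<^sub>s(n)\<close>\<close>

lemma magic_pairsD:
  "p \<in> magic_pairs n \<Longrightarrow> cstar_algebra (fst p)"
  "p \<in> magic_pairs n \<Longrightarrow> magic_unitary (fst p) n (snd p)"
  by (auto simp: magic_pairs_def)

lemma A_s_entry_apply: "p \<in> magic_pairs n \<Longrightarrow> A_s_entry n i j p = snd p i j"
  by (simp add: A_s_entry_def split: prod.split)

abbreviation A_s_product :: "nat \<Rightarrow> univ star_alg" where
  "A_s_product n \<equiv> bounded_product (magic_pairs n) fst"

abbreviation A_s_entries :: "nat \<Rightarrow> univ set" where
  "A_s_entries n \<equiv> {A_s_entry n i j | i j. i < n \<and> j < n}"

lemma cstar_algebra_A_s_product: "cstar_algebra (A_s_product n)"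
  by (intro cstar_algebra_bounded_product magic_pairsD(1))

lemma A_s_entry_product:
  assumes "i < n" "j < n"
  shows "A_s_entry n i j \<in> carrier (A_s_product n)"
proof (rule bounded_productI[where M = 1])
  fix p assume p: "p \<in> magic_pairs n"
  note m = magic_pairsD(2)[OF p, unfolded magic_unitary_def]
  show "A_s_entry n i j p \<in> carrier (fst p)" using m assms p by (simp add: A_s_entry_apply)
  show "nrm (fst p) (A_s_entry n i j p) \<le> 1"
    using m assms p cstar_nrm_projection[OF magic_pairsD(1)[OF p]] by (simp add: A_s_entry_apply)
qed (simp add: A_s_entry_def)

lemma star_hom_apply:
  assumes "p \<in> magic_pairs n"
  shows "(\<lambda>F. F p) \<in> star_hom (A_s_product n) (fst p)"
  using assms by (auto simp: star_hom_def Ring.ring_hom_def bounded_product_ops bounded_productD)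

lemma A_s_entry_product_magic: "magic_unitary (A_s_product n) n (A_s_entry n)"
proof -
  let ?P = "A_s_product n"
  interpret P: ring ?P by (rule cstar_algebra_ring[OF cstar_algebra_A_s_product])
  note ops = bounded_product_ops A_s_entry_apply
  have eqI: "F = G" if "F \<in> carrier ?P" "G \<in> carrier ?P" "\<And>p. p \<in> magic_pairs n \<Longrightarrow> F p = G p" for F G
    using that bounded_productD(2) by (metis extensionalityI)
  have sum: "finsum ?P g {..<n} p = finsum (fst p) (\<lambda>x. g x p) {..<n}"
    if "p \<in> magic_pairs n" "\<And>x. x < n \<Longrightarrow> g x \<in> carrier ?P" for g p
    using star_hom_finsum[OF cstar_algebra_A_s_product magic_pairsD(1)[OF that(1)]
        star_hom_apply[OF that(1)], of "{..<n}" g] that(2) by simp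
  have m: "magic_unitary (fst p) n (snd p)" if "p \<in> magic_pairs n" for p
    using magic_pairsD(2)[OF that] .
  note e = A_s_entry_product
  note cl = e P.m_closed cstar_algebra.star_closed[OF cstar_algebra_A_s_product] P.zero_closed P.one_closed
  have 1: "star ?P (A_s_entry n i j) = A_s_entry n i j"
      "A_s_entry n i j \<otimes>\<^bsub>?P\<^esub> A_s_entry n i j = A_s_entry n i j" if "i < n" "j < n" for i j
    using that m by (auto intro!: eqI cl simp: ops magic_unitary_def)
  have 2: "A_s_entry n i j \<otimes>\<^bsub>?P\<^esub> A_s_entry n i k = \<zero>\<^bsub>?P\<^esub>"
      "A_s_entry n j i \<otimes>\<^bsub>?P\<^esub> A_s_entry n k i = \<zero>\<^bsub>?P\<^esub>"
    if "i < n" "j < n" "k < n" "j \<noteq> k" for i j k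
    using that m by (auto intro!: eqI cl simp: ops magic_unitary_def)
  have 3: "(\<Oplus>\<^bsub>?P\<^esub>j\<in>{..<n}. A_s_entry n i j) = \<one>\<^bsub>?P\<^esub>"
      "(\<Oplus>\<^bsub>?P\<^esub>j\<in>{..<n}. A_s_entry n j i) = \<one>\<^bsub>?P\<^esub>" if "i < n" for i
    using that m by (auto intro!: eqI P.finsum_closed cl simp: ops sum e magic_unitary_def)
  show ?thesis
    unfolding magic_unitary_def by (intro conjI allI impI) (simp_all add: e 1 2 3)
qed

lemma cstar_subalgebra_A_s: "cstar_subalgebra (A_s_product n) (carrier (A_s n))"
  unfolding A_s_def Let_def
  by (auto intro!: cstar_subalgebra_generated[OF cstar_algebra_A_s_product] A_s_entry_product)

lemma A_s_eq: "A_s n = (A_s_product n)\<lparr>carrier := carrier (A_s n)\<rparr>"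
  by (simp add: A_s_def Let_def)

theorem cstar_algebra_A_s: "cstar_algebra (A_s n)"
  using cstar_algebra_subalgebra[OF cstar_algebra_A_s_product cstar_subalgebra_A_s]
  unfolding A_s_eq[symmetric] .

lemma A_s_entry_closed: "\<lbrakk>i < n; j < n\<rbrakk> \<Longrightarrow> A_s_entry n i j \<in> carrier (A_s n)"
  using cstar_generated_subset[of "A_s_entries n" "A_s_product n"] by (auto simp: A_s_def Let_def)

theorem A_s_magic_unitary: "magic_unitary (A_s n) n (A_s_entry n)"
  using magic_unitary_subalgebra[OF cstar_algebra_A_s_product cstar_subalgebra_A_s
      A_s_entry_product_magic A_s_entry_closed]
  unfolding A_s_eq[symmetric] .

theorem A_s_generated: "cstar_generated (A_s n) (A_s_entries n) = carrier (A_s n)"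
proof
  note P = cstar_algebra_A_s_product and A = cstar_algebra_A_s
  let ?P = "A_s_product n"
  have sub: "carrier (A_s n) \<subseteq> carrier ?P" using cstar_subalgebra_A_s by (simp add: cstar_subalgebra_def)
  have ops: "add (A_s n) = add ?P" "monoid.mult (A_s n) = monoid.mult ?P" "one (A_s n) = one ?P"
    "star (A_s n) = star ?P" "smult (A_s n) = smult ?P" "nrm (A_s n) = nrm ?P"
    by (simp_all add: A_s_def Let_def)
  have conv: "converges (A_s n) X x = converges ?P X x"
    if "\<And>k. X k \<in> carrier (A_s n)" "x \<in> carrier (A_s n)" for X x
  proof -
    have "X k \<ominus>\<^bsub>A_s n\<^esub> x = X k \<ominus>\<^bsub>?P\<^esub> x" for k
      using cstar_minus(1)[OF A that]
        cstar_minus(1)[OF P subsetD[OF sub that(1)] subsetD[OF sub that(2)]] by (simp add: ops)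
    then show ?thesis by (simp add: converges_def ops)
  qed
  show "cstar_generated (A_s n) (A_s_entries n) \<subseteq> carrier (A_s n)"
    by (rule cstar_generated_least[OF cstar_subalgebra_carrier[OF A]]) (auto intro: A_s_entry_closed)
  have "cstar_subalgebra ?P E" if E: "cstar_subalgebra (A_s n) E" for E
    unfolding cstar_subalgebra_def nrm_closed_def
  proof (intro conjI allI ballI impI)
    fix X x assume X: "\<forall>k. X k \<in> E" "x \<in> carrier ?P" "converges ?P X x"
    have "\<And>k. X k \<in> carrier (A_s n)" using X(1) E by (auto simp: cstar_subalgebra_def)
    moreover from this have "x \<in> carrier (A_s n)"
      using cstar_subalgebra_A_s[of n] X(2,3) unfolding cstar_subalgebra_def nrm_closed_def by blast
    ultimately show "x \<in> E"
      using E X conv[of X x] unfolding cstar_subalgebra_def nrm_closed_def by blast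
  qed (use E sub in \<open>auto simp: cstar_subalgebra_def ops\<close>)
  then show "carrier (A_s n) \<subseteq> cstar_generated (A_s n) (A_s_entries n)"
    unfolding cstar_generated_def by (auto simp: A_s_def Let_def cstar_generated_def)
qed

primrec star_eval :: "'b star_alg \<Rightarrow> nat \<Rightarrow> (nat \<Rightarrow> nat \<Rightarrow> 'b) \<Rightarrow> star_poly \<Rightarrow> 'b" where
  "star_eval B n v (Gen i j) = (if i < n \<and> j < n then v i j else \<zero>\<^bsub>B\<^esub>)"
| "star_eval B n v (Const c) = c \<odot>\<^bsub>B\<^esub> \<one>\<^bsub>B\<^esub>"
| "star_eval B n v (Add p q) = star_eval B n v p \<oplus>\<^bsub>B\<^esub> star_eval B n v q"
| "star_eval B n v (Mul p q) = star_eval B n v p \<otimes>\<^bsub>B\<^esub> star_eval B n v q"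
| "star_eval B n v (Star p) = star B (star_eval B n v p)"

lemma star_eval_dense:
  assumes B: "cstar_algebra B" and v: "\<And>i j. \<lbrakk>i < n; j < n\<rbrakk> \<Longrightarrow> v i j \<in> carrier B"
    and x: "x \<in> cstar_generated B {v i j | i j. i < n \<and> j < n}" and e: "e > 0"
  shows "\<exists>p. nrm B (star_eval B n v p \<ominus>\<^bsub>B\<^esub> x) < e"
proof -
  interpret B: ring B by (rule cstar_algebra_ring[OF B])
  note ca = cstar_algebra.star_closed[OF B] cstar_smult(1)[OF B]
  let ?ev = "star_eval B n v"
  have ev: "?ev p \<in> carrier B" for p
    by (induction p) (auto simp: v ca)
  have zero: "nrm B (x \<ominus>\<^bsub>B\<^esub> x) = 0" if "x \<in> carrier B" for x
    using that by (simp add: B.r_neg a_minus_def cstar_nrm_zero[OF B])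
  define E where "E = {x \<in> carrier B. \<forall>e>0. \<exists>p. nrm B (?ev p \<ominus>\<^bsub>B\<^esub> x) < e}"
  have E: "cstar_subalgebra B E"
    unfolding cstar_subalgebra_def nrm_closed_def
  proof (intro conjI ballI allI impI)
    show "E \<subseteq> carrier B" by (auto simp: E_def)
    have "nrm B (?ev (Const 1) \<ominus>\<^bsub>B\<^esub> \<one>\<^bsub>B\<^esub>) = 0"
      using zero[OF B.one_closed] cstar_smult(5)[OF B B.one_closed] by simp
    then show "\<one>\<^bsub>B\<^esub> \<in> E" unfolding E_def by (auto intro!: exI[of _ "Const 1"] simp del: star_eval.simps)
  next
    fix x y assume "x \<in> E" "y \<in> E"
    then have x: "x \<in> carrier B" "\<And>e. e > 0 \<Longrightarrow> \<exists>p. nrm B (?ev p \<ominus>\<^bsub>B\<^esub> x) < e"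
      and y: "y \<in> carrier B" "\<And>e. e > 0 \<Longrightarrow> \<exists>p. nrm B (?ev p \<ominus>\<^bsub>B\<^esub> y) < e"
      by (auto simp: E_def)
    have "\<exists>r. nrm B (?ev r \<ominus>\<^bsub>B\<^esub> (x \<oplus>\<^bsub>B\<^esub> y)) < e" if e: "e > 0" for e
    proof -
      obtain p q where p: "nrm B (?ev p \<ominus>\<^bsub>B\<^esub> x) < e / 2" and q: "nrm B (?ev q \<ominus>\<^bsub>B\<^esub> y) < e / 2"
        using x(2)[of "e / 2"] y(2)[of "e / 2"] e by auto
      have "?ev (Add p q) \<ominus>\<^bsub>B\<^esub> (x \<oplus>\<^bsub>B\<^esub> y) = (?ev p \<ominus>\<^bsub>B\<^esub> x) \<oplus>\<^bsub>B\<^esub> (?ev q \<ominus>\<^bsub>B\<^esub> y)"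
        using x(1) y(1) ev by (simp add: a_minus_def B.minus_add B.a_ac)
      then have "nrm B (?ev (Add p q) \<ominus>\<^bsub>B\<^esub> (x \<oplus>\<^bsub>B\<^esub> y)) < e"
        using cstar_algebra.nrm_triangle[OF B, of "?ev p \<ominus>\<^bsub>B\<^esub> x" "?ev q \<ominus>\<^bsub>B\<^esub> y"] p q x(1) y(1) ev
        by simp
      then show ?thesis by blast
    qed
    then show "x \<oplus>\<^bsub>B\<^esub> y \<in> E" using x y by (simp add: E_def)
    have "\<exists>r. nrm B (?ev r \<ominus>\<^bsub>B\<^esub> (x \<otimes>\<^bsub>B\<^esub> y)) < e" if e: "e > 0" for e
    proof -
      define M where "M = nrm B x + nrm B y + 2"
      have nn: "0 \<le> nrm B x" "0 \<le> nrm B y" using cstar_algebra.nrm_nonneg[OF B] x y by auto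
      then have M: "M > 0" by (simp add: M_def)
      define d where "d = min 1 (e / M)"
      have d: "0 < d" "d \<le> 1" "d \<le> e / M" using e M by (auto simp: d_def)
      obtain p q where p: "nrm B (?ev p \<ominus>\<^bsub>B\<^esub> x) < d" and q: "nrm B (?ev q \<ominus>\<^bsub>B\<^esub> y) < d"
        using x(2)[OF d(1)] y(2)[OF d(1)] by auto
      let ?a = "?ev p" and ?b = "?ev q"
      have dc: "?a \<ominus>\<^bsub>B\<^esub> x \<in> carrier B" "?b \<ominus>\<^bsub>B\<^esub> y \<in> carrier B" using ev x y by auto
      have "?ev (Mul p q) \<ominus>\<^bsub>B\<^esub> (x \<otimes>\<^bsub>B\<^esub> y)
          = ?a \<otimes>\<^bsub>B\<^esub> (?b \<ominus>\<^bsub>B\<^esub> y) \<oplus>\<^bsub>B\<^esub> (?a \<ominus>\<^bsub>B\<^esub> x) \<otimes>\<^bsub>B\<^esub> y"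
        using x(1) y(1) ev[of p] ev[of q]
        by (simp add: a_minus_def B.r_distr B.l_distr B.r_minus B.l_minus B.a_assoc B.r_neg1)
      then have "nrm B (?ev (Mul p q) \<ominus>\<^bsub>B\<^esub> (x \<otimes>\<^bsub>B\<^esub> y))
          \<le> nrm B (?a \<otimes>\<^bsub>B\<^esub> (?b \<ominus>\<^bsub>B\<^esub> y)) + nrm B ((?a \<ominus>\<^bsub>B\<^esub> x) \<otimes>\<^bsub>B\<^esub> y)"
        using cstar_algebra.nrm_triangle[OF B] ev dc y(1) by simp
      also have "\<dots> \<le> nrm B ?a * nrm B (?b \<ominus>\<^bsub>B\<^esub> y) + nrm B (?a \<ominus>\<^bsub>B\<^esub> x) * nrm B y"
        using cstar_algebra.nrm_mult[OF B] ev dc y(1) by (intro add_mono) auto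
      also have "\<dots> \<le> (nrm B x + 1) * d + d * nrm B y"
      proof -
        have "nrm B ?a \<le> nrm B x + nrm B (x \<ominus>\<^bsub>B\<^esub> ?a)"
          by (rule cstar_nrm_diff(2)[OF B x(1) ev])
        then have "nrm B ?a \<le> nrm B x + 1" using p d cstar_nrm_diff(1)[OF B x(1) ev] by simp
        then show ?thesis
          using p q nn d cstar_algebra.nrm_nonneg[OF B] dc by (intro add_mono mult_mono) auto
      qed
      also have "\<dots> < d * M" using d by (simp add: M_def algebra_simps)
      also have "\<dots> \<le> e" using d M by (simp add: field_simps)
      finally show ?thesis by blast
    qed
    then show "x \<otimes>\<^bsub>B\<^esub> y \<in> E" using x y by (simp add: E_def)
  next
    fix x assume "x \<in> E"
    then have x: "x \<in> carrier B" "\<And>e. e > 0 \<Longrightarrow> \<exists>p. nrm B (?ev p \<ominus>\<^bsub>B\<^esub> x) < e" by (auto simp: E_def)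
    have "nrm B (?ev (Star p) \<ominus>\<^bsub>B\<^esub> star B x) = nrm B (?ev p \<ominus>\<^bsub>B\<^esub> x)" for p
    proof -
      have "star B (?ev p \<ominus>\<^bsub>B\<^esub> x) = ?ev (Star p) \<ominus>\<^bsub>B\<^esub> star B x"
        using cstar_minus(1)[OF B ev x(1), of p] cstar_minus(1)[OF B, of "?ev (Star p)" "star B x"]
          cstar_algebra.star_add[OF B ev] cstar_algebra.star_smult[OF B x(1)] ca x(1) ev by simp
      then show ?thesis using cstar_nrm_star[OF B cstar_minus(2)[OF B ev x(1)]] by metis
    qed
    then show "star B x \<in> E" using x ca unfolding E_def by (simp del: star_eval.simps) metis
    fix c
    have "\<exists>r. nrm B (?ev r \<ominus>\<^bsub>B\<^esub> (c \<odot>\<^bsub>B\<^esub> x)) < e" if e: "e > 0" for e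
    proof -
      obtain p where p: "nrm B (?ev p \<ominus>\<^bsub>B\<^esub> x) < e / (cmod c + 1)"
        using x(2)[of "e / (cmod c + 1)"] e by (auto simp: add_nonneg_pos)
      have one: "c \<odot>\<^bsub>B\<^esub> \<one>\<^bsub>B\<^esub> \<otimes>\<^bsub>B\<^esub> ?ev p = c \<odot>\<^bsub>B\<^esub> ?ev p"
        using cstar_algebra.smult_mult_left[OF B B.one_closed ev, of c p] ev by simp
      have "(- 1) \<odot>\<^bsub>B\<^esub> (c \<odot>\<^bsub>B\<^esub> x) = c \<odot>\<^bsub>B\<^esub> ((- 1) \<odot>\<^bsub>B\<^esub> x)"
        using cstar_smult(4)[OF B x(1), of "-1" c] cstar_smult(4)[OF B x(1), of c "-1"] by simp
      then have "?ev (Mul (Const c) p) \<ominus>\<^bsub>B\<^esub> (c \<odot>\<^bsub>B\<^esub> x) = c \<odot>\<^bsub>B\<^esub> (?ev p \<ominus>\<^bsub>B\<^esub> x)"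
        using one cstar_minus(1)[OF B ev x(1), of p]
          cstar_minus(1)[OF B cstar_smult(1)[OF B ev] cstar_smult(1)[OF B x(1)], of c p c]
          cstar_smult(3)[OF B ev cstar_smult(1)[OF B x(1)], of c p "-1"] by simp
      then have "nrm B (?ev (Mul (Const c) p) \<ominus>\<^bsub>B\<^esub> (c \<odot>\<^bsub>B\<^esub> x)) = cmod c * nrm B (?ev p \<ominus>\<^bsub>B\<^esub> x)"
        using cstar_algebra.nrm_smult[OF B cstar_minus(2)[OF B ev x(1)]] by metis
      also have "\<dots> \<le> (cmod c) * (e / (cmod c + 1))" using p by (intro mult_left_mono) auto
      also have "cmod c + 1 > 0" by (simp add: add_nonneg_pos)
      then have "cmod c * (e / (cmod c + 1)) < e" using e by (simp add: field_simps)
      finally show ?thesis by blast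
    qed
    then show "c \<odot>\<^bsub>B\<^esub> x \<in> E" using x ca by (simp add: E_def)
  next
    fix X x assume X: "\<forall>k. X k \<in> E" and x: "x \<in> carrier B" and lim: "converges B X x"
    have "\<exists>r. nrm B (?ev r \<ominus>\<^bsub>B\<^esub> x) < e" if e: "e > 0" for e
    proof -
      have "\<forall>\<^sub>F k in sequentially. nrm B (X k \<ominus>\<^bsub>B\<^esub> x) < e / 2"
        using order_tendstoD(2)[OF lim[unfolded converges_def], of "e / 2"] e by simp
      then obtain k where k: "nrm B (X k \<ominus>\<^bsub>B\<^esub> x) < e / 2"
        by (auto simp: eventually_sequentially)
      have Xk: "X k \<in> carrier B" using X by (simp add: E_def)
      have "X k \<in> E" "e / 2 > 0" using X e by auto
      then obtain p where p: "nrm B (?ev p \<ominus>\<^bsub>B\<^esub> X k) < e / 2" unfolding E_def by blast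
      show ?thesis using cstar_nrm_diff(3)[OF B ev Xk x, of p] p k by (intro exI[of _ p]) simp
    qed
    then show "x \<in> E" using x by (simp add: E_def)
  qed
  have "v i j \<in> E" if "i < n" "j < n" for i j
    using that zero[OF v[OF that]] v unfolding E_def by (auto intro!: exI[of _ "Gen i j"])
  then have "cstar_generated B {v i j | i j. i < n \<and> j < n} \<subseteq> E"
    by (intro cstar_generated_least[OF E]) auto
  then show ?thesis using x e by (auto simp: E_def)
qed

theorem A_s_universal:
  fixes B :: "'b star_alg"
  assumes B: "cstar_algebra B" and v: "magic_unitary B n v"
  shows "\<exists>\<phi>\<in>star_hom (A_s n) B. (\<forall>x\<in>carrier (A_s n). nrm B (\<phi> x) \<le> nrm (A_s n) x) \<and>
           (\<forall>i<n. \<forall>j<n. \<phi> (A_s_entry n i j) = v i j)"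
proof -
  have vc: "v i j \<in> carrier B" if "i < n" "j < n" for i j using v that by (simp add: magic_unitary_def)
  define D where "D = cstar_generated B {v i j | i j. i < n \<and> j < n}"
  have Dsub: "cstar_subalgebra B D"
    unfolding D_def by (rule cstar_subalgebra_generated[OF B]) (auto intro: vc)
  then have DB: "D \<subseteq> carrier B" by (simp add: cstar_subalgebra_def)
  define C where "C = B\<lparr>carrier := D\<rparr>"
  have C: "cstar_algebra C" unfolding C_def by (rule cstar_algebra_subalgebra[OF B Dsub])
  have vD: "v i j \<in> D" if "i < n" "j < n" for i j
    using that cstar_generated_subset[of "{v i j | i j. i < n \<and> j < n}" B] by (auto simp: D_def)
  have vC: "magic_unitary C n v"
    unfolding C_def by (rule magic_unitary_subalgebra[OF B Dsub v vD])
  let ?close = "\<lambda>x k p. nrm B (star_eval B n v p \<ominus>\<^bsub>B\<^esub> x) < 1 / real (Suc k)"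
  define f :: "'b \<Rightarrow> test" where "f x = (\<lambda>k. SOME p. ?close x k p)" for x
  have f: "?close x k (f x k)" if x: "x \<in> D" for x k
    unfolding f_def
    by (rule someI_ex[of "?close x k"])
      (use star_eval_dense[OF B vc x[unfolded D_def], of "1 / real (Suc k)"] in simp)
  have evB: "star_eval B n v p \<in> carrier B" for p
  proof -
    interpret B: ring B by (rule cstar_algebra_ring[OF B])
    show ?thesis
      by (induction p) (auto simp: vc cstar_algebra.star_closed[OF B] cstar_smult(1)[OF B])
  qed
  have inj: "inj_on f (carrier C)"
  proof (rule inj_onI)
    fix x y assume "x \<in> carrier C" "y \<in> carrier C" and eq: "f x = f y"
    then have xy: "x \<in> D" "y \<in> D" "x \<in> carrier B" "y \<in> carrier B" using DB by (auto simp: C_def)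
    have small: "nrm B (x \<ominus>\<^bsub>B\<^esub> y) < 2 / real (Suc k)" for k
    proof -
      let ?p = "star_eval B n v (f x k)"
      have "nrm B (x \<ominus>\<^bsub>B\<^esub> y) \<le> nrm B (x \<ominus>\<^bsub>B\<^esub> ?p) + nrm B (?p \<ominus>\<^bsub>B\<^esub> y)"
        by (rule cstar_nrm_diff(3)[OF B xy(3) evB xy(4)])
      also have "nrm B (x \<ominus>\<^bsub>B\<^esub> ?p) = nrm B (?p \<ominus>\<^bsub>B\<^esub> x)" by (rule cstar_nrm_diff(1)[OF B xy(3) evB])
      finally show ?thesis using f[OF xy(1), of k] f[OF xy(2), of k] eq by simp
    qed
    have "nrm B (x \<ominus>\<^bsub>B\<^esub> y) \<le> 0"
    proof (rule field_le_epsilon)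
      fix e :: real assume "e > 0"
      then obtain k where k: "2 / e < real k" using reals_Archimedean2 by blast
      then have "2 / real (Suc k) < e" using \<open>e > 0\<close> by (simp add: field_simps)
      then show "nrm B (x \<ominus>\<^bsub>B\<^esub> y) \<le> 0 + e" using small[of k] by simp
    qed
    then show "x = y"
      using cstar_nrm_diff(4)[OF B xy(3,4)] cstar_algebra.nrm_nonneg[OF B cstar_minus(2)[OF B xy(3,4)]]
      by simp
  qed
  let ?T = "image_algebra f C"
  note ops = image_algebra_ops[OF inj]
  have T: "cstar_algebra ?T" by (rule cstar_algebra_image_algebra[OF C inj])
  have Tc: "carrier ?T = f ` D" by (simp add: image_algebra_def Let_def C_def)
  have "f \<in> star_hom C ?T" using ops ring.ring_simprules(6)[OF cstar_algebra_ring[OF C]]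
    by (auto simp: star_hom_def Ring.ring_hom_def)
  then have "magic_unitary ?T n (\<lambda>i j. f (v i j))" by (rule star_hom_magic_unitary[OF C T _ vC])
  then have p: "(?T, \<lambda>i j. f (v i j)) \<in> magic_pairs n" using T by (simp add: magic_pairs_def)
  let ?p = "(?T, \<lambda>i j. f (v i j))"
  define g where "g = inv_into D f"
  have gf: "g (f x) = x" if "x \<in> D" for x using inj that by (simp add: g_def C_def inv_into_f_f)
  have ghom: "g \<in> star_hom ?T B"
  proof -
    have Cops: "add C = add B" "monoid.mult C = monoid.mult B" "one C = one B"
      "star C = star B" "smult C = smult B" "carrier C = D" by (simp_all add: C_def)
    have "\<one>\<^bsub>?T\<^esub> = f \<one>\<^bsub>B\<^esub>" by (simp add: image_algebra_def Let_def C_def)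
    then show ?thesis
      using ops Dsub gf DB unfolding star_hom_def Ring.ring_hom_def Cops cstar_subalgebra_def
      by (auto simp: Tc)
  qed
  have ev: "(\<lambda>F. F ?p) \<in> star_hom (A_s_product n) ?T" using star_hom_apply[OF p] by simp
  have sub: "carrier (A_s n) \<subseteq> carrier (A_s_product n)"
    using cstar_subalgebra_A_s by (simp add: cstar_subalgebra_def)
  have Aops: "add (A_s n) = add (A_s_product n)" "monoid.mult (A_s n) = monoid.mult (A_s_product n)"
    "one (A_s n) = one (A_s_product n)" "star (A_s n) = star (A_s_product n)"
    "smult (A_s n) = smult (A_s_product n)" "nrm (A_s n) = nrm (A_s_product n)"
    by (simp_all add: A_s_def Let_def)
  have one: "\<one>\<^bsub>A_s_product n\<^esub> \<in> carrier (A_s_product n)"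
    by (rule ring.ring_simprules(6)[OF cstar_algebra_ring[OF cstar_algebra_A_s_product]])
  have "(\<lambda>F. g (F ?p)) \<in> star_hom (A_s n) B"
    unfolding star_hom_def Ring.ring_hom_def Aops
    using star_homD[OF ev] star_homD[OF ghom] sub
      star_homD(6)[OF ev one] star_homD(6)[OF ghom star_homD(1)[OF ev one]]
    by (auto simp: subset_iff)
  moreover have "nrm B (g (F ?p)) \<le> nrm (A_s n) F" if F: "F \<in> carrier (A_s n)" for F
  proof -
    have "F ?p \<in> f ` D" using star_homD(1)[OF ev] sub F Tc by blast
    then obtain x where x: "x \<in> D" "F ?p = f x" by blast
    have "nrm ?T (f x) = nrm B x" using ops(6)[of x] x by (simp add: C_def)
    moreover have "nrm ?T (F ?p) \<le> nrm (A_s_product n) F"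
      using bounded_productD(3)[OF _ p, of F fst] sub F by auto
    ultimately show ?thesis using x gf by (simp add: Aops)
  qed
  moreover have "g (A_s_entry n i j ?p) = v i j" if "i < n" "j < n" for i j
    using that A_s_entry_apply[OF p, of i j] gf vD by simp
  ultimately show ?thesis by (intro bexI[of _ "\<lambda>F. g (F ?p)"]) auto
qed

end

theory Submission
  imports Defs
begin

text \<open>
  Let \<open>I\<close> be the closed ideal with \<open>A(X) = A\<^sub>s(n) / I\<close>. The algebra is generated by the entries
  \<open>u\<^sub>i\<^sub>j\<close>, so it suffices that any two entries commute modulo \<open>I\<close>
  (\<open>quotient_commutative_if_generators_commute\<close>).

  Since all orbit matrices are intertwiners, \<open>u\<^sub>i\<^sub>j u\<^sub>k\<^sub>l = 0\<close> unless some automorphism takes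
  \<open>(i, k)\<close> to \<open>(j, l)\<close> (\<open>A_graph_entries_vanish\<close>). So only entries \<open>P = u\<^sub>a\<^sub>b\<close> and \<open>Q = u\<^sub>c\<^sub>d\<close> with
  \<open>b = \<sigma> a\<close>, \<open>d = \<sigma> c\<close> and \<open>a \<noteq> c\<close> matter. The hypothesis on the orbits says that \<open>a\<close> and \<open>c\<close> belong
  to a triangle \<open>a, c, k\<close> in which each vertex is determined by its relations to the other two
  (\<open>rigid_triangles\<close>). Put \<open>K = u\<^sub>k\<^sub>e\<close> with \<open>e = \<sigma> k\<close>. Inserting row sums equal to \<open>1\<close> into products
  of two of the three elements \<open>P\<close>, \<open>Q\<close>, \<open>K\<close> leaves only the third one in the middle, and these
  relations combine to \<open>PQPQ = PQ\<close> (\<open>triangle_idempotent\<close>).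

  It remains to see that projections whose products are idempotent modulo \<open>I\<close> commute modulo \<open>I\<close>
  (\<open>projections_commute_mod_closed_ideal\<close>). Over a Hilbert space this is a matter of positivity; in
  the quotient the following argument uses only norms of representatives in \<open>A\<^sub>s(n)\<close>. The reflections
  \<open>f = 1 - 2P\<close> and \<open>g = 1 - 2Q\<close> are unitaries, so \<open>U = (fg)\<^sup>2\<close> is a contraction. From \<open>PQPQ = PQ\<close>
  one computes that \<open>w = fg - gf\<close> satisfies \<open>PU = P + Pw\<close> and \<open>PwU = Pw\<close> modulo \<open>I\<close>, hence
  \<open>PU\<^sup>m = P + m Pw\<close>. Bounded powers force \<open>Pw \<in> I\<close>. By symmetry \<open>Qw \<in> I\<close>, then \<open>U = 1 + w\<close> and
  \<open>wU = w\<close> modulo \<open>I\<close>, and the same argument gives \<open>w \<in> I\<close>. As \<open>w = 4(PQ - QP)\<close>, this is the claim.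
\<close>

section \<open>Pairs of idempotents in a ring\<close>

definition reflection :: "('a, 'm) ring_scheme \<Rightarrow> 'a \<Rightarrow> 'a" where
  "reflection R p = \<one>\<^bsub>R\<^esub> \<ominus>\<^bsub>R\<^esub> (p \<oplus>\<^bsub>R\<^esub> p)"

definition commutator :: "('a, 'm) ring_scheme \<Rightarrow> 'a \<Rightarrow> 'a \<Rightarrow> 'a" where
  "commutator R x y = x \<otimes>\<^bsub>R\<^esub> y \<ominus>\<^bsub>R\<^esub> y \<otimes>\<^bsub>R\<^esub> x"

context ring
begin

lemma minus_self_cancel:
  assumes "x \<in> carrier R" "y \<in> carrier R"
  shows "x \<ominus> (x \<oplus> y) = \<ominus> y" "x \<ominus> y \<oplus> y = x"
  using assms by (simp_all add: a_minus_def minus_add a_assoc l_neg r_neg2 r_neg1 r_neg)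

lemma reflection_closed: "p \<in> carrier R \<Longrightarrow> reflection R p \<in> carrier R"
  by (simp add: reflection_def)

lemma reflection_mult:
  assumes "p \<in> carrier R" "x \<in> carrier R"
  shows "reflection R p \<otimes> x = x \<ominus> (p \<otimes> x \<oplus> p \<otimes> x)"
    and "x \<otimes> reflection R p = x \<ominus> (x \<otimes> p \<oplus> x \<otimes> p)"
  using assms by (simp_all add: reflection_def a_minus_def l_distr r_distr l_minus r_minus)

lemma reflection_involution:
  assumes p: "p \<in> carrier R" "p \<otimes> p = p"
  shows "p \<otimes> reflection R p = \<ominus> p" "reflection R p \<otimes> reflection R p = \<one>"
proof -
  show 1: "p \<otimes> reflection R p = \<ominus> p"
    using p by (simp add: reflection_mult minus_self_cancel)
  have "reflection R p \<otimes> reflection R p = reflection R p \<ominus> (\<ominus> p \<oplus> \<ominus> p)"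
    using p 1 by (simp add: reflection_mult(1)[of p "reflection R p"] reflection_closed)
  also have "\<dots> = \<one>"
    using p by (simp add: reflection_def a_minus_def minus_add a_assoc l_neg r_neg1 r_neg2)
  finally show "reflection R p \<otimes> reflection R p = \<one>" .
qed

text \<open>Replacing an element \<open>x\<close> by \<open>1 - x\<close> only changes the sign of a commutator, and here this happens
  twice, so the claim is \<open>[2p, 2q] = 4[p, q]\<close>.\<close>

lemma commutator_reflection:
  assumes p: "p \<in> carrier R" and q: "q \<in> carrier R"
  shows "commutator R (reflection R p) (reflection R q) =
    (commutator R p q \<oplus> commutator R p q) \<oplus> (commutator R p q \<oplus> commutator R p q)"
proof -
  have gen: "(\<one> \<ominus> x) \<otimes> (\<one> \<ominus> y) \<ominus> (\<one> \<ominus> y) \<otimes> (\<one> \<ominus> x) = x \<otimes> y \<ominus> y \<otimes> x"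
    if x: "x \<in> carrier R" and y: "y \<in> carrier R" for x y
  proof -
    have e: "(\<one> \<ominus> x) \<otimes> (\<one> \<ominus> y) = x \<otimes> y \<oplus> (\<one> \<ominus> (x \<oplus> y))"
      "(\<one> \<ominus> y) \<otimes> (\<one> \<ominus> x) = y \<otimes> x \<oplus> (\<one> \<ominus> (x \<oplus> y))"
      using x y by (simp_all add: a_minus_def l_distr r_distr l_minus r_minus minus_add a_ac)
    have "(s \<oplus> z) \<ominus> (t \<oplus> z) = s \<ominus> t"
      if "s \<in> carrier R" "t \<in> carrier R" "z \<in> carrier R" for s t z
    proof -
      have "(s \<oplus> z) \<ominus> (t \<oplus> z) = s \<oplus> (z \<oplus> (\<ominus> z \<oplus> \<ominus> t))"
        using that by (simp add: a_minus_def minus_add a_assoc a_comm)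
      then show ?thesis using that by (simp add: a_minus_def r_neg1 r_neg2)
    qed
    then show ?thesis unfolding e using x y by simp
  qed
  show ?thesis
    unfolding commutator_def reflection_def gen[OF a_closed[OF p p] a_closed[OF q q]]
    using p q by (simp add: a_minus_def l_distr r_distr minus_add a_ac)
qed
lemma commutator_closed:
  "\<lbrakk>x \<in> carrier R; y \<in> carrier R\<rbrakk> \<Longrightarrow> commutator R x y \<in> carrier R"
  by (simp add: commutator_def)

lemma commutator_swap:
  "\<lbrakk>x \<in> carrier R; y \<in> carrier R\<rbrakk> \<Longrightarrow> commutator R y x = \<ominus> commutator R x y"
  by (simp add: commutator_def a_minus_def minus_add a_comm)

lemma commutator_eq_zero_iff:
  "\<lbrakk>x \<in> carrier R; y \<in> carrier R\<rbrakk> \<Longrightarrow> commutator R x y = \<zero> \<longleftrightarrow> x \<otimes> y = y \<otimes> x"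
  using minus_self_cancel(2)[of "x \<otimes> y" "y \<otimes> x"]
  by (auto simp: commutator_def a_minus_def r_neg)

lemma commutator_involution:
  assumes a: "a \<in> carrier R" "a \<otimes> a = \<one>" and b: "b \<in> carrier R"
  shows "commutator R a b \<otimes> a = \<ominus> (a \<otimes> commutator R a b)"
    and "commutator R b a \<otimes> a = \<ominus> (a \<otimes> commutator R b a)"
proof -
  show 1: "commutator R a b \<otimes> a = \<ominus> (a \<otimes> commutator R a b)"
  proof -
  have "a \<otimes> (a \<otimes> b) = b" using a b by (simp flip: m_assoc)
  then show ?thesis
    using a b by (simp add: commutator_def a_minus_def l_distr r_distr l_minus r_minus m_assoc
        minus_add a_comm)
  qed
  show "commutator R b a \<otimes> a = \<ominus> (a \<otimes> commutator R b a)"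
    using 1 a b commutator_swap[OF a(1) b]
    by (simp add: l_minus r_minus commutator_closed)
qed

text \<open>Write \<open>ab = ba + [a, b]\<close> in the first factor and use that \<open>ba\<close> is the inverse of \<open>ab\<close>.\<close>

lemma squared_product_of_involutions:
  assumes a: "a \<in> carrier R" "a \<otimes> a = \<one>" and b: "b \<in> carrier R" "b \<otimes> b = \<one>"
  shows "(a \<otimes> b) \<otimes> (a \<otimes> b) = \<one> \<oplus> commutator R a b \<otimes> (a \<otimes> b)"
proof -
  have "(b \<otimes> a) \<otimes> (a \<otimes> b) = b \<otimes> (a \<otimes> a) \<otimes> b" using a(1) b(1) by (simp add: m_assoc)
  then have "(b \<otimes> a) \<otimes> (a \<otimes> b) = \<one>" using a b by simp
  then have "commutator R a b \<otimes> (a \<otimes> b) = (a \<otimes> b) \<otimes> (a \<otimes> b) \<ominus> \<one>"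
    using a(1) b(1) by (simp add: commutator_def a_minus_def l_distr l_minus)
  then show ?thesis
    using a(1) b(1) by (simp add: a_minus_def a_comm[of \<one>] a_assoc l_neg)
qed

text \<open>Both sides are \<open>pq - pqp\<close>: multiplying out the left one gives \<open>pqpq - pqp\<close>.\<close>

lemma corner_commutator:
  assumes p: "p \<in> carrier R" "p \<otimes> p = p" and q: "q \<in> carrier R" "q \<otimes> q = q"
    and pqpq: "p \<otimes> q \<otimes> p \<otimes> q = p \<otimes> q"
  shows "p \<otimes> q \<otimes> commutator R p q = p \<otimes> commutator R p q"
proof -
  have [simp]: "p \<otimes> (p \<otimes> x) = p \<otimes> x" "q \<otimes> (q \<otimes> x) = q \<otimes> x" if "x \<in> carrier R" for x
    using p q that by (simp_all flip: m_assoc)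
  have "p \<otimes> (q \<otimes> (p \<otimes> q)) = p \<otimes> q" using pqpq p q by (simp add: m_assoc)
  then show ?thesis
    using p q by (simp add: commutator_def a_minus_def r_distr r_minus m_assoc)
qed

text \<open>Right multiplication by \<open>u = (ab)\<^sup>2\<close> acts on \<open>p\<close> and \<open>pw\<close> as a Jordan block of size two with
  eigenvalue \<open>1\<close>. The commutator \<open>w\<close> anticommutes with both reflections, and moving a reflection
  past \<open>w\<close> gives \<open>pwa = - paw = pw\<close> because \<open>pa = - p\<close>, and \<open>pwb = - pbw = - pw + 2pqw = pw\<close>
  because \<open>pqw = pw\<close>. Hence \<open>pw\<close> is fixed by \<open>u\<close>, and \<open>u = 1 + wab\<close> gives \<open>pu = p + pw\<close>.\<close>

lemma corner_jordan_block:
  fixes p q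
  defines "a \<equiv> reflection R p" and "b \<equiv> reflection R q"
  defines "w \<equiv> commutator R a b"
  assumes p: "p \<in> carrier R" "p \<otimes> p = p" and q: "q \<in> carrier R" "q \<otimes> q = q"
    and pqpq: "p \<otimes> q \<otimes> p \<otimes> q = p \<otimes> q"
  shows "p \<otimes> ((a \<otimes> b) \<otimes> (a \<otimes> b)) = p \<oplus> p \<otimes> w"
    and "(p \<otimes> w) \<otimes> ((a \<otimes> b) \<otimes> (a \<otimes> b)) = p \<otimes> w"
proof -
  have a: "a \<in> carrier R" "a \<otimes> a = \<one>" and b: "b \<in> carrier R" "b \<otimes> b = \<one>"
    using p q by (simp_all add: a_def b_def reflection_closed reflection_involution)
  have w: "w \<in> carrier R" using a b by (simp add: w_def commutator_closed)
  have "p \<otimes> w \<otimes> a = \<ominus> (p \<otimes> a \<otimes> w)"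
    using commutator_involution(1)[OF a b(1)] p a w by (simp add: m_assoc r_minus flip: w_def)
  then have wa: "p \<otimes> w \<otimes> a = p \<otimes> w"
    using p w by (simp add: a_def reflection_involution l_minus)
  have "p \<otimes> q \<otimes> w = p \<otimes> w"
    using corner_commutator[OF p q pqpq] p q
    unfolding w_def a_def b_def commutator_reflection[OF p(1) q(1)]
    by (simp add: r_distr commutator_closed)
  then have bw: "p \<otimes> b \<otimes> w = \<ominus> (p \<otimes> w)"
    using p q w by (simp add: b_def reflection_mult a_minus_def l_distr l_minus minus_self_cancel(1)[unfolded a_minus_def])
  have "w \<otimes> b = \<ominus> (b \<otimes> w)"
    using commutator_involution(2)[OF b a(1)] by (simp flip: w_def)
  then have "p \<otimes> w \<otimes> b = \<ominus> (p \<otimes> b \<otimes> w)"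
    using p b w by (simp add: m_assoc r_minus)
  then have wb: "p \<otimes> w \<otimes> b = p \<otimes> w" using bw p w by simp
  have wab: "p \<otimes> w \<otimes> (a \<otimes> b) = p \<otimes> w"
    using wa wb p w a b by (simp flip: m_assoc)
  show "p \<otimes> ((a \<otimes> b) \<otimes> (a \<otimes> b)) = p \<oplus> p \<otimes> w"
    using wab p w a b
    by (simp add: squared_product_of_involutions[OF a b] r_distr flip: m_assoc w_def)
  show "(p \<otimes> w) \<otimes> ((a \<otimes> b) \<otimes> (a \<otimes> b)) = p \<otimes> w"
    using wab p w a b by (metis m_assoc m_closed)
qed

text \<open>If \<open>w\<close> is killed by \<open>p\<close> and \<open>q\<close> from the left, both reflections fix \<open>w\<close> from the left, so by
  anticommutation they negate it from the right and \<open>wab = w\<close>. This is again a Jordan block, now on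
  \<open>1\<close> and \<open>w\<close>.\<close>

lemma annihilated_jordan_block:
  fixes p q
  defines "a \<equiv> reflection R p" and "b \<equiv> reflection R q"
  defines "w \<equiv> commutator R a b"
  assumes p: "p \<in> carrier R" "p \<otimes> p = p" and q: "q \<in> carrier R" "q \<otimes> q = q"
    and pw: "p \<otimes> w = \<zero>" and qw: "q \<otimes> w = \<zero>"
  shows "(a \<otimes> b) \<otimes> (a \<otimes> b) = \<one> \<oplus> w" and "w \<otimes> ((a \<otimes> b) \<otimes> (a \<otimes> b)) = w"
proof -
  have a: "a \<in> carrier R" "a \<otimes> a = \<one>" and b: "b \<in> carrier R" "b \<otimes> b = \<one>"
    using p q by (simp_all add: a_def b_def reflection_closed reflection_involution)
  have w: "w \<in> carrier R" using a b by (simp add: w_def commutator_closed)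
  \<comment> \<open>\<open>aw = w - 2pw\<close>, and likewise for \<open>b\<close>\<close>
  have aw: "a \<otimes> w = w" "b \<otimes> w = w"
    using p q w pw qw by (simp_all add: a_def b_def reflection_mult minus_eq)
  have wa: "w \<otimes> a = \<ominus> w"
    using commutator_involution(1)[OF a b(1)] aw by (simp flip: w_def)
  have wb: "w \<otimes> b = \<ominus> w"
    using commutator_involution(2)[OF b a(1)] aw by (simp flip: w_def)
  have wab: "w \<otimes> (a \<otimes> b) = w"
    using wa wb w a b by (simp add: l_minus flip: m_assoc)
  show "(a \<otimes> b) \<otimes> (a \<otimes> b) = \<one> \<oplus> w"
    using wab by (simp add: squared_product_of_involutions[OF a b] flip: w_def)
  show "w \<otimes> ((a \<otimes> b) \<otimes> (a \<otimes> b)) = w"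
    using wab w a b by (metis m_assoc m_closed)
qed

end

text \<open>Right multiplication by \<open>u\<close> has no Jordan block of size two with eigenvalue \<open>1\<close>; otherwise
  \<open>y u\<^sup>k = y + k z\<close> would grow linearly. The condition is purely algebraic, so that it can be stated
  in a quotient ring, where it is checked with the norm of the algebra above it.\<close>

definition growth_free :: "('a, 'm) ring_scheme \<Rightarrow> 'a \<Rightarrow> bool" where
  "growth_free R u \<longleftrightarrow> (\<forall>y\<in>carrier R. \<forall>z\<in>carrier R.
     y \<otimes>\<^bsub>R\<^esub> u = y \<oplus>\<^bsub>R\<^esub> z \<longrightarrow> z \<otimes>\<^bsub>R\<^esub> u = z \<longrightarrow> z = \<zero>\<^bsub>R\<^esub>)"

text \<open>If \<open>p\<close> and \<open>q\<close> are projections on a Hilbert space and \<open>pq\<close> is idempotent, then \<open>pq = qp\<close>; for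
  idempotents of a ring this fails. What replaces positivity is that the product of reflections \<open>u\<close>
  has no Jordan blocks: this forces \<open>pw = 0\<close>, then \<open>qw = 0\<close> with the roles of \<open>p\<close> and \<open>q\<close> exchanged, and
  finally \<open>w = 0\<close>, where \<open>w = 4(pq - qp)\<close>.\<close>

lemma (in ring) growth_free_idempotents_commute:
  fixes p q
  defines "a \<equiv> reflection R p" and "b \<equiv> reflection R q"
  assumes p: "p \<in> carrier R" "p \<otimes> p = p" and q: "q \<in> carrier R" "q \<otimes> q = q"
    and pqpq: "p \<otimes> q \<otimes> p \<otimes> q = p \<otimes> q" and qpqp: "q \<otimes> p \<otimes> q \<otimes> p = q \<otimes> p"
    and growth: "growth_free R ((a \<otimes> b) \<otimes> (a \<otimes> b))" "growth_free R ((b \<otimes> a) \<otimes> (b \<otimes> a))"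
    and two: "\<And>x. x \<in> carrier R \<Longrightarrow> x \<oplus> x = \<zero> \<Longrightarrow> x = \<zero>"
  shows "p \<otimes> q = q \<otimes> p"
proof -
  define w where "w = commutator R a b"
  have ab: "a \<in> carrier R" "b \<in> carrier R" using p q by (simp_all add: a_def b_def reflection_closed)
  have w: "w \<in> carrier R" using ab by (simp add: w_def commutator_closed)
  note growthD = growth[unfolded growth_free_def, rule_format]
  have pw: "p \<otimes> w = \<zero>"
    using corner_jordan_block[OF p q pqpq] growthD(1)[of p "p \<otimes> w"] p w
    by (simp add: w_def a_def b_def)
  have "q \<otimes> commutator R b a = \<zero>"
    using corner_jordan_block[OF q p qpqp] growthD(2)[of q "q \<otimes> commutator R b a"] q ab
    by (simp add: a_def b_def commutator_closed)
  then have qw: "q \<otimes> w = \<zero>"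
    using commutator_swap[OF ab] q w by (simp add: r_minus flip: w_def)
  have "w = \<zero>"
    using annihilated_jordan_block[OF p q] pw qw growthD(1)[of \<one> w] w ab
    by (simp add: w_def a_def b_def)
  then have "(commutator R p q \<oplus> commutator R p q) \<oplus> (commutator R p q \<oplus> commutator R p q) = \<zero>"
    using commutator_reflection[OF p(1) q(1)] by (simp add: w_def a_def b_def)
  then have "commutator R p q = \<zero>"
    using two commutator_closed[OF p(1) q(1)] by blast
  then show ?thesis using commutator_eq_zero_iff p q by simp
qed

section \<open>Projections modulo a closed ideal\<close>

lemma (in ideal) quot_simps:
  shows "x \<in> carrier R \<Longrightarrow> I +> x \<in> carrier (R Quot I)"
    and "x \<in> carrier R \<Longrightarrow> y \<in> carrier R \<Longrightarrow> I +> (x \<oplus> y) = (I +> x) \<oplus>\<^bsub>R Quot I\<^esub> (I +> y)"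
    and "x \<in> carrier R \<Longrightarrow> y \<in> carrier R \<Longrightarrow> I +> (x \<otimes> y) = (I +> x) \<otimes>\<^bsub>R Quot I\<^esub> (I +> y)"
    and "x \<in> carrier R \<Longrightarrow> y \<in> carrier R \<Longrightarrow> I +> (x \<ominus> y) = (I +> x) \<ominus>\<^bsub>R Quot I\<^esub> (I +> y)"
    and "I +> \<one> = \<one>\<^bsub>R Quot I\<^esub>"
    and "I +> \<zero> = \<zero>\<^bsub>R Quot I\<^esub>"
    and "x \<in> carrier R \<Longrightarrow> I +> x = \<zero>\<^bsub>R Quot I\<^esub> \<longleftrightarrow> x \<in> I"
    and "x \<in> carrier R \<Longrightarrow> y \<in> carrier R \<Longrightarrow> I +> x = I +> y \<longleftrightarrow> x \<ominus> y \<in> I"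
proof -
  interpret Q: ring "R Quot I" by (rule quotient_is_ring)
  note hom = rcos_ring_hom
  show closed: "x \<in> carrier R \<Longrightarrow> I +> x \<in> carrier (R Quot I)" for x
    by (rule ring_hom_closed[OF hom])
  show add: "x \<in> carrier R \<Longrightarrow> y \<in> carrier R \<Longrightarrow> I +> (x \<oplus> y) = (I +> x) \<oplus>\<^bsub>R Quot I\<^esub> (I +> y)" for x y
    by (rule ring_hom_add[OF hom])
  show "x \<in> carrier R \<Longrightarrow> y \<in> carrier R \<Longrightarrow> I +> (x \<otimes> y) = (I +> x) \<otimes>\<^bsub>R Quot I\<^esub> (I +> y)"
    by (rule ring_hom_mult[OF hom])
  show "I +> \<one> = \<one>\<^bsub>R Quot I\<^esub>" by (rule ring_hom_one[OF hom])
  show zero: "I +> \<zero> = \<zero>\<^bsub>R Quot I\<^esub>"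
    by (rule ring_hom_zero[OF hom ring_axioms quotient_is_ring])
  have "I +> \<ominus> y = \<ominus>\<^bsub>R Quot I\<^esub> (I +> y)" if "y \<in> carrier R" for y
    using add[of "\<ominus> y" y] that zero closed Q.minus_equality by (simp add: l_neg)
  then show "x \<in> carrier R \<Longrightarrow> y \<in> carrier R \<Longrightarrow> I +> (x \<ominus> y) = (I +> x) \<ominus>\<^bsub>R Quot I\<^esub> (I +> y)"
    using add by (simp add: a_minus_def)
  have z: "\<zero>\<^bsub>R Quot I\<^esub> = I" by (simp add: FactRing_def)
  show "x \<in> carrier R \<Longrightarrow> I +> x = \<zero>\<^bsub>R Quot I\<^esub> \<longleftrightarrow> x \<in> I"
    unfolding z using a_rcos_self[of x] a_rcos_zero[OF ideal_axioms, of x] by metis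
  show "x \<in> carrier R \<Longrightarrow> y \<in> carrier R \<Longrightarrow> I +> x = I +> y \<longleftrightarrow> x \<ominus> y \<in> I"
    using quotient_eq_iff_same_a_r_cos[OF ideal_axioms, of x y] by blast
qed

lemma quotient_carrier:
  "carrier (R Quot I) = (\<lambda>x. I +>\<^bsub>R\<^esub> x) ` carrier R"
  by (auto simp: FactRing_def A_RCOSETS_def RCOSETS_def a_r_coset_def)

lemma ideal_smult:
  assumes A: "cstar_algebra A" and I: "ideal I A" and x: "x \<in> I"
  shows "c \<odot>\<^bsub>A\<^esub> x \<in> I"
proof -
  interpret ideal I A by (rule I)
  have xc: "x \<in> carrier A" using x by (rule a_Hcarr)
  have "(c \<odot>\<^bsub>A\<^esub> \<one>\<^bsub>A\<^esub>) \<otimes>\<^bsub>A\<^esub> x = c \<odot>\<^bsub>A\<^esub> x"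
    using cstar_algebra.smult_mult_left[OF A one_closed xc] xc by simp
  then show ?thesis using I_l_closed[OF x cstar_smult(1)[OF A one_closed]] by metis
qed

text \<open>The reflection \<open>1 - 2p\<close> is a self-adjoint unitary.\<close>

lemma nrm_reflection_le_one:
  assumes A: "cstar_algebra A" and p: "p \<in> carrier A" "star A p = p" "p \<otimes>\<^bsub>A\<^esub> p = p"
  shows "nrm A (reflection A p) \<le> 1"
proof -
  interpret ring A by (rule cstar_algebra_ring[OF A])
  let ?a = "reflection A p"
  have pp: "p \<oplus>\<^bsub>A\<^esub> p \<in> carrier A" using p by simp
  have a: "?a \<in> carrier A" by (rule reflection_closed[OF p(1)])
  have "star A ?a = ?a"
    unfolding reflection_def cstar_minus(1)[OF A one_closed pp]
    using p pp by (simp add: cstar_algebra.star_add[OF A] cstar_algebra.star_smult[OF A]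
        cstar_smult(1)[OF A] cstar_star_one[OF A])
  then have "(nrm A ?a)\<^sup>2 = nrm A \<one>\<^bsub>A\<^esub>"
    using cstar_algebra.cstar_identity[OF A a] reflection_involution(2)[OF p(1,3)] by simp
  then have "(nrm A ?a)\<^sup>2 \<le> 1\<^sup>2" using cstar_nrm_one[OF A] by simp
  then show ?thesis by (rule power2_le_imp_le) simp
qed

lemma nrm_mult_le_one:
  assumes A: "cstar_algebra A" and "x \<in> carrier A" "y \<in> carrier A" "nrm A x \<le> 1" "nrm A y \<le> 1"
  shows "nrm A (x \<otimes>\<^bsub>A\<^esub> y) \<le> 1"
  using cstar_algebra.nrm_mult[OF A assms(2,3)] cstar_algebra.nrm_nonneg[OF A assms(2)]
    cstar_algebra.nrm_nonneg[OF A assms(3)] mult_mono[OF assms(4,5)] assms by simp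

text \<open>If \<open>y u = y + z\<close> and \<open>z u = z\<close> modulo \<open>I\<close>, then \<open>y u\<^sup>k = y + k z\<close> modulo \<open>I\<close>. For a contraction
  \<open>u\<close> the elements \<open>(y u\<^sup>k - y) / k\<close> tend to \<open>0\<close>, so \<open>z\<close> is a limit of the elements
  \<open>z - (y u\<^sup>k - y) / k\<close> of \<open>I\<close>.\<close>

lemma growth_free_contraction:
  assumes A: "cstar_algebra A" and I: "ideal I A" and closed: "nrm_closed A I"
    and u: "u \<in> carrier A" "nrm A u \<le> 1"
  shows "growth_free (A Quot I) (I +>\<^bsub>A\<^esub> u)"
  unfolding growth_free_def
proof (intro ballI impI)
  interpret I: ideal I A by (rule I)
  interpret Q: ring "A Quot I" by (rule I.quotient_is_ring)
  let ?h = "(\<lambda>x. I +>\<^bsub>A\<^esub> x)"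
  note q = I.quot_simps
  note sm = cstar_smult[OF A]
  fix Y Z assume "Y \<in> carrier (A Quot I)" "Z \<in> carrier (A Quot I)"
    and YZ: "Y \<otimes>\<^bsub>A Quot I\<^esub> ?h u = Y \<oplus>\<^bsub>A Quot I\<^esub> Z" and ZZ: "Z \<otimes>\<^bsub>A Quot I\<^esub> ?h u = Z"
  then obtain y z where y: "y \<in> carrier A" "Y = ?h y" and z: "z \<in> carrier A" "Z = ?h z"
    by (auto simp: quotient_carrier)
  have pow: "u [^]\<^bsub>A\<^esub> (k::nat) \<in> carrier A" "nrm A (u [^]\<^bsub>A\<^esub> k) \<le> 1" for k
  proof -
    show "u [^]\<^bsub>A\<^esub> (k::nat) \<in> carrier A" for k using u by simp
    then show "nrm A (u [^]\<^bsub>A\<^esub> k) \<le> 1"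
      by (induction k) (use u cstar_nrm_one[OF A] in \<open>auto intro: nrm_mult_le_one[OF A]\<close>)
  qed
  \<comment> \<open>Scalars are central, so every multiple of \<open>z\<close> is fixed by \<open>u\<close> as well.\<close>
  have zu: "?h ((of_nat k \<odot>\<^bsub>A\<^esub> z) \<otimes>\<^bsub>A\<^esub> u) = ?h (of_nat k \<odot>\<^bsub>A\<^esub> z)" for k
  proof -
    have e: "of_nat k \<odot>\<^bsub>A\<^esub> z = (of_nat k \<odot>\<^bsub>A\<^esub> \<one>\<^bsub>A\<^esub>) \<otimes>\<^bsub>A\<^esub> z"
      using cstar_algebra.smult_mult_left[OF A I.one_closed z(1)] z by simp
    show ?thesis
      unfolding e using ZZ z u sm(1)[OF I.one_closed]
      by (simp add: I.m_assoc q(1) q(3))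
  qed
  have lin: "?h (y \<otimes>\<^bsub>A\<^esub> u [^]\<^bsub>A\<^esub> k) = ?h (y \<oplus>\<^bsub>A\<^esub> of_nat k \<odot>\<^bsub>A\<^esub> z)" for k :: nat
  proof (induction k)
    case 0
    then show ?case using y z by (simp add: sm)
  next
    case (Suc k)
    let ?kz = "of_nat k \<odot>\<^bsub>A\<^esub> z"
    have kz: "?kz \<in> carrier A" using z by (simp add: sm)
    have "?h (y \<otimes>\<^bsub>A\<^esub> u [^]\<^bsub>A\<^esub> Suc k) = ?h (y \<otimes>\<^bsub>A\<^esub> u [^]\<^bsub>A\<^esub> k) \<otimes>\<^bsub>A Quot I\<^esub> ?h u"
      using y u pow by (simp add: q(3)[symmetric] I.m_assoc)
    also have "\<dots> = ?h (y \<otimes>\<^bsub>A\<^esub> u) \<oplus>\<^bsub>A Quot I\<^esub> ?h (?kz \<otimes>\<^bsub>A\<^esub> u)"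
      unfolding Suc using y kz u by (simp add: q(2,3)[symmetric] I.l_distr)
    also have "\<dots> = (?h y \<oplus>\<^bsub>A Quot I\<^esub> ?h z) \<oplus>\<^bsub>A Quot I\<^esub> ?h ?kz"
      unfolding zu using YZ y z u by (simp add: q(3))
    also have "\<dots> = ?h (y \<oplus>\<^bsub>A\<^esub> (z \<oplus>\<^bsub>A\<^esub> ?kz))"
      using y z kz by (simp add: q(2)[symmetric] I.a_assoc)
    also have "z \<oplus>\<^bsub>A\<^esub> ?kz = of_nat (Suc k) \<odot>\<^bsub>A\<^esub> z"
      using sm(2)[OF z(1), of 1 "of_nat k"] sm(5)[OF z(1)] by simp
    finally show ?case .
  qed
  let ?d = "\<lambda>k. y \<otimes>\<^bsub>A\<^esub> u [^]\<^bsub>A\<^esub> (k::nat) \<ominus>\<^bsub>A\<^esub> y"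
  have d: "?d k \<in> carrier A" "nrm A (?d k) \<le> 2 * nrm A y" for k
  proof -
    show "?d k \<in> carrier A" for k using y pow by simp
    have "nrm A (?d k) \<le> nrm A (y \<otimes>\<^bsub>A\<^esub> u [^]\<^bsub>A\<^esub> k) + nrm A y"
      using cstar_minus(1)[OF A _ y(1), of "y \<otimes>\<^bsub>A\<^esub> u [^]\<^bsub>A\<^esub> k"] y pow
        cstar_algebra.nrm_triangle[OF A, of "y \<otimes>\<^bsub>A\<^esub> u [^]\<^bsub>A\<^esub> k" "(- 1) \<odot>\<^bsub>A\<^esub> y"]
        cstar_algebra.nrm_smult[OF A y(1), of "- 1"] by (simp add: sm)
    moreover have "nrm A (y \<otimes>\<^bsub>A\<^esub> u [^]\<^bsub>A\<^esub> k) \<le> nrm A y * 1"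
      using cstar_algebra.nrm_mult[OF A y(1) pow(1)[of k]] cstar_algebra.nrm_nonneg[OF A y(1)] pow(2)[of k]
      by (meson mult_left_mono order_trans)
    ultimately show "nrm A (?d k) \<le> 2 * nrm A y" by simp
  qed
  \<comment> \<open>Indices are shifted by one to avoid dividing by zero.\<close>
  define X where "X k = z \<ominus>\<^bsub>A\<^esub> (1 / of_nat (Suc k)) \<odot>\<^bsub>A\<^esub> ?d (Suc k)" for k
  have X: "X k \<in> I" for k
  proof -
    let ?n = "of_nat (Suc k) :: complex"
    have n: "?n \<noteq> 0" by (simp del: of_nat_Suc)
    have nz: "?n \<odot>\<^bsub>A\<^esub> z \<in> carrier A" using z by (simp add: sm del: of_nat_Suc)
    have "?h (?d (Suc k)) = ?h (?n \<odot>\<^bsub>A\<^esub> z)"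
    proof -
      have "?h (?d (Suc k)) = ?h (y \<otimes>\<^bsub>A\<^esub> u [^]\<^bsub>A\<^esub> Suc k) \<ominus>\<^bsub>A Quot I\<^esub> ?h y"
        using y pow[of "Suc k"] by (simp add: q(4) del: nat_pow_Suc I.nat_pow_Suc)
      also have "\<dots> = ?h ((y \<oplus>\<^bsub>A\<^esub> ?n \<odot>\<^bsub>A\<^esub> z) \<ominus>\<^bsub>A\<^esub> y)"
        unfolding lin using y nz by (simp add: q(4))
      also have "(y \<oplus>\<^bsub>A\<^esub> ?n \<odot>\<^bsub>A\<^esub> z) \<ominus>\<^bsub>A\<^esub> y = ?n \<odot>\<^bsub>A\<^esub> z"
        using y nz by (simp add: a_minus_def I.a_assoc I.a_comm[of _ "\<ominus>\<^bsub>A\<^esub> y"] I.r_neg2 I.r_neg1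
            del: of_nat_Suc)
      finally show ?thesis .
    qed
    then have "?n \<odot>\<^bsub>A\<^esub> z \<ominus>\<^bsub>A\<^esub> ?d (Suc k) \<in> I"
      unfolding q(8)[OF nz d(1), symmetric] by (rule sym)
    then have "(1 / ?n) \<odot>\<^bsub>A\<^esub> (?n \<odot>\<^bsub>A\<^esub> z \<ominus>\<^bsub>A\<^esub> ?d (Suc k)) \<in> I"
      by (rule ideal_smult[OF A I])
    moreover have "(1 / ?n) \<odot>\<^bsub>A\<^esub> (?n \<odot>\<^bsub>A\<^esub> z \<ominus>\<^bsub>A\<^esub> ?d (Suc k)) = X k"
    proof -
      note dc = d(1)[of "Suc k"]
      have "(1 / ?n) \<odot>\<^bsub>A\<^esub> (?n \<odot>\<^bsub>A\<^esub> z) = z"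
        using sm(4)[OF z(1), of "1 / ?n" ?n] sm(5)[OF z(1)] n by (simp del: of_nat_Suc)
      moreover have "(1 / ?n) \<odot>\<^bsub>A\<^esub> ((- 1) \<odot>\<^bsub>A\<^esub> ?d (Suc k)) = (- 1) \<odot>\<^bsub>A\<^esub> ((1 / ?n) \<odot>\<^bsub>A\<^esub> ?d (Suc k))"
        using sm(4)[OF dc, of "1 / ?n" "- 1"] sm(4)[OF dc, of "- 1" "1 / ?n"] by (simp del: of_nat_Suc)
      ultimately show ?thesis
        unfolding X_def cstar_minus(1)[OF A nz dc] cstar_minus(1)[OF A z(1) sm(1)[OF dc]]
        using sm(3)[OF nz sm(1)[OF dc, of "-1"], of "1 / ?n"] by simp
    qed
    ultimately show ?thesis by simp
  qed
  have "converges A X z"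
  proof -
    have upper: "nrm A (X k \<ominus>\<^bsub>A\<^esub> z) \<le> 2 * nrm A y * inverse (of_nat (Suc k))" for k
    proof -
      let ?e = "(1 / of_nat (Suc k)) \<odot>\<^bsub>A\<^esub> ?d (Suc k)"
      have e: "?e \<in> carrier A" by (rule sm(1)[OF d(1)])
      have Xc: "X k \<in> carrier A" using X by (rule I.a_Hcarr)
      have "nrm A (X k \<ominus>\<^bsub>A\<^esub> z) = nrm A (z \<ominus>\<^bsub>A\<^esub> X k)" by (rule cstar_nrm_diff(1)[OF A Xc z(1)])
      also have "z \<ominus>\<^bsub>A\<^esub> X k = ?e"
        unfolding X_def using z e by (simp add: a_minus_def I.minus_add I.r_neg1 I.r_neg2)
      also have "nrm A ?e = inverse (of_nat (Suc k)) * nrm A (?d (Suc k))"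
        unfolding cstar_algebra.nrm_smult[OF A d(1)] norm_divide norm_of_nat
        by (simp only: norm_one inverse_eq_divide)
      also have "\<dots> \<le> inverse (of_nat (Suc k)) * (2 * nrm A y)"
        by (intro mult_left_mono d(2)) simp
      finally show ?thesis by (simp add: mult.commute)
    qed
    have lim: "(\<lambda>k. 2 * nrm A y * inverse (of_nat (Suc k))) \<longlonglongrightarrow> 0"
      by (intro tendsto_mult_right_zero LIMSEQ_inverse_real_of_nat)
    have lower: "0 \<le> nrm A (X k \<ominus>\<^bsub>A\<^esub> z)" for k
      using X z by (intro cstar_algebra.nrm_nonneg[OF A] I.minus_closed) (auto intro: I.a_Hcarr)
    show ?thesis
      unfolding converges_def
      by (rule tendsto_sandwich[OF _ _ tendsto_const lim]) (simp_all only: lower upper always_eventually simp_thms)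
  qed
  then have "z \<in> I" using closed X z by (auto simp: nrm_closed_def)
  then show "Z = \<zero>\<^bsub>A Quot I\<^esub>" using q(7)[OF z(1)] z by simp
qed

text \<open>The elements \<open>(ab)\<^sup>2\<close> and \<open>(ba)\<^sup>2\<close> of \<open>A\<close> are products of unitaries, hence contractions, and this
  keeps their images in the quotient free of Jordan blocks.\<close>

lemma projections_commute_mod_closed_ideal:
  assumes A: "cstar_algebra A" and I: "ideal I A" and closed: "nrm_closed A I"
    and p: "p \<in> carrier A" "star A p = p" "p \<otimes>\<^bsub>A\<^esub> p = p"
    and q: "q \<in> carrier A" "star A q = q" "q \<otimes>\<^bsub>A\<^esub> q = q"
  defines "R \<equiv> A Quot I" and "P \<equiv> I +>\<^bsub>A\<^esub> p" and "Q \<equiv> I +>\<^bsub>A\<^esub> q"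
  assumes PQPQ: "P \<otimes>\<^bsub>R\<^esub> Q \<otimes>\<^bsub>R\<^esub> P \<otimes>\<^bsub>R\<^esub> Q = P \<otimes>\<^bsub>R\<^esub> Q"
    and QPQP: "Q \<otimes>\<^bsub>R\<^esub> P \<otimes>\<^bsub>R\<^esub> Q \<otimes>\<^bsub>R\<^esub> P = Q \<otimes>\<^bsub>R\<^esub> P"
  shows "P \<otimes>\<^bsub>R\<^esub> Q = Q \<otimes>\<^bsub>R\<^esub> P"
proof -
  interpret I: ideal I A by (rule I)
  interpret R: ring R unfolding R_def by (rule I.quotient_is_ring)
  note qs = I.quot_simps[folded R_def]
  let ?a = "reflection A p" and ?b = "reflection A q"
  have refl: "I +>\<^bsub>A\<^esub> reflection A x = reflection R (I +>\<^bsub>A\<^esub> x)" if "x \<in> carrier A" for x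
    using that by (simp add: reflection_def qs)
  have c: "?a \<in> carrier A" "?b \<in> carrier A" using p q by (auto intro: I.reflection_closed)
  have n: "nrm A ?a \<le> 1" "nrm A ?b \<le> 1" using nrm_reflection_le_one[OF A] p q by auto
  have "growth_free R (I +>\<^bsub>A\<^esub> ((?a \<otimes>\<^bsub>A\<^esub> ?b) \<otimes>\<^bsub>A\<^esub> (?a \<otimes>\<^bsub>A\<^esub> ?b)))"
    "growth_free R (I +>\<^bsub>A\<^esub> ((?b \<otimes>\<^bsub>A\<^esub> ?a) \<otimes>\<^bsub>A\<^esub> (?b \<otimes>\<^bsub>A\<^esub> ?a)))"
    unfolding R_def using c n
    by (auto intro!: growth_free_contraction[OF A I closed] nrm_mult_le_one[OF A])
  then have growth: "growth_free R ((reflection R P \<otimes>\<^bsub>R\<^esub> reflection R Q) \<otimes>\<^bsub>R\<^esub> (reflection R P \<otimes>\<^bsub>R\<^esub> reflection R Q))"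
    "growth_free R ((reflection R Q \<otimes>\<^bsub>R\<^esub> reflection R P) \<otimes>\<^bsub>R\<^esub> (reflection R Q \<otimes>\<^bsub>R\<^esub> reflection R P))"
    using c p q by (simp_all add: qs(3) refl P_def Q_def)
  have two: "x = \<zero>\<^bsub>R\<^esub>" if "x \<in> carrier R" "x \<oplus>\<^bsub>R\<^esub> x = \<zero>\<^bsub>R\<^esub>" for x
  proof -
    obtain y where y: "y \<in> carrier A" "x = I +>\<^bsub>A\<^esub> y" using \<open>x \<in> carrier R\<close> by (auto simp: R_def quotient_carrier)
    then have "y \<oplus>\<^bsub>A\<^esub> y \<in> I" using that(2) by (simp add: qs(2)[symmetric] qs(7))
    moreover have "y \<oplus>\<^bsub>A\<^esub> y = 2 \<odot>\<^bsub>A\<^esub> y"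
      using cstar_smult(2)[OF A y(1), of 1 1] cstar_smult(5)[OF A y(1)] by simp
    ultimately have "(1 / 2) \<odot>\<^bsub>A\<^esub> (2 \<odot>\<^bsub>A\<^esub> y) \<in> I" using ideal_smult[OF A I] by metis
    then have "y \<in> I"
      using cstar_smult(4)[OF A y(1), of "1 / 2" 2] cstar_smult(5)[OF A y(1)] by simp
    then show ?thesis using y qs(7) by simp
  qed
  have "P \<in> carrier R" "P \<otimes>\<^bsub>R\<^esub> P = P" "Q \<in> carrier R" "Q \<otimes>\<^bsub>R\<^esub> Q = Q"
    using p q by (simp_all add: P_def Q_def qs(1) qs(3)[symmetric])
  from R.growth_free_idempotents_commute[OF this PQPQ QPQP growth two] show ?thesis .
qed

section \<open>Passing from generators to the whole algebra\<close>

lemma nrm_closedD: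
  "\<lbrakk>nrm_closed A D; x \<in> carrier A; \<And>k. X k \<in> D; converges A X x\<rbrakk> \<Longrightarrow> x \<in> D"
  unfolding nrm_closed_def by metis

text \<open>Membership of \<open>star A x\<close> is imposed separately: the commutant of a non-self-adjoint \<open>y\<close> need not be
  closed under the involution.\<close>

lemma commutant_mod_closed_ideal:
  assumes A: "cstar_algebra A" and I: "ideal I A" and closed: "nrm_closed A I" and y: "y \<in> carrier A"
  shows "cstar_subalgebra A
    {x \<in> carrier A. commutator A x y \<in> I \<and> commutator A (star A x) y \<in> I}" (is "cstar_subalgebra A ?C")
proof -
  interpret I: ideal I A by (rule I)
  interpret Q: ring "A Quot I" by (rule I.quotient_is_ring)
  let ?h = "(\<lambda>x. I +>\<^bsub>A\<^esub> x)"
  note q = I.quot_simps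
  note sm = cstar_smult[OF A]
  note st = cstar_algebra.star_closed[OF A]
  have com: "commutator A x y \<in> I \<longleftrightarrow> ?h x \<otimes>\<^bsub>A Quot I\<^esub> ?h y = ?h y \<otimes>\<^bsub>A Quot I\<^esub> ?h x"
    if "x \<in> carrier A" for x
    using that y q(8)[of "x \<otimes>\<^bsub>A\<^esub> y" "y \<otimes>\<^bsub>A\<^esub> x"] by (simp add: commutator_def q(3))
  have add: "commutator A (x \<oplus>\<^bsub>A\<^esub> x') y \<in> I"
    if "commutator A x y \<in> I" "commutator A x' y \<in> I" "x \<in> carrier A" "x' \<in> carrier A" for x x'
    using that y by (simp add: com q Q.l_distr Q.r_distr)
  have mult: "commutator A (x \<otimes>\<^bsub>A\<^esub> x') y \<in> I"
    if "commutator A x y \<in> I" "commutator A x' y \<in> I" "x \<in> carrier A" "x' \<in> carrier A" for x x'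
    using that y by (simp add: com q) (metis Q.m_assoc q(1))
  have smult: "commutator A (c \<odot>\<^bsub>A\<^esub> x) y \<in> I" if "commutator A x y \<in> I" "x \<in> carrier A" for x c
  proof -
    have "commutator A (c \<odot>\<^bsub>A\<^esub> x) y = c \<odot>\<^bsub>A\<^esub> commutator A x y"
    proof -
      have xy: "x \<otimes>\<^bsub>A\<^esub> y \<in> carrier A" "y \<otimes>\<^bsub>A\<^esub> x \<in> carrier A" using that y by auto
      have "(- 1) \<odot>\<^bsub>A\<^esub> (c \<odot>\<^bsub>A\<^esub> (y \<otimes>\<^bsub>A\<^esub> x)) = c \<odot>\<^bsub>A\<^esub> ((- 1) \<odot>\<^bsub>A\<^esub> (y \<otimes>\<^bsub>A\<^esub> x))"
        using sm(4)[OF xy(2), of "- 1" c] sm(4)[OF xy(2), of c "- 1"] by simp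
      then show ?thesis
        using that(2) y xy cstar_algebra.smult_mult_left[OF A that(2) y, of c]
          cstar_algebra.smult_mult_right[OF A y that(2), of c]
        by (simp add: commutator_def cstar_minus(1)[OF A] sm(1) sm(3))
    qed
    then show ?thesis using ideal_smult[OF A I that(1)] by simp
  qed
  have limit: "commutator A x y \<in> I"
    if Z: "\<And>k. Z k \<in> carrier A" "\<And>k. commutator A (Z k) y \<in> I" and x: "x \<in> carrier A"
      and lim: "converges A Z x" for Z x
  proof -
    have le: "nrm A (commutator A (Z k) y \<ominus>\<^bsub>A\<^esub> commutator A x y)
        \<le> nrm A (Z k \<ominus>\<^bsub>A\<^esub> x) * (2 * nrm A y)" for k
    proof -
      let ?d = "Z k \<ominus>\<^bsub>A\<^esub> x"
      have d: "?d \<in> carrier A" using Z x by simp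
      have "commutator A (Z k) y \<ominus>\<^bsub>A\<^esub> commutator A x y = ?d \<otimes>\<^bsub>A\<^esub> y \<ominus>\<^bsub>A\<^esub> y \<otimes>\<^bsub>A\<^esub> ?d"
        using Z(1)[of k] x y
        by (simp add: commutator_def a_minus_def I.l_distr I.r_distr I.l_minus I.r_minus I.minus_add I.a_ac)
      also have "nrm A \<dots> \<le> nrm A (?d \<otimes>\<^bsub>A\<^esub> y) + nrm A (y \<otimes>\<^bsub>A\<^esub> ?d)"
        using cstar_minus(1)[OF A, of "?d \<otimes>\<^bsub>A\<^esub> y" "y \<otimes>\<^bsub>A\<^esub> ?d"] d y
          cstar_algebra.nrm_triangle[OF A, of "?d \<otimes>\<^bsub>A\<^esub> y" "(- 1) \<odot>\<^bsub>A\<^esub> (y \<otimes>\<^bsub>A\<^esub> ?d)"]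
          cstar_algebra.nrm_smult[OF A, of "y \<otimes>\<^bsub>A\<^esub> ?d" "- 1"] by (simp add: sm)
      also have "\<dots> \<le> nrm A ?d * nrm A y + nrm A y * nrm A ?d"
        by (intro add_mono cstar_algebra.nrm_mult[OF A] d y)
      finally show ?thesis by (simp add: algebra_simps)
    qed
    have c: "commutator A z y \<in> carrier A" if "z \<in> carrier A" for z
      using that y by (simp add: I.commutator_closed)
    have lower: "0 \<le> nrm A (commutator A (Z k) y \<ominus>\<^bsub>A\<^esub> commutator A x y)" for k
      using c x Z by (intro cstar_algebra.nrm_nonneg[OF A] I.minus_closed) auto
    have upper: "(\<lambda>k. nrm A (Z k \<ominus>\<^bsub>A\<^esub> x) * (2 * nrm A y)) \<longlonglongrightarrow> 0"
      using tendsto_mult_left_zero[OF lim[unfolded converges_def]] .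
    have "converges A (\<lambda>k. commutator A (Z k) y) (commutator A x y)"
      unfolding converges_def
      by (rule tendsto_sandwich[OF _ _ tendsto_const upper])
        (simp_all only: lower le always_eventually simp_thms)
    then show ?thesis by (rule nrm_closedD[OF closed c[OF x] Z(2)])
  qed
  show ?thesis
    unfolding cstar_subalgebra_def
  proof (intro conjI ballI allI)
    show "\<one>\<^bsub>A\<^esub> \<in> ?C"
      using y by (simp add: commutator_def cstar_star_one[OF A] a_minus_def I.r_neg)
    show "nrm_closed A ?C"
      unfolding nrm_closed_def
    proof (intro allI ballI impI)
      fix Z x assume Z: "\<forall>k. Z k \<in> ?C" and x: "x \<in> carrier A" and lim: "converges A Z x"
      have "nrm A (star A (Z k) \<ominus>\<^bsub>A\<^esub> star A x) = nrm A (Z k \<ominus>\<^bsub>A\<^esub> x)" for k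
      proof -
        have z: "Z k \<in> carrier A" using Z by simp
        have "star A (Z k) \<ominus>\<^bsub>A\<^esub> star A x = star A (Z k \<ominus>\<^bsub>A\<^esub> x)"
          using z x by (simp add: cstar_minus(1)[OF A] st sm(1) cstar_algebra.star_add[OF A]
              cstar_algebra.star_smult[OF A])
        then show ?thesis using z x by (simp add: cstar_nrm_star[OF A])
      qed
      then have "converges A (\<lambda>k. star A (Z k)) (star A x)" using lim by (simp add: converges_def)
      then show "x \<in> ?C"
        using limit[of Z x] limit[of "\<lambda>k. star A (Z k)" "star A x"] Z x lim st by simp
    qed
  qed (use add mult smult st cstar_algebra.star_add[OF A] cstar_algebra.star_mult[OF A]
      cstar_algebra.star_smult[OF A] cstar_algebra.star_star[OF A] sm(1) in auto)
qed

text \<open>The commutant argument is used twice: first for a generator in place of \<open>y\<close>, then for an arbitrary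
  element.\<close>

lemma quotient_commutative_if_generators_commute:
  assumes A: "cstar_algebra A" and I: "ideal I A" and closed: "nrm_closed A I"
    and S: "S \<subseteq> carrier A" "\<And>s. s \<in> S \<Longrightarrow> star A s = s" and gen: "cstar_generated A S = carrier A"
    and com: "\<And>s t. \<lbrakk>s \<in> S; t \<in> S\<rbrakk> \<Longrightarrow> commutator A s t \<in> I"
    and x: "x \<in> carrier A" and y: "y \<in> carrier A"
  shows "commutator A x y \<in> I"
proof -
  interpret I: ideal I A by (rule I)
  have step: "commutator A x y \<in> I" if "y \<in> carrier A" "\<And>s. s \<in> S \<Longrightarrow> commutator A s y \<in> I"
    "x \<in> carrier A" for x y
  proof -
    have "S \<subseteq> {x \<in> carrier A. commutator A x y \<in> I \<and> commutator A (star A x) y \<in> I}"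
      using S that by auto
    from cstar_generated_least[OF commutant_mod_closed_ideal[OF A I closed that(1)] this]
    show ?thesis using gen that(3) by blast
  qed
  have swap: "commutator A x y \<in> I" if "commutator A y x \<in> I" "x \<in> carrier A" "y \<in> carrier A" for x y
    using I.commutator_swap[OF that(3,2)] that(1) by simp
  have "commutator A s y \<in> I" if s: "s \<in> S" for s
  proof -
    have sc: "s \<in> carrier A" using S(1) s by blast
    show ?thesis by (rule swap[OF step[OF sc com[OF _ s] y] sc y])
  qed
  then show ?thesis using step[OF y _ x] by blast
qed

section \<open>Orbitals and rigid triangles\<close>

lemma aut_comp: "\<lbrakk>\<sigma> \<in> aut X; \<tau> \<in> aut X\<rbrakk> \<Longrightarrow> \<sigma> \<circ> \<tau> \<in> aut X"
  by (auto simp: aut_def permutes_compose permutes_in_image)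

lemma aut_inv:
  assumes s: "\<sigma> \<in> aut X"
  shows "inv_into UNIV \<sigma> \<in> aut X"
proof -
  have p: "\<sigma> permutes pverts X" using s by (simp add: aut_def)
  have "(inv_into UNIV \<sigma> i, inv_into UNIV \<sigma> j) \<in> parcs X \<longleftrightarrow> (i, j) \<in> parcs X" if "i \<in> pverts X" "j \<in> pverts X" for i j
  proof -
    have "inv_into UNIV \<sigma> i \<in> pverts X" "inv_into UNIV \<sigma> j \<in> pverts X"
      using that p by (simp_all add: permutes_inv permutes_in_image)
    then have "(\<sigma> (inv_into UNIV \<sigma> i), \<sigma> (inv_into UNIV \<sigma> j)) \<in> parcs X \<longleftrightarrow> (inv_into UNIV \<sigma> i, inv_into UNIV \<sigma> j) \<in> parcs X"
      using s by (simp add: aut_def)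
    then show ?thesis using p by (simp add: permutes_inverses)
  qed
  then show ?thesis using p by (simp add: aut_def permutes_inv)
qed

lemma aut_inverses: "\<sigma> \<in> aut X \<Longrightarrow> \<sigma> (inv_into UNIV \<sigma> i) = i" "\<sigma> \<in> aut X \<Longrightarrow> inv_into UNIV \<sigma> (\<sigma> i) = i"
  by (auto simp: aut_def permutes_inverses)

lemma aut_id: "id \<in> aut X"
  by (simp add: aut_def permutes_id)

lemma aut_pverts: "\<sigma> \<in> aut X \<Longrightarrow> \<sigma> i \<in> pverts X \<longleftrightarrow> i \<in> pverts X"
  by (simp add: aut_def permutes_in_image)

text \<open>The pairs \<open>e\<close> and \<open>f\<close> lie in the same orbit of the automorphism group on pairs. Orbitals encode all
  \<open>labelled_orbit X L i s\<close> at once: for a vertex-transitive graph, \<open>v\<close> lies in the \<open>s\<close>-th orbit at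
  \<open>i\<close> for exactly one label \<open>s\<close>, and this label determines the orbital of \<open>(v, i)\<close>.\<close>

definition same_orbital :: "nat pair_pre_digraph \<Rightarrow> nat \<times> nat \<Rightarrow> nat \<times> nat \<Rightarrow> bool" where
  "same_orbital X e f \<longleftrightarrow> (\<exists>\<sigma>\<in>aut X. map_prod \<sigma> \<sigma> e = f)"

lemma same_orbital_sym: "same_orbital X e f \<Longrightarrow> same_orbital X f e"
proof -
  assume "same_orbital X e f"
  then obtain \<sigma> where "\<sigma> \<in> aut X" "map_prod \<sigma> \<sigma> e = f" by (auto simp: same_orbital_def)
  then show ?thesis
    unfolding same_orbital_def
    by (intro bexI[of _ "inv_into UNIV \<sigma>"] aut_inv) (cases e, auto simp: aut_inverses)
qed

lemma same_orbital_trans: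
  assumes "same_orbital X e f" "same_orbital X f g" shows "same_orbital X e g"
proof -
  obtain \<sigma> \<tau> where "\<sigma> \<in> aut X" "map_prod \<sigma> \<sigma> e = f" "\<tau> \<in> aut X" "map_prod \<tau> \<tau> f = g"
    using assms by (auto simp: same_orbital_def)
  then show ?thesis
    unfolding same_orbital_def by (intro bexI[of _ "\<tau> \<circ> \<sigma>"] aut_comp) (cases e, auto)
qed

lemma same_orbital_map:
  assumes "\<sigma> \<in> aut X"
  shows "same_orbital X (\<sigma> i, \<sigma> j) f \<longleftrightarrow> same_orbital X (i, j) f"
    and "same_orbital X f (\<sigma> i, \<sigma> j) \<longleftrightarrow> same_orbital X f (i, j)"
proof -
  have "same_orbital X (i, j) (\<sigma> i, \<sigma> j)" using assms by (auto simp: same_orbital_def)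
  then show "same_orbital X (\<sigma> i, \<sigma> j) f \<longleftrightarrow> same_orbital X (i, j) f"
    "same_orbital X f (\<sigma> i, \<sigma> j) \<longleftrightarrow> same_orbital X f (i, j)"
    by (blast intro: same_orbital_sym same_orbital_trans)+
qed

lemma same_orbital_swap:
  "same_orbital X (i, k) (j, l) \<longleftrightarrow> same_orbital X (k, i) (l, j)"
  by (auto simp: same_orbital_def)

lemma moved_orbit_0:
  assumes "S \<in> orbits_0 X" shows "moved_orbit X S 0 = S"
  using moved_orbit_eq[OF assms aut_id] by simp

lemma moved_orbit_map:
  assumes S: "S \<in> orbits_0 X" and X: "vertex_transitive X" "0 \<in> pverts X" "i \<in> pverts X"
    and s: "\<sigma> \<in> aut X"
  shows "\<sigma> v \<in> moved_orbit X S (\<sigma> i) \<longleftrightarrow> v \<in> moved_orbit X S i"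
proof -
  obtain \<tau> where t: "\<tau> \<in> aut X" "\<tau> 0 = i" using X by (auto simp: vertex_transitive_def)
  have "moved_orbit X S (\<sigma> i) = \<sigma> ` moved_orbit X S i"
    using moved_orbit_eq[OF S t] moved_orbit_eq[OF S aut_comp[OF s t(1)]] t(2)
    by (simp add: image_comp)
  moreover have "inj \<sigma>" using s by (auto simp: aut_def permutes_inj)
  ultimately show ?thesis by (simp add: inj_image_mem_iff)
qed

lemma moved_orbit_same_orbital:
  assumes "S \<in> orbits_0 X" "vertex_transitive X" "0 \<in> pverts X" "i \<in> pverts X"
    and "same_orbital X (v, i) (w, j)" "v \<in> moved_orbit X S i"
  shows "w \<in> moved_orbit X S j"
  using assms moved_orbit_map by (fastforce simp: same_orbital_def)

text \<open>Apply the hypothesis to the orbit, at the base vertex \<open>0\<close>, of the point that \<open>v\<close> becomes when \<open>i\<close>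
  is moved to \<open>0\<close>.\<close>

lemma same_orbitalI:
  assumes X: "vertex_transitive X" "0 \<in> pverts X"
    and i: "i \<in> pverts X" and j: "j \<in> pverts X" and v: "v \<in> pverts X"
    and same: "\<And>S. S \<in> orbits_0 X \<Longrightarrow> v \<in> moved_orbit X S i \<Longrightarrow> w \<in> moved_orbit X S j"
  shows "same_orbital X (v, i) (w, j)"
proof -
  obtain \<sigma> \<tau> where s: "\<sigma> \<in> aut X" "\<sigma> 0 = i" and t: "\<tau> \<in> aut X" "\<tau> 0 = j"
    using X i j unfolding vertex_transitive_def by metis
  define x where "x = inv_into UNIV \<sigma> v"
  have x: "x \<in> pverts X" "\<sigma> x = v"
    using v aut_pverts[OF aut_inv[OF s(1)]] aut_inverses[OF s(1)] by (simp_all add: x_def)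
  define S where "S = (\<lambda>\<rho>. \<rho> x) ` stabilizer X 0"
  have S: "S \<in> orbits_0 X" using x by (auto simp: S_def orbits_0_def)
  have "x \<in> S" using aut_id[of X] by (auto simp: S_def stabilizer_def image_iff intro!: bexI[of _ id])
  then have "w \<in> moved_orbit X S j" using same[OF S] moved_orbit_eq[OF S s] x by blast
  then obtain \<rho> where r: "\<rho> \<in> stabilizer X 0" "w = \<tau> (\<rho> x)"
    using moved_orbit_eq[OF S t] by (auto simp: S_def)
  define \<phi> where "\<phi> = \<tau> \<circ> \<rho> \<circ> inv_into UNIV \<sigma>"
  have "\<phi> \<in> aut X" using r t s unfolding \<phi>_def stabilizer_def by (auto intro!: aut_comp aut_inv)
  moreover have "\<phi> i = j" using r t s aut_inverses(2)[OF s(1), of 0] by (simp add: \<phi>_def stabilizer_def)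
  moreover have "\<phi> v = w" using r x by (simp add: \<phi>_def x_def)
  ultimately show ?thesis by (auto simp: same_orbital_def)
qed

text \<open>The vertex \<open>k\<close> is determined by its relation to \<open>a\<close> and its relation to \<open>c\<close>; this is what the
  one-point intersections of labelled orbits express, in a form invariant under automorphisms.\<close>

definition pins_down :: "nat pair_pre_digraph \<Rightarrow> nat \<Rightarrow> nat \<Rightarrow> nat \<Rightarrow> bool" where
  "pins_down X a c k \<longleftrightarrow> (\<forall>v. same_orbital X (k, a) (v, a) \<longrightarrow> same_orbital X (k, c) (v, c) \<longrightarrow> v = k)"

lemma pins_down_transport:
  assumes pin: "pins_down X a c k" and s: "\<sigma> \<in> aut X"
    and v: "same_orbital X (k, a) (v, \<sigma> a)" "same_orbital X (k, c) (v, \<sigma> c)"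
  shows "v = \<sigma> k"
proof -
  have "same_orbital X (k, x) (inv_into UNIV \<sigma> v, x)" if "same_orbital X (k, x) (v, \<sigma> x)" for x
    using that same_orbital_map(2)[OF aut_inv[OF s], of "(k, x)" v "\<sigma> x"] aut_inverses[OF s] by simp
  then have "inv_into UNIV \<sigma> v = k" using pin v by (simp add: pins_down_def)
  then show ?thesis using aut_inverses(1)[OF s] by metis
qed

lemma pins_down_map:
  assumes "pins_down X a c k" and "\<sigma> \<in> aut X"
  shows "pins_down X (\<sigma> a) (\<sigma> c) (\<sigma> k)"
  using pins_down_transport[OF assms] same_orbital_map(1)[OF assms(2)] by (simp add: pins_down_def)

lemma pins_down_of_orbits:
  assumes X: "vertex_transitive X" "0 \<in> pverts X" "a \<in> pverts X" "c \<in> pverts X"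
    and S: "S \<in> orbits_0 X" "S' \<in> orbits_0 X"
    and inter: "moved_orbit X S a \<inter> moved_orbit X S' c = {k}"
  shows "pins_down X a c k"
  unfolding pins_down_def
proof (intro allI impI)
  fix v assume v: "same_orbital X (k, a) (v, a)" "same_orbital X (k, c) (v, c)"
  have "v \<in> moved_orbit X S a"
    by (rule moved_orbit_same_orbital[OF S(1) X(1-3) v(1)]) (use inter in blast)
  moreover have "v \<in> moved_orbit X S' c"
    by (rule moved_orbit_same_orbital[OF S(2) X(1,2,4) v(2)]) (use inter in blast)
  ultimately show "v = k" using inter by blast
qed

text \<open>The hypothesis speaks of one triangle \<open>0, j, k\<close> for each orbit of the stabilizer of \<open>0\<close>. Every
  ordered pair of distinct vertices is an automorphic image of one of the pairs \<open>(0, j)\<close>, and the image of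
  \<open>k\<close> completes it to a triangle in which each vertex is determined by the other two.\<close>

lemma rigid_triangles:
  assumes X: "graph_on n X" "vertex_transitive X" and L: "orbit_labelling X r L"
    and tri: "\<forall>s\<in>{1..r}. \<exists>j\<in>labelled_orbit X L 0 s. \<exists>k\<in>{..<n}.
      \<exists>t1\<in>{0..r}. \<exists>t2\<in>{0..r}. \<exists>t3\<in>{0..r}. \<exists>t4\<in>{0..r}. \<exists>t5\<in>{0..r}.
        labelled_orbit X L 0 t1 \<inter> labelled_orbit X L j t2 = {k} \<and>
        labelled_orbit X L 0 s \<inter> labelled_orbit X L k t4 = {j} \<and>
        labelled_orbit X L k t5 \<inter> labelled_orbit X L j t3 = {0}"
    and ac: "a < n" "c < n" "a \<noteq> c"
  shows "\<exists>k<n. pins_down X a c k \<and> pins_down X a k c \<and> pins_down X k c a"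
proof -
  have V: "pverts X = {..<n}" using X by (simp add: graph_on_def)
  have 0: "0 \<in> pverts X" using V ac by auto
  have orb: "L t \<in> orbits_0 X" if "t \<in> {0..r}" for t
    using L that unfolding orbit_labelling_def bij_betw_def by blast
  obtain \<sigma> where s: "\<sigma> \<in> aut X" "\<sigma> 0 = a" using X(2) 0 ac V unfolding vertex_transitive_def by blast
  define c' where "c' = inv_into UNIV \<sigma> c"
  have c': "c' < n" "\<sigma> c' = c"
    using ac s V aut_pverts[OF aut_inv[OF s(1)]] aut_inverses[OF s(1)] by (auto simp: c'_def)
  have c0: "c' \<noteq> 0" using c'(2) s(2) ac(3) by metis
  define S where "S = (\<lambda>\<rho>. \<rho> c') ` stabilizer X 0"
  have "c' \<in> S" using aut_id[of X] by (auto simp: S_def stabilizer_def image_iff intro!: bexI[of _ id])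
  have "S \<in> orbits_0 X" using c' V by (auto simp: S_def orbits_0_def)
  then have "S \<in> L ` {0..r}" using L by (simp add: orbit_labelling_def bij_betw_def)
  then obtain t where t: "t \<in> {0..r}" "L t = S" by blast
  have "L 0 = {0}" using L by (simp add: orbit_labelling_def)
  then have "t \<noteq> 0" using t(2) \<open>c' \<in> S\<close> c0 by (metis singletonD)
  then have t1r: "t \<in> {1..r}" using t(1) by simp
  note bspec[OF tri t1r]
  then obtain j where j: "j \<in> labelled_orbit X L 0 t" and ex: "\<exists>k\<in>{..<n}.
      \<exists>t1\<in>{0..r}. \<exists>t2\<in>{0..r}. \<exists>t3\<in>{0..r}. \<exists>t4\<in>{0..r}. \<exists>t5\<in>{0..r}.
        labelled_orbit X L 0 t1 \<inter> labelled_orbit X L j t2 = {k} \<and>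
        labelled_orbit X L 0 t \<inter> labelled_orbit X L k t4 = {j} \<and>
        labelled_orbit X L k t5 \<inter> labelled_orbit X L j t3 = {0}"
    by (rule bexE)
  from ex obtain k t1 t2 t3 t4 t5
    where k: "k \<in> {..<n}"
      and ts: "t1 \<in> {0..r}" "t2 \<in> {0..r}" "t3 \<in> {0..r}" "t4 \<in> {0..r}" "t5 \<in> {0..r}"
      and i1: "labelled_orbit X L 0 t1 \<inter> labelled_orbit X L j t2 = {k}"
      and i2: "labelled_orbit X L 0 t \<inter> labelled_orbit X L k t4 = {j}"
      and i3: "labelled_orbit X L k t5 \<inter> labelled_orbit X L j t3 = {0}"
    by (elim bexE conjE) (rule that)
  have "j \<in> S" using j moved_orbit_0[OF orb[OF t(1)]] t by simp
  then obtain \<rho> where r: "\<rho> \<in> stabilizer X 0" "j = \<rho> c'" by (auto simp: S_def)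
  then have r': "\<rho> \<in> aut X" "\<rho> 0 = 0" by (auto simp: stabilizer_def)
  have jV: "j \<in> pverts X" using r(2) aut_pverts[OF r'(1), of c'] c'(1) V by simp
  have kV: "k \<in> pverts X" using k V by simp
  \<comment> \<open>\<open>\<rho>\<close> aligns \<open>c'\<close> with the representative \<open>j\<close> of its orbit, and \<open>\<sigma>\<close> takes \<open>(0, c')\<close> to \<open>(a, c)\<close>.\<close>
  define \<phi> where "\<phi> = \<sigma> \<circ> inv_into UNIV \<rho>"
  have f: "\<phi> \<in> aut X" unfolding \<phi>_def by (intro aut_comp s aut_inv r')
  have f0: "\<phi> 0 = a" using aut_inverses(2)[OF r'(1), of 0] r' s by (simp add: \<phi>_def)
  have fj: "\<phi> j = c" using r aut_inverses(2)[OF r'(1)] c' by (simp add: \<phi>_def)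
  have "pins_down X 0 j k" "pins_down X 0 k j" "pins_down X k j 0"
    by (rule pins_down_of_orbits[OF X(2) 0 0 jV orb[OF ts(1)] orb[OF ts(2)] i1]
        pins_down_of_orbits[OF X(2) 0 0 kV orb[OF t(1)] orb[OF ts(4)] i2]
        pins_down_of_orbits[OF X(2) 0 kV jV orb[OF ts(5)] orb[OF ts(3)] i3])+
  from this[THEN pins_down_map[OF _ f]]
  have "pins_down X a c (\<phi> k) \<and> pins_down X a (\<phi> k) c \<and> pins_down X (\<phi> k) c a"
    by (simp add: f0 fj)
  moreover have "\<phi> k < n" using aut_pverts[OF f, of k] k V by simp
  ultimately show ?thesis by blast
qed

section \<open>Zero products of magic unitary entries\<close>

lemma (in ring) sandwiched_sum:
  assumes B: "finite B" and p: "p \<in> carrier R" and q: "q \<in> carrier R"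
    and r: "\<And>v. v \<in> B \<Longrightarrow> r v \<in> carrier R"
    and c: "c \<in> B" and other: "\<And>v. \<lbrakk>v \<in> B; v \<noteq> c\<rbrakk> \<Longrightarrow> p \<otimes> r v \<otimes> q = \<zero>"
  shows "p \<otimes> finsum R r B \<otimes> q = p \<otimes> r c \<otimes> q"
proof -
  have "p \<otimes> finsum R r B \<otimes> q = (\<Oplus>v\<in>B. p \<otimes> r v \<otimes> q)"
    using r p q by (subst finsum_rdistr[OF B p]) (auto simp: finsum_ldistr[OF B q])
  also have "\<dots> = (\<Oplus>v\<in>B. if c = v then p \<otimes> r v \<otimes> q else \<zero>)"
    using r p q other by (intro finsum_cong') auto
  also have "\<dots> = p \<otimes> r c \<otimes> q"
    by (rule finsum_singleton[OF c B]) (use r p q in auto)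
  finally show ?thesis .
qed

text \<open>The intertwining relation at position \<open>(i, l)\<close>, multiplied by \<open>u i j\<close> on the left and by \<open>u k l\<close>
  on the right, keeps by orthogonality only the term \<open>t i k\<close> on one side and \<open>t j l\<close> on the other.\<close>

lemma (in ring) magic_intertwiner_vanishing:
  fixes n :: nat
  assumes u: "\<And>i j. \<lbrakk>i < n; j < n\<rbrakk> \<Longrightarrow> u i j \<in> carrier R \<and> u i j \<otimes> u i j = u i j"
    and orth: "\<And>i j k. \<lbrakk>i < n; j < n; k < n; j \<noteq> k\<rbrakk> \<Longrightarrow> u i j \<otimes> u i k = \<zero> \<and> u j i \<otimes> u k i = \<zero>"
    and t: "\<And>i j. \<lbrakk>i < n; j < n\<rbrakk> \<Longrightarrow>
      (\<Oplus>k\<in>{..<n}. if t i k then u k j else \<zero>) = (\<Oplus>k\<in>{..<n}. if t k j then u i k else \<zero>)"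
    and lt: "i < n" "j < n" "k < n" "l < n" and ne: "t i k \<noteq> t j l"
  shows "u i j \<otimes> u k l = \<zero>"
proof -
  have ij: "u i j \<in> carrier R" and kl: "u k l \<in> carrier R" using u lt by auto
  have assoc: "u i j \<otimes> x \<otimes> u k l = u i j \<otimes> (x \<otimes> u k l)" if "x \<in> carrier R" for x
    using that ij kl by (simp add: m_assoc)
  have "u i j \<otimes> (\<Oplus>m\<in>{..<n}. if t i m then u m l else \<zero>) \<otimes> u k l
      = u i j \<otimes> (if t i k then u k l else \<zero>) \<otimes> u k l"
    by (rule sandwiched_sum) (use lt u ij kl orth in \<open>auto simp: assoc\<close>)
  moreover have "u i j \<otimes> (\<Oplus>m\<in>{..<n}. if t m l then u i m else \<zero>) \<otimes> u k l
      = u i j \<otimes> (if t j l then u i j else \<zero>) \<otimes> u k l"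
    by (rule sandwiched_sum) (use lt u ij kl orth in auto)
  ultimately have "u i j \<otimes> (if t i k then u k l else \<zero>) \<otimes> u k l = u i j \<otimes> (if t j l then u i j else \<zero>) \<otimes> u k l"
    using t[OF lt(1,4)] by simp
  moreover have "u i j \<otimes> u k l \<otimes> u k l = u i j \<otimes> u k l" "u i j \<otimes> u i j \<otimes> u k l = u i j \<otimes> u k l"
    using u[OF lt(1,2)] u[OF lt(3,4)] by (simp_all add: m_assoc[of _ "u k l" "u k l"])
  ultimately show ?thesis
    using ne ij kl by (cases "t i k") auto
qed

lemma closed_ideal_generated:
  assumes A: "cstar_algebra A" and S: "S \<subseteq> carrier A"
  shows "ideal (closed_ideal_generated A S) A" and "nrm_closed A (closed_ideal_generated A S)"
proof -
  interpret ring A by (rule cstar_algebra_ring[OF A])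
  have "carrier A \<in> {I. ideal I A \<and> nrm_closed A I \<and> S \<subseteq> I}"
    using S oneideal by (auto simp: nrm_closed_def)
  then show "ideal (closed_ideal_generated A S) A"
    unfolding closed_ideal_generated_def by (intro i_Intersect) auto
  show "nrm_closed A (closed_ideal_generated A S)"
    unfolding closed_ideal_generated_def nrm_closed_def by blast
qed

lemma A_ideal_closed_ideal: "ideal (A_ideal n X) (A_s n)" "nrm_closed (A_s n) (A_ideal n X)"
proof -
  interpret ring "A_s n" by (rule cstar_algebra_ring[OF cstar_algebra_A_s])
  let ?S = "{scalar_mat_mult (A_s n) n (adjacency_matrix n X) (A_s_entry n) i j
          \<ominus>\<^bsub>A_s n\<^esub> mat_scalar_mult (A_s n) n (A_s_entry n) (adjacency_matrix n X) i j | i j. i < n \<and> j < n}"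
  have "?S \<subseteq> carrier (A_s n)"
    by (auto simp: scalar_mat_mult_def mat_scalar_mult_def A_s_entry_closed
        intro!: minus_closed finsum_closed cstar_smult(1)[OF cstar_algebra_A_s])
  from closed_ideal_generated[OF cstar_algebra_A_s this]
  show "ideal (A_ideal n X) (A_s n)" "nrm_closed (A_s n) (A_ideal n X)"
    by (simp_all add: A_ideal_def Let_def)
qed

lemma cstar_quotient_ops:
  "carrier (cstar_quotient A I) = carrier (A Quot I)"
  "monoid.mult (cstar_quotient A I) = monoid.mult (A Quot I)"
  "finsum (cstar_quotient A I) f B = finsum (A Quot I) f B"
  by (simp_all add: cstar_quotient_def finsum_def finprod_def)

text \<open>The scalar multiple of a coset is defined as a union over all representatives, which agree.\<close>

lemma cstar_quotient_smult:
  assumes A: "cstar_algebra A" and I: "ideal I A" and x: "x \<in> carrier A"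
  shows "c \<odot>\<^bsub>cstar_quotient A I\<^esub> (I +>\<^bsub>A\<^esub> x) = I +>\<^bsub>A\<^esub> (c \<odot>\<^bsub>A\<^esub> x)"
proof -
  interpret ideal I A by (rule I)
  have "I +>\<^bsub>A\<^esub> (c \<odot>\<^bsub>A\<^esub> y) = I +>\<^bsub>A\<^esub> (c \<odot>\<^bsub>A\<^esub> x)" if y: "y \<in> I +>\<^bsub>A\<^esub> x" for y
  proof -
    obtain z where z: "z \<in> I" "y = z \<oplus>\<^bsub>A\<^esub> x" using y by (auto simp: a_r_coset_def r_coset_def)
    have "c \<odot>\<^bsub>A\<^esub> y = c \<odot>\<^bsub>A\<^esub> z \<oplus>\<^bsub>A\<^esub> c \<odot>\<^bsub>A\<^esub> x" using z x cstar_smult(3)[OF A _ x] a_Hcarr by simp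
    moreover have "c \<odot>\<^bsub>A\<^esub> z \<in> I" by (rule ideal_smult[OF A I z(1)])
    moreover have "c \<odot>\<^bsub>A\<^esub> x \<in> carrier A" by (rule cstar_smult(1)[OF A x])
    ultimately show ?thesis
      using quot_simps(2,7) quot_simps(1) ring.ring_simprules(8)[OF quotient_is_ring] a_Hcarr by metis
  qed
  then have "(\<Union>y\<in>I +>\<^bsub>A\<^esub> x. I +>\<^bsub>A\<^esub> (c \<odot>\<^bsub>A\<^esub> y)) = I +>\<^bsub>A\<^esub> (c \<odot>\<^bsub>A\<^esub> x)"
    by (intro UN_constant_eq[OF a_rcos_self[OF x]] ballI)
  then show ?thesis by (simp add: cstar_quotient_def)
qed

lemma quotient_magic_unitary:
  assumes A: "cstar_algebra A" and I: "ideal I A" and u: "magic_unitary A n u"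
  defines "R \<equiv> A Quot I"
  shows "\<lbrakk>i < n; j < n\<rbrakk> \<Longrightarrow> I +>\<^bsub>A\<^esub> u i j \<in> carrier R \<and>
      (I +>\<^bsub>A\<^esub> u i j) \<otimes>\<^bsub>R\<^esub> (I +>\<^bsub>A\<^esub> u i j) = I +>\<^bsub>A\<^esub> u i j"
    and "\<lbrakk>i < n; j < n; k < n; j \<noteq> k\<rbrakk> \<Longrightarrow>
      (I +>\<^bsub>A\<^esub> u i j) \<otimes>\<^bsub>R\<^esub> (I +>\<^bsub>A\<^esub> u i k) = \<zero>\<^bsub>R\<^esub> \<and>
      (I +>\<^bsub>A\<^esub> u j i) \<otimes>\<^bsub>R\<^esub> (I +>\<^bsub>A\<^esub> u k i) = \<zero>\<^bsub>R\<^esub>"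
    and "i < n \<Longrightarrow> (\<Oplus>\<^bsub>R\<^esub>j\<in>{..<n}. I +>\<^bsub>A\<^esub> u i j) = \<one>\<^bsub>R\<^esub>"
proof -
  interpret I: ideal I A by (rule I)
  interpret Q: ring R unfolding R_def by (rule I.quotient_is_ring)
  note q = I.quot_simps[folded R_def]
  have cl: "u i j \<in> carrier A" if "i < n" "j < n" for i j
    using u that by (simp add: magic_unitary_def)
  show "\<lbrakk>i < n; j < n\<rbrakk> \<Longrightarrow> I +>\<^bsub>A\<^esub> u i j \<in> carrier R \<and>
      (I +>\<^bsub>A\<^esub> u i j) \<otimes>\<^bsub>R\<^esub> (I +>\<^bsub>A\<^esub> u i j) = I +>\<^bsub>A\<^esub> u i j"
    using u cl by (simp add: q(1) q(3)[symmetric] magic_unitary_def)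
  show "\<lbrakk>i < n; j < n; k < n; j \<noteq> k\<rbrakk> \<Longrightarrow>
      (I +>\<^bsub>A\<^esub> u i j) \<otimes>\<^bsub>R\<^esub> (I +>\<^bsub>A\<^esub> u i k) = \<zero>\<^bsub>R\<^esub> \<and>
      (I +>\<^bsub>A\<^esub> u j i) \<otimes>\<^bsub>R\<^esub> (I +>\<^bsub>A\<^esub> u k i) = \<zero>\<^bsub>R\<^esub>"
    using u cl by (simp add: q(3)[symmetric] magic_unitary_def q(6))
  have sum: "finite S \<Longrightarrow> (\<And>v. v \<in> S \<Longrightarrow> f v \<in> carrier A) \<Longrightarrow>
      I +>\<^bsub>A\<^esub> finsum A f S = (\<Oplus>\<^bsub>R\<^esub>v\<in>S. I +>\<^bsub>A\<^esub> f v)" for f and S :: "nat set"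
    by (induction S rule: finite_induct) (simp_all add: q(1,2,6) Pi_def)
  show "i < n \<Longrightarrow> (\<Oplus>\<^bsub>R\<^esub>j\<in>{..<n}. I +>\<^bsub>A\<^esub> u i j) = \<one>\<^bsub>R\<^esub>"
    using sum[of "{..<n}" "u i"] cl u by (simp add: magic_unitary_def q(5))
qed

lemma orbit_matrix_in_T_space:
  assumes "S \<in> orbits_0 X"
  shows "orbit_matrix n X S \<in> T_space n X"
proof -
  interpret V: vectorspace "class_ring :: complex ring" "module_mat TYPE(complex) n n" by (rule matrix_vs)
  have "orbit_matrix n X ` orbits_0 X \<subseteq> carrier (module_mat TYPE(complex) n n)"
    by (auto simp: orbit_matrix_def module_mat_simps)
  then show ?thesis using V.in_own_span assms unfolding T_space_def by blast
qed

text \<open>This is where \<open>B_clos\<close> enters: every orbit matrix is an intertwiner, and some orbit matrix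
  separates two pairs in different orbitals.\<close>

lemma A_graph_entries_vanish:
  assumes X: "B_clos n X" and lt: "i < n" "j < n" "k < n" "l < n"
    and ne: "\<not> same_orbital X (i, k) (j, l)"
  defines "R \<equiv> A_s n Quot A_ideal n X"
  shows "A_graph_entry n X i j \<otimes>\<^bsub>R\<^esub> A_graph_entry n X k l = \<zero>\<^bsub>R\<^esub>"
proof -
  note I = A_ideal_closed_ideal(1)[of n X] and A = cstar_algebra_A_s[of n]
  interpret I: ideal "A_ideal n X" "A_s n" by (rule I)
  interpret R: ring R unfolding R_def by (rule I.quotient_is_ring)
  note q = I.quot_simps[folded R_def]
  let ?u = "A_graph_entry n X"
  note m = quotient_magic_unitary[OF A I A_s_magic_unitary, folded R_def A_graph_entry_def]
  have V: "pverts X = {..<n}" and vt: "vertex_transitive X" and int: "intertwiners n X = T_space n X"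
    using X by (simp_all add: B_clos_def graph_on_def)
  \<comment> \<open>A separating orbit can be chosen to contain the first pair.\<close>
  have "\<exists>S\<in>orbits_0 X. i \<in> moved_orbit X S k \<and> j \<notin> moved_orbit X S l"
    using same_orbitalI[OF vt, of k l i j] ne lt V by auto
  then obtain S where S: "S \<in> orbits_0 X" and sep: "i \<in> moved_orbit X S k" "j \<notin> moved_orbit X S l"
    by blast
  let ?T = "orbit_matrix n X S" and ?t = "\<lambda>a b. a \<in> moved_orbit X S b"
  have T: "?T \<in> intertwiners n X" unfolding int by (rule orbit_matrix_in_T_space[OF S])
  have entry: "?T $$ (a, b) = (if ?t a b then 1 else 0)" if "a < n" "b < n" for a b
    using that by (simp add: orbit_matrix_def)
  have sc: "?T $$ (a, b) \<odot>\<^bsub>A_graph n X\<^esub> ?u c d = (if ?t a b then ?u c d else \<zero>\<^bsub>R\<^esub>)"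
    if "a < n" "b < n" "c < n" "d < n" for a b c d
    using cstar_quotient_smult[OF A I A_s_entry_closed[OF that(3,4)]]
      cstar_smult(5,6)[OF A A_s_entry_closed[OF that(3,4)]] q(6)
    by (simp add: entry[OF that(1,2)] A_graph_def A_graph_entry_def)
  have sums: "(\<Oplus>\<^bsub>R\<^esub>k\<in>{..<n}. if ?t i k then ?u k j else \<zero>\<^bsub>R\<^esub>)
      = (\<Oplus>\<^bsub>R\<^esub>k\<in>{..<n}. if ?t k j then ?u i k else \<zero>\<^bsub>R\<^esub>)" if "i < n" "j < n" for i j
  proof -
    have "(\<Oplus>\<^bsub>R\<^esub>k\<in>{..<n}. if ?t i k then ?u k j else \<zero>\<^bsub>R\<^esub>)
        = (\<Oplus>\<^bsub>R\<^esub>k\<in>{..<n}. ?T $$ (i, k) \<odot>\<^bsub>A_graph n X\<^esub> ?u k j)"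
      using that m(1) by (intro R.finsum_cong') (auto simp: sc)
    also have "\<dots> = scalar_mat_mult (A_graph n X) n ?T ?u i j"
      by (simp add: scalar_mat_mult_def A_graph_def cstar_quotient_ops R_def)
    also have "\<dots> = mat_scalar_mult (A_graph n X) n ?u ?T i j"
      using T that by (simp add: intertwiners_def)
    also have "\<dots> = (\<Oplus>\<^bsub>R\<^esub>k\<in>{..<n}. ?T $$ (k, j) \<odot>\<^bsub>A_graph n X\<^esub> ?u i k)"
      by (simp add: mat_scalar_mult_def A_graph_def cstar_quotient_ops R_def)
    also have "\<dots> = (\<Oplus>\<^bsub>R\<^esub>k\<in>{..<n}. if ?t k j then ?u i k else \<zero>\<^bsub>R\<^esub>)"
      using that m(1) by (intro R.finsum_cong') (auto simp: sc)
    finally show ?thesis .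
  qed
  show ?thesis
    by (rule R.magic_intertwiner_vanishing[of n ?u ?t]) (use m(1,2) sums lt sep in auto)
qed

text \<open>Insert the sum \<open>1\<close> of row \<open>k\<close> between the two factors. A summand \<open>u k v\<close> survives only if \<open>v\<close> is
  related to \<open>\<sigma> a\<close> and \<open>\<sigma> c\<close> as \<open>k\<close> is to \<open>a\<close> and \<open>c\<close>, and this forces \<open>v = \<sigma> k\<close>.\<close>

lemma pinned_product:
  assumes X: "B_clos n X" and lt: "a < n" "c < n" "k < n" and s: "\<sigma> \<in> aut X"
    and pin: "pins_down X a c k"
  defines "R \<equiv> A_s n Quot A_ideal n X" and "P \<equiv> \<lambda>i. A_graph_entry n X i (\<sigma> i)"
  shows "P a \<otimes>\<^bsub>R\<^esub> P k \<otimes>\<^bsub>R\<^esub> P c = P a \<otimes>\<^bsub>R\<^esub> P c"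
proof -
  note I = A_ideal_closed_ideal(1)[of n X] and A = cstar_algebra_A_s[of n]
  interpret I: ideal "A_ideal n X" "A_s n" by (rule I)
  interpret R: ring R unfolding R_def by (rule I.quotient_is_ring)
  note m = quotient_magic_unitary[OF A I A_s_magic_unitary, folded R_def A_graph_entry_def]
  note vanish = A_graph_entries_vanish[OF X, folded R_def]
  have V: "pverts X = {..<n}" using X by (simp add: B_clos_def graph_on_def)
  have sn: "\<sigma> i < n" if "i < n" for i using aut_pverts[OF s, of i] that V by simp
  have Pc: "P i \<in> carrier R" if "i < n" for i using m(1) sn that by (simp add: P_def)
  have zero: "P a \<otimes>\<^bsub>R\<^esub> A_graph_entry n X k v \<otimes>\<^bsub>R\<^esub> P c = \<zero>\<^bsub>R\<^esub>" if v: "v \<in> {..<n}" "v \<noteq> \<sigma> k" for v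
  proof -
    have vn: "v < n" using v by simp
    have r: "A_graph_entry n X k v \<in> carrier R" using m(1)[OF lt(3) vn] by simp
    have "\<not> same_orbital X (k, a) (v, \<sigma> a) \<or> \<not> same_orbital X (k, c) (v, \<sigma> c)"
      using pins_down_transport[OF pin s] v by blast
    then show ?thesis
    proof
      assume "\<not> same_orbital X (k, a) (v, \<sigma> a)"
      then have "P a \<otimes>\<^bsub>R\<^esub> A_graph_entry n X k v = \<zero>\<^bsub>R\<^esub>"
        unfolding P_def using same_orbital_swap by (intro vanish lt vn sn) blast
      then show ?thesis using Pc lt by simp
    next
      assume "\<not> same_orbital X (k, c) (v, \<sigma> c)"
      then have "A_graph_entry n X k v \<otimes>\<^bsub>R\<^esub> P c = \<zero>\<^bsub>R\<^esub>"
        unfolding P_def by (intro vanish lt vn sn)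
      then show ?thesis using Pc lt r by (simp add: R.m_assoc)
    qed
  qed
  have "P a \<otimes>\<^bsub>R\<^esub> (\<Oplus>\<^bsub>R\<^esub>v\<in>{..<n}. A_graph_entry n X k v) \<otimes>\<^bsub>R\<^esub> P c = P a \<otimes>\<^bsub>R\<^esub> A_graph_entry n X k (\<sigma> k) \<otimes>\<^bsub>R\<^esub> P c"
    by (rule R.sandwiched_sum) (use Pc lt m(1) sn zero in auto)
  moreover have "A_graph_entry n X k (\<sigma> k) = P k" by (simp add: P_def)
  ultimately show ?thesis using m(3)[OF lt(3)] Pc lt by simp
qed

text \<open>With \<open>P\<close>, \<open>Q\<close>, \<open>K\<close> for the entries at \<open>a\<close>, \<open>c\<close>, \<open>k\<close>, the three rigid corners give
  \<open>PKQ = PQ\<close>, \<open>PQK = PK\<close> and \<open>KPQ = KQ\<close>, and the first one also gives \<open>QKP = QP\<close>. Therefore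
  \<open>PQ = PKQ = PQKQ = PQKPQ = PQPQ\<close>.\<close>

lemma triangle_idempotent:
  assumes X: "B_clos n X" and lt: "a < n" "c < n" "k < n" and s: "\<sigma> \<in> aut X"
    and pins: "pins_down X a c k" "pins_down X a k c" "pins_down X k c a"
  defines "R \<equiv> A_s n Quot A_ideal n X" and "P \<equiv> \<lambda>i. A_graph_entry n X i (\<sigma> i)"
  shows "P a \<otimes>\<^bsub>R\<^esub> P c \<otimes>\<^bsub>R\<^esub> P a \<otimes>\<^bsub>R\<^esub> P c = P a \<otimes>\<^bsub>R\<^esub> P c"
    and "P c \<otimes>\<^bsub>R\<^esub> P a \<otimes>\<^bsub>R\<^esub> P c \<otimes>\<^bsub>R\<^esub> P a = P c \<otimes>\<^bsub>R\<^esub> P a"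
proof -
  note I = A_ideal_closed_ideal(1)[of n X] and A = cstar_algebra_A_s[of n]
  interpret I: ideal "A_ideal n X" "A_s n" by (rule I)
  interpret R: ring R unfolding R_def by (rule I.quotient_is_ring)
  note m = quotient_magic_unitary[OF A I A_s_magic_unitary, folded R_def A_graph_entry_def]
  have V: "pverts X = {..<n}" using X by (simp add: B_clos_def graph_on_def)
  have sn: "\<sigma> i < n" if "i < n" for i using aut_pverts[OF s, of i] that V by simp
  have Pc: "P i \<in> carrier R" "P i \<otimes>\<^bsub>R\<^esub> P i = P i" if "i < n" for i
    using m(1)[OF that sn[OF that]] by (simp_all add: P_def)
  have swap: "pins_down X y x z" if "pins_down X x y z" for x y z
    using that by (simp add: pins_down_def)
  have ins: "P x \<otimes>\<^bsub>R\<^esub> P z \<otimes>\<^bsub>R\<^esub> P y = P x \<otimes>\<^bsub>R\<^esub> P y"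
    if "pins_down X x y z" "x < n" "y < n" "z < n" for x y z
    unfolding R_def P_def by (rule pinned_product[OF X that(2-4) s that(1)])
  have key: "P x \<otimes>\<^bsub>R\<^esub> P y \<otimes>\<^bsub>R\<^esub> P x \<otimes>\<^bsub>R\<^esub> P y = P x \<otimes>\<^bsub>R\<^esub> P y"
    if xy: "x < n" "y < n" and z: "z < n"
      and p: "pins_down X x y z" "pins_down X x z y" "pins_down X z y x" for x y z
  proof -
    note [simp] = Pc(1)[OF xy(1)] Pc(1)[OF xy(2)] Pc(1)[OF z]
    have "P x \<otimes>\<^bsub>R\<^esub> P y = P x \<otimes>\<^bsub>R\<^esub> P z \<otimes>\<^bsub>R\<^esub> P y" using ins[OF p(1) xy z] by simp
    also have "\<dots> = P x \<otimes>\<^bsub>R\<^esub> P y \<otimes>\<^bsub>R\<^esub> P z \<otimes>\<^bsub>R\<^esub> P y" using ins[OF p(2) xy(1) z xy(2)] by simp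
    also have "\<dots> = P x \<otimes>\<^bsub>R\<^esub> P y \<otimes>\<^bsub>R\<^esub> (P z \<otimes>\<^bsub>R\<^esub> P x \<otimes>\<^bsub>R\<^esub> P y)"
      using ins[OF p(3) z xy(2) xy(1)] by (simp add: R.m_assoc)
    also have "\<dots> = P x \<otimes>\<^bsub>R\<^esub> (P y \<otimes>\<^bsub>R\<^esub> P z \<otimes>\<^bsub>R\<^esub> P x) \<otimes>\<^bsub>R\<^esub> P y" by (simp add: R.m_assoc)
    also have "\<dots> = P x \<otimes>\<^bsub>R\<^esub> P y \<otimes>\<^bsub>R\<^esub> P x \<otimes>\<^bsub>R\<^esub> P y"
      using ins[OF swap[OF p(1)] xy(2,1) z] by (simp add: R.m_assoc)
    finally show ?thesis by simp
  qed
  show "P a \<otimes>\<^bsub>R\<^esub> P c \<otimes>\<^bsub>R\<^esub> P a \<otimes>\<^bsub>R\<^esub> P c = P a \<otimes>\<^bsub>R\<^esub> P c"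
    by (rule key[OF lt pins])
  show "P c \<otimes>\<^bsub>R\<^esub> P a \<otimes>\<^bsub>R\<^esub> P c \<otimes>\<^bsub>R\<^esub> P a = P c \<otimes>\<^bsub>R\<^esub> P a"
    by (rule key[OF lt(2,1,3) swap[OF pins(1)] swap[OF pins(3)] swap[OF pins(2)]])
qed

theorem theorem9p1:
  fixes n r :: nat and X :: "nat pair_pre_digraph" and L :: "nat \<Rightarrow> nat set"
  assumes "B_clos n X"
    and "orbit_labelling X r L"
    and "\<forall>s\<in>{1..r}. \<exists>j\<in>labelled_orbit X L 0 s. \<exists>k\<in>{..<n}.
      \<exists>t1\<in>{0..r}. \<exists>t2\<in>{0..r}. \<exists>t3\<in>{0..r}. \<exists>t4\<in>{0..r}. \<exists>t5\<in>{0..r}.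
        labelled_orbit X L 0 t1 \<inter> labelled_orbit X L j t2 = {k} \<and>
        labelled_orbit X L 0 s \<inter> labelled_orbit X L k t4 = {j} \<and>
        labelled_orbit X L k t5 \<inter> labelled_orbit X L j t3 = {0}"
  shows "no_quantum_symmetry n X"
proof -
  note A = cstar_algebra_A_s[of n] and I = A_ideal_closed_ideal[of n X]
  interpret I: ideal "A_ideal n X" "A_s n" by (rule I(1))
  define R where "R = A_s n Quot A_ideal n X"
  note q = I.quot_simps[folded R_def]
  have X: "graph_on n X" "vertex_transitive X" using assms(1) by (simp_all add: B_clos_def)
  let ?u = "A_graph_entry n X" and ?v = "A_s_entry n"
  note v = A_s_entry_closed[of _ n]
  have proj: "star (A_s n) (?v i j) = ?v i j" "?v i j \<otimes>\<^bsub>A_s n\<^esub> ?v i j = ?v i j" if "i < n" "j < n" for i j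
    using A_s_magic_unitary[of n] that by (simp_all add: magic_unitary_def)
  have com: "?u a b \<otimes>\<^bsub>R\<^esub> ?u c d = ?u c d \<otimes>\<^bsub>R\<^esub> ?u a b"
    if lt: "a < n" "b < n" "c < n" "d < n" for a b c d
  proof (cases "same_orbital X (a, c) (b, d)")
    case False
    moreover from False have "\<not> same_orbital X (c, a) (d, b)" using same_orbital_swap by blast
    ultimately show ?thesis
      using A_graph_entries_vanish[OF assms(1)] lt by (simp add: R_def)
  next
    case True
    then obtain \<sigma> where s: "\<sigma> \<in> aut X" "b = \<sigma> a" "d = \<sigma> c" by (auto simp: same_orbital_def)
    show ?thesis
    proof (cases "a = c")
      case True
      then show ?thesis using s by simp
    next
      case False
      from rigid_triangles[OF X assms(2,3) lt(1,3) False] obtain k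
        where k: "k < n" "pins_down X a c k" "pins_down X a k c" "pins_down X k c a"
        by blast
      show ?thesis
        using projections_commute_mod_closed_ideal[OF A I v[OF lt(1,2)] proj[OF lt(1,2)]
            v[OF lt(3,4)] proj[OF lt(3,4)]]
          triangle_idempotent[OF assms(1) lt(1,3) k(1) s(1) k(2-4)]
        unfolding R_def A_graph_entry_def s(2,3) by blast
    qed
  qed
  have "commutator (A_s n) x y \<in> A_ideal n X" if "x \<in> carrier (A_s n)" "y \<in> carrier (A_s n)" for x y
  proof (rule quotient_commutative_if_generators_commute[OF A I _ _ A_s_generated _ that])
    show "A_s_entries n \<subseteq> carrier (A_s n)" using v by blast
    show "star (A_s n) s = s" if "s \<in> A_s_entries n" for s using that proj by blast
    show "commutator (A_s n) s t \<in> A_ideal n X" if st: "s \<in> A_s_entries n" "t \<in> A_s_entries n" for s t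
    proof -
      obtain a b c d where lt: "a < n" "b < n" "c < n" "d < n" and e: "s = ?v a b" "t = ?v c d"
        using st by blast
      show ?thesis
        using com[OF lt] v[OF lt(1,2)] v[OF lt(3,4)] q(8)[of "s \<otimes>\<^bsub>A_s n\<^esub> t" "t \<otimes>\<^bsub>A_s n\<^esub> s"]
        by (simp add: commutator_def e A_graph_entry_def q(3))
    qed
  qed
  then have "(A_ideal n X +>\<^bsub>A_s n\<^esub> x) \<otimes>\<^bsub>R\<^esub> (A_ideal n X +>\<^bsub>A_s n\<^esub> y)
      = (A_ideal n X +>\<^bsub>A_s n\<^esub> y) \<otimes>\<^bsub>R\<^esub> (A_ideal n X +>\<^bsub>A_s n\<^esub> x)"
    if "x \<in> carrier (A_s n)" "y \<in> carrier (A_s n)" for x y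
    using that q(8)[of "x \<otimes>\<^bsub>A_s n\<^esub> y" "y \<otimes>\<^bsub>A_s n\<^esub> x"] by (simp add: commutator_def q(3))
  then show ?thesis
    by (auto simp: no_quantum_symmetry_def A_graph_def cstar_quotient_ops quotient_carrier R_def)
qed

end
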